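(* Let $R\subset S$ be an integral FCP extension of commutative rings. Then the following conditions are equivalent: (1) $R\subset S$ is u-closed; (2) $R\subset S$ is an $i$-extension; (3) ${}_S^+R={}_S^tR$. If these conditions are satisfied, any minimal subextension of $R\subset S$ (that is, any minimal extension $T\subset U$ with $T,U\in[R,S]$) is either ramified or inert.
   Context: All rings are commutative and unital; $\subset$ denotes proper inclusion. $[R,S]$ is the set of all $R$-subalgebras of $S$, ordered by inclusion; $R\subseteq S$ has FCP if each chain in $[R,S]$ is finite. $R\subseteq S$ is an $i$-extension if $\mathrm{Spec}(S)\to\mathrm{Spec}(R)$ is injective. $R\subseteq S$ is u-closed (anodal) if every $b\in S$ with $b^2-b\in R$ and $b^3-b^2\in R$ lies in $R$. An integral extension is infra-integral if all its residual field extensions $\kappa_R(Q\cap R)\to\kappa_S(Q)$ ($Q\in\mathrm{Spec}(S)$) are isomorphisms, and subintegral if moreover it is an $i$-extension. The seminormalization ${}_S^+R$ (resp. t-closure ${}_S^tR$) is the greatest $B\in[R,S]$ such that $R\subseteq B$ is subintegral (resp. infra-integral). An extension $T\subset U$ is minimal if $[T,U]=\{T,U\}$. A finite minimal extension $T\subset U$ has conductor $M=(T:U)\in\mathrm{Max}(T)$ and is exactly one of: inert ($M\in\mathrm{Max}(U)$ and $T/M\to U/M$ is a minimal field extension); decomposed (there are $M_1,M_2\in\mathrm{Max}(U)$, with $M=M_1\cap M_2$, $M_1\ne M_2$, and $T/M\to U/M_1$, $T/M\to U/M_2$ isomorphisms); ramified (there is $M'\in\mathrm{Max}(U)$ with $M'^2\subseteq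 M\subset M'$, $[U/M:T/M]=2$ and $T/M\to U/M'$ an isomorphism). *)

theory Defs
  imports "HOL-Algebra.Polynomials" "HOL-Algebra.Embedded_Algebras" "HOL-Algebra.Ideal_Product"
    "HOL-Algebra.QuotRing"
begin

text \<open>
  An extension \<open>T \<subseteq> U\<close> is given by two subrings \<open>T\<close>, \<open>U\<close> of an ambient commutative ring \<open>A\<close>;
  the ring structure of a subring \<open>T\<close> is \<open>A\<lparr>carrier := T\<rparr>\<close>.
\<close>

abbreviation sub_ring :: "('a, 'b) ring_scheme \<Rightarrow> 'a set \<Rightarrow> ('a, 'b) ring_scheme" where
  "sub_ring A T \<equiv> A\<lparr>carrier := T\<rparr>"

definition intermediate_rings :: "('a, 'b) ring_scheme \<Rightarrow> 'a set \<Rightarrow> 'a set \<Rightarrow> 'a set set" where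
  "intermediate_rings A T U = {B. subring B A \<and> T \<subseteq> B \<and> B \<subseteq> U}"

definition FCP :: "('a, 'b) ring_scheme \<Rightarrow> 'a set \<Rightarrow> 'a set \<Rightarrow> bool" where
  "FCP A T U \<longleftrightarrow> (\<forall>C. subset.chain (intermediate_rings A T U) C \<longrightarrow> finite C)"

definition minimal_extension :: "('a, 'b) ring_scheme \<Rightarrow> 'a set \<Rightarrow> 'a set \<Rightarrow> bool" where
  "minimal_extension A T U \<longleftrightarrow> T \<subset> U \<and> intermediate_rings A T U = {T, U}"

definition integral_extension :: "('a, 'b) ring_scheme \<Rightarrow> 'a set \<Rightarrow> 'a set \<Rightarrow> bool" where
  "integral_extension A T U \<longleftrightarrow>
     (\<forall>x\<in>U. \<exists>p\<in>carrier (univ_poly A T).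
        p \<noteq> [] \<and> lead_coeff p = \<one>\<^bsub>A\<^esub> \<and> ring.eval A p x = \<zero>\<^bsub>A\<^esub>)"

definition finite_extension :: "('a, 'b) ring_scheme \<Rightarrow> 'a set \<Rightarrow> 'a set \<Rightarrow> bool" where
  "finite_extension A T U \<longleftrightarrow> (\<exists>us. set us \<subseteq> U \<and> ring.Span A T us = U)"

definition u_closed :: "('a, 'b) ring_scheme \<Rightarrow> 'a set \<Rightarrow> 'a set \<Rightarrow> bool" where
  "u_closed A T U \<longleftrightarrow>
     (\<forall>b\<in>U. b [^]\<^bsub>A\<^esub> (2::nat) \<ominus>\<^bsub>A\<^esub> b \<in> T \<longrightarrow>
            b [^]\<^bsub>A\<^esub> (3::nat) \<ominus>\<^bsub>A\<^esub> b [^]\<^bsub>A\<^esub> (2::nat) \<in> T \<longrightarrow> b \<in> T)"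

definition Spec :: "('a, 'b) ring_scheme \<Rightarrow> 'a set set" where
  "Spec A = {P. primeideal P A}"

definition Max_Spec :: "('a, 'b) ring_scheme \<Rightarrow> 'a set set" where
  "Max_Spec A = {M. maximalideal M A}"

definition i_extension :: "('a, 'b) ring_scheme \<Rightarrow> 'a set \<Rightarrow> 'a set \<Rightarrow> bool" where
  "i_extension A T U \<longleftrightarrow> inj_on (\<lambda>Q. Q \<inter> T) (Spec (sub_ring A U))"

text \<open>The fraction \<open>a / s\<close> over a domain \<open>D\<close>, as an equivalence class of pairs.\<close>

definition fraction_class :: "('a, 'b) ring_scheme \<Rightarrow> 'a \<Rightarrow> 'a \<Rightarrow> ('a \<times> 'a) set" where
  "fraction_class D a s = {(b, t). b \<in> carrier D \<and> t \<in> carrier D - {\<zero>\<^bsub>D\<^esub>} \<and> a \<otimes>\<^bsub>D\<^esub> t = b \<otimes>\<^bsub>D\<^esub> s}"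

definition fraction_field :: "('a, 'b) ring_scheme \<Rightarrow> ('a \<times> 'a) set ring" where
  "fraction_field D =
     \<lparr>carrier = {fraction_class D a s | a s. a \<in> carrier D \<and> s \<in> carrier D - {\<zero>\<^bsub>D\<^esub>}},
      mult = (\<lambda>x y. \<Union>(a, s)\<in>x. \<Union>(b, t)\<in>y. fraction_class D (a \<otimes>\<^bsub>D\<^esub> b) (s \<otimes>\<^bsub>D\<^esub> t)),
      one = fraction_class D \<one>\<^bsub>D\<^esub> \<one>\<^bsub>D\<^esub>,
      zero = fraction_class D \<zero>\<^bsub>D\<^esub> \<one>\<^bsub>D\<^esub>,
      add = (\<lambda>x y. \<Union>(a, s)\<in>x. \<Union>(b, t)\<in>y.
               fraction_class D (a \<otimes>\<^bsub>D\<^esub> t \<oplus>\<^bsub>D\<^esub> b \<otimes>\<^bsub>D\<^esub> s) (s \<otimes>\<^bsub>D\<^esub> t))\<rparr>"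

text \<open>The map \<open>a / s \<mapsto> h a / h s\<close> of fraction fields induced by an injective homomorphism
  \<open>h\<close> into a domain \<open>E\<close>.\<close>

definition fraction_map ::
    "('c, 'd) ring_scheme \<Rightarrow> ('a \<Rightarrow> 'c) \<Rightarrow> ('a \<times> 'a) set \<Rightarrow> ('c \<times> 'c) set" where
  "fraction_map E h x = (\<Union>(a, s)\<in>x. fraction_class E (h a) (h s))"

definition residue_field :: "('a, 'b) ring_scheme \<Rightarrow> 'a set \<Rightarrow> ('a set \<times> 'a set) set ring" where
  "residue_field A P = fraction_field (A Quot P)"

text \<open>The canonical map \<open>T/P \<rightarrow> U/Q\<close>, \<open>P + x \<mapsto> Q + x\<close>, for ideals \<open>P \<subseteq> Q\<close> of \<open>T\<close> and \<open>U\<close>;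
  note that \<open>Q + (P + x) = Q + x\<close>.\<close>

definition quot_map :: "('a, 'b) ring_scheme \<Rightarrow> 'a set \<Rightarrow> 'a set \<Rightarrow> 'a set" where
  "quot_map A Q c = Q <+>\<^bsub>A\<^esub> c"

definition residue_map ::
    "('a, 'b) ring_scheme \<Rightarrow> 'a set \<Rightarrow> 'a set \<Rightarrow> ('a set \<times> 'a set) set \<Rightarrow> ('a set \<times> 'a set) set" where
  "residue_map A U Q = fraction_map (sub_ring A U Quot Q) (quot_map A Q)"

definition infra_integral :: "('a, 'b) ring_scheme \<Rightarrow> 'a set \<Rightarrow> 'a set \<Rightarrow> bool" where
  "infra_integral A T U \<longleftrightarrow> integral_extension A T U \<and>
     (\<forall>Q\<in>Spec (sub_ring A U).
        residue_map A U Q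
          \<in> ring_iso (residue_field (sub_ring A T) (Q \<inter> T)) (residue_field (sub_ring A U) Q))"

definition subintegral :: "('a, 'b) ring_scheme \<Rightarrow> 'a set \<Rightarrow> 'a set \<Rightarrow> bool" where
  "subintegral A T U \<longleftrightarrow> infra_integral A T U \<and> i_extension A T U"

definition seminormalization :: "('a, 'b) ring_scheme \<Rightarrow> 'a set \<Rightarrow> 'a set \<Rightarrow> 'a set" where
  "seminormalization A T U = (GREATEST B. B \<in> intermediate_rings A T U \<and> subintegral A T B)"

definition t_closure :: "('a, 'b) ring_scheme \<Rightarrow> 'a set \<Rightarrow> 'a set \<Rightarrow> 'a set" where
  "t_closure A T U = (GREATEST B. B \<in> intermediate_rings A T U \<and> infra_integral A T B)"

definition conductor :: "('a, 'b) ring_scheme \<Rightarrow> 'a set \<Rightarrow> 'a set \<Rightarrow> 'a set" where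
  "conductor A T U = {x \<in> U. \<forall>u\<in>U. x \<otimes>\<^bsub>A\<^esub> u \<in> T}"

text \<open>In the next two definitions, with \<open>M\<close> the conductor, the field \<open>T/M\<close> is regarded as a
  subring of \<open>U/M\<close> through its image under the canonical map.\<close>

definition inert :: "('a, 'b) ring_scheme \<Rightarrow> 'a set \<Rightarrow> 'a set \<Rightarrow> bool" where
  "inert A T U \<longleftrightarrow> finite_extension A T U \<and> minimal_extension A T U \<and>
     (let M = conductor A T U in
        M \<in> Max_Spec (sub_ring A T) \<and> M \<in> Max_Spec (sub_ring A U) \<and>
        minimal_extension (sub_ring A U Quot M)
          (quot_map A M ` carrier (sub_ring A T Quot M)) (carrier (sub_ring A U Quot M)))"

definition ramified :: "('a, 'b) ring_scheme \<Rightarrow> 'a set \<Rightarrow> 'a set \<Rightarrow> bool" where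
  "ramified A T U \<longleftrightarrow> finite_extension A T U \<and> minimal_extension A T U \<and>
     (let M = conductor A T U in
        M \<in> Max_Spec (sub_ring A T) \<and>
        (\<exists>M'\<in>Max_Spec (sub_ring A U).
           ideal_prod (sub_ring A U) M' M' \<subseteq> M \<and> M \<subset> M' \<and>
           ring.dimension (sub_ring A U Quot M) 2
             (quot_map A M ` carrier (sub_ring A T Quot M)) (carrier (sub_ring A U Quot M)) \<and>
           quot_map A M' \<in> ring_iso (sub_ring A T Quot M) (sub_ring A U Quot M')))"

end

theory Submission
  imports Defs
begin

text \<open>
  If \<open>b\<close> is a bad element for u-closedness, \<open>b\<^sup>2 - b \<in> R\<close> and \<open>b\<^sup>3 - b\<^sup>2 \<in> R\<close> but \<open>b \<notin> R\<close>, then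
  modulo the ideal \<open>{r. r b \<in> R}\<close> the element \<open>b\<close> is an idempotent that is free over \<open>R\<close>, so over every
  prime containing this ideal \<open>R[b]\<close> has two primes; by lying over, so has \<open>S\<close>. Moreover
  \<open>R[b]\<close> is infra-integral over \<open>R\<close>, hence contained in the t-closure, and it cannot be contained in the
  seminormalization.

  Conversely, FCP makes \<open>S\<close> strongly \<open>\<pi>\<close>-regular modulo the conductor \<open>(R : S)\<close>: for every \<open>x \<in> S\<close> there
  are \<open>n\<close> and \<open>y\<close> with \<open>x\<^sup>n (1 - y x) \<in> (R : S)\<close>. One descends along minimal steps \<open>T \<subset> T'\<close>, whose conductor
  is a maximal ideal of \<open>T\<close>. Then \<open>e = (y x)\<^sup>n\<close> is idempotent modulo the conductor, hence lies
  in \<open>R\<close> if \<open>R \<subset> S\<close> is u-closed; choosing \<open>x\<close> in one of two primes over the same prime of \<open>R\<close> and not in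
  the other gives a contradiction.

  A minimal i-extension \<open>T \<subset> U\<close> with conductor \<open>M\<close> is \<open>T + T y\<close> with \<open>y\<^sup>2 \<in> M\<close> if \<open>U/M\<close> has a nilpotent \<open>y\<close>
  (ramified); otherwise \<open>M\<close> is the intersection of the primes containing it, all of which lie over \<open>M\<close>, so
  there is only one and \<open>U/M\<close> is a field (inert).
\<close>

subsection \<open>Ideals of subrings\<close>

text \<open>After \<open>residue_map_iso_iff\<close>, residue fields are no longer handled as
  fields: the residue map at \<open>Q\<close> is an isomorphism iff every \<open>b\<close> of the
  larger ring satisfies \<open>s b - t\<close> in \<open>Q\<close> for some \<open>s\<close> in
  \<open>T - Q\<close> and \<open>t\<close> in \<open>T\<close>. The elements with such a congruence
  form a subring, so it suffices to check generators. This shows that composites of infra-integral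
  or subintegral extensions are of the same kind, so that the two \<open>GREATEST\<close> terms
  denote existing rings, and that adjoining a bad element is infra-integral. Condition (3) leads
  back to (1) by applying (2) => (1) to the seminormalization, over which injectivity holds by
  construction. Injectivity passes from \<open>S\<close> to subextensions by lying over. Maximality
  of the conductor of a minimal step comes from Nakayama's lemma. The obstacle in the descent is
  that the conductor of \<open>B \<subset> C\<close> is an ideal of \<open>C\<close>, but in general
  not of \<open>S\<close>; it is enlarged to the ideal of all \<open>w\<close> in \<open>S\<close>
  that multiply the conductor of \<open>C \<subseteq> S\<close> into \<open>B\<close>.\<close>

context cring
begin

lemma subring_is_cring: "subring U R \<Longrightarrow> cring (sub_ring R U)"
  using subcring_iff subcringI' subringE(1) by blast

lemma subring_carrier [dest]: "subring U R \<Longrightarrow> x \<in> U \<Longrightarrow> x \<in> carrier R"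
  using subringE(1) by blast

lemma subring_minus_closed: "\<lbrakk>subring U R; a \<in> U; b \<in> U\<rbrakk> \<Longrightarrow> a \<ominus> b \<in> U"
  by (simp add: a_minus_def subringE)

lemma subring_pow_closed: "\<lbrakk>subring U R; a \<in> U\<rbrakk> \<Longrightarrow> a [^] (n::nat) \<in> U"
  by (induct n) (auto simp: subringE)

text \<open>Zero, one, sum and product of \<open>sub_ring R U\<close> are record fields inherited
  from \<open>R\<close>, but negation is defined by a description over the carrier and has to be
  compared through uniqueness of inverses.\<close>

lemma subring_a_inv:
  assumes "subring U R" "x \<in> U"
  shows "\<ominus>\<^bsub>sub_ring R U\<^esub> x = \<ominus> x"
proof -
  interpret U: cring "sub_ring R U"
    using assms(1) by (rule subring_is_cring)
  have "x \<in> carrier R" using assms by blast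
  then show ?thesis
    using assms U.minus_equality[of "\<ominus> x" x] by (simp add: subringE l_neg)
qed

text \<open>Negatives are covered by multiplication with \<open>\<ominus> \<one>\<close>, an element
  of \<open>U\<close>. With ambient operations only on the right-hand side, ideals of different
  subrings can be compared and intersected directly.\<close>

lemma ideal_subring_iff:
  assumes "subring U R"
  shows "ideal I (sub_ring R U) \<longleftrightarrow>
    I \<subseteq> U \<and> \<zero> \<in> I \<and> (\<forall>x\<in>I. \<forall>y\<in>I. x \<oplus> y \<in> I) \<and> (\<forall>u\<in>U. \<forall>x\<in>I. u \<otimes> x \<in> I)"
proof
  assume "ideal I (sub_ring R U)"
  then interpret I: ideal I "sub_ring R U" .
  show "I \<subseteq> U \<and> \<zero> \<in> I \<and> (\<forall>x\<in>I. \<forall>y\<in>I. x \<oplus> y \<in> I) \<and> (\<forall>u\<in>U. \<forall>x\<in>I. u \<otimes> x \<in> I)"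
    using additive_subgroup.a_closed[OF I.is_additive_subgroup]
      additive_subgroup.zero_closed[OF I.is_additive_subgroup] I.a_subset I.I_l_closed by auto
next
  assume I: "I \<subseteq> U \<and> \<zero> \<in> I \<and> (\<forall>x\<in>I. \<forall>y\<in>I. x \<oplus> y \<in> I) \<and> (\<forall>u\<in>U. \<forall>x\<in>I. u \<otimes> x \<in> I)"
  interpret U: cring "sub_ring R U"
    using assms by (rule subring_is_cring)
  have inv: "\<ominus> x \<in> I" if "x \<in> I" for x
  proof -
    have "x \<in> carrier R" using that I assms by blast
    then have "\<ominus> x = (\<ominus> \<one>) \<otimes> x" by algebra
    then show ?thesis using I that subringE(3,5)[OF assms] by simp
  qed
  show "ideal I (sub_ring R U)"
  proof (rule idealI)
    show "subgroup I (add_monoid (sub_ring R U))"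
    proof (rule U.add.subgroupI)
      fix a assume "a \<in> I"
      then show "\<ominus>\<^bsub>sub_ring R U\<^esub> a \<in> I"
        using inv subring_a_inv[OF assms] I by auto
    qed (use I in auto)
  next
    fix a x assume "a \<in> I" "x \<in> carrier (sub_ring R U)"
    then show "x \<otimes>\<^bsub>sub_ring R U\<^esub> a \<in> I" "a \<otimes>\<^bsub>sub_ring R U\<^esub> x \<in> I"
      using I U.m_comm[of a x] by auto
  qed (rule U.ring_axioms)
qed

lemma ideal_subringD:
  assumes "subring U R" "ideal I (sub_ring R U)"
  shows "I \<subseteq> U" "\<zero> \<in> I" "\<And>x y. \<lbrakk>x \<in> I; y \<in> I\<rbrakk> \<Longrightarrow> x \<oplus> y \<in> I"
    "\<And>u x. \<lbrakk>u \<in> U; x \<in> I\<rbrakk> \<Longrightarrow> u \<otimes> x \<in> I" "\<And>u x. \<lbrakk>u \<in> U; x \<in> I\<rbrakk> \<Longrightarrow> x \<otimes> u \<in> I"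
    "\<And>x. x \<in> I \<Longrightarrow> \<ominus> x \<in> I" "\<And>x y. \<lbrakk>x \<in> I; y \<in> I\<rbrakk> \<Longrightarrow> x \<ominus> y \<in> I"
proof -
  note I = assms(2)[unfolded ideal_subring_iff[OF assms(1)]]
  show "I \<subseteq> U" "\<zero> \<in> I" "\<And>x y. \<lbrakk>x \<in> I; y \<in> I\<rbrakk> \<Longrightarrow> x \<oplus> y \<in> I"
    "\<And>u x. \<lbrakk>u \<in> U; x \<in> I\<rbrakk> \<Longrightarrow> u \<otimes> x \<in> I"
    using I by auto
  show "x \<otimes> u \<in> I" if "u \<in> U" "x \<in> I" for u x
  proof -
    have "x \<in> carrier R" "u \<in> carrier R" using that I assms(1) by blast+
    then show ?thesis using I that by (simp add: m_comm)
  qed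
  show inv: "\<ominus> x \<in> I" if "x \<in> I" for x
  proof -
    have "x \<in> carrier R" using that I assms by blast
    then have "\<ominus> x = (\<ominus> \<one>) \<otimes> x" by algebra
    then show ?thesis using I that subringE(3,5)[OF assms(1)] by simp
  qed
  show "x \<ominus> y \<in> I" if "x \<in> I" "y \<in> I" for x y
    using that inv I by (simp add: a_minus_def)
qed

lemma primeideal_subring_iff:
  assumes "subring U R"
  shows "primeideal Q (sub_ring R U) \<longleftrightarrow>
    ideal Q (sub_ring R U) \<and> \<one> \<notin> Q \<and> (\<forall>a\<in>U. \<forall>b\<in>U. a \<otimes> b \<in> Q \<longrightarrow> a \<in> Q \<or> b \<in> Q)"
proof -
  interpret U: cring "sub_ring R U"
    using assms by (rule subring_is_cring)
  have "Q = U" if "ideal Q (sub_ring R U)" "\<one> \<in> Q"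
    using ideal.one_imp_carrier[OF that(1)] that(2) by simp
  moreover have "\<one> \<in> U" using assms by (rule subringE)
  ultimately show ?thesis
    unfolding primeideal_def primeideal_axioms_def using U.cring_axioms by auto
qed

lemma primeideal_subringD:
  assumes "subring U R" "primeideal Q (sub_ring R U)"
  shows "ideal Q (sub_ring R U)" "\<one> \<notin> Q"
    "\<And>a b. \<lbrakk>a \<in> U; b \<in> U; a \<otimes> b \<in> Q\<rbrakk> \<Longrightarrow> a \<in> Q \<or> b \<in> Q"
    "\<And>a n. \<lbrakk>a \<in> U; a [^] (n::nat) \<in> Q\<rbrakk> \<Longrightarrow> a \<in> Q"
proof -
  note Q = assms(2)[unfolded primeideal_subring_iff[OF assms(1)]]
  show "ideal Q (sub_ring R U)" "\<one> \<notin> Q"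
    "\<And>a b. \<lbrakk>a \<in> U; b \<in> U; a \<otimes> b \<in> Q\<rbrakk> \<Longrightarrow> a \<in> Q \<or> b \<in> Q"
    using Q by auto
  show "a \<in> Q" if "a \<in> U" "a [^] n \<in> Q" for a and n :: nat
    using that(2)
  proof (induct n)
    case 0 then show ?case using Q by simp
  next
    case (Suc n)
    then show ?case using Q that(1) subring_pow_closed[OF assms(1) that(1), of n] by auto
  qed
qed

lemma primeideal_inter_subring:
  assumes "subring T R" "subring U R" "T \<subseteq> U" "primeideal Q (sub_ring R U)"
  shows "primeideal (Q \<inter> T) (sub_ring R T)"
  unfolding primeideal_subring_iff[OF assms(1)] ideal_subring_iff[OF assms(1)]
  using primeideal_subringD[OF assms(2,4)] subringE[OF assms(1)] assms(3)
    ideal_subringD[OF assms(2) primeideal_subringD(1)[OF assms(2,4)]]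
  by (auto simp: subset_iff)

text \<open>An ideal properly above \<open>M\<close> contains some \<open>u\<close> outside
  \<open>M\<close>, and with it \<open>1 = (1 - u v) + u v\<close>. Invertibility modulo
  \<open>M\<close> is the form in which Nakayama's lemma and integrality over a field deliver
  maximality.\<close>

lemma maximalideal_subringI:
  assumes "subring U R" "ideal M (sub_ring R U)" "\<one> \<notin> M"
    and "\<And>u. u \<in> U \<Longrightarrow> u \<notin> M \<Longrightarrow> \<exists>v\<in>U. \<one> \<ominus> u \<otimes> v \<in> M"
  shows "maximalideal M (sub_ring R U)"
proof (rule maximalidealI)
  show "carrier (sub_ring R U) \<noteq> M" using assms(1,3) subringE(3) by fastforce
  fix J assume J: "ideal J (sub_ring R U)" "M \<subseteq> J" "J \<subseteq> carrier (sub_ring R U)"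
  note JD = ideal_subringD[OF assms(1) J(1)]
  show "J = M \<or> J = carrier (sub_ring R U)"
  proof (cases "J = M")
    case False
    then obtain u where u: "u \<in> J" "u \<notin> M" using J(2) by blast
    then obtain v where v: "v \<in> U" "\<one> \<ominus> u \<otimes> v \<in> M" using assms(4) JD(1) by blast
    have c: "u \<in> carrier R" "v \<in> carrier R" using u v JD(1) assms(1) by blast+
    have "(\<one> \<ominus> u \<otimes> v) \<oplus> u \<otimes> v \<in> J" using u v J(2) JD by blast
    moreover have "(\<one> \<ominus> u \<otimes> v) \<oplus> u \<otimes> v = \<one>" using c by algebra
    ultimately have "\<one> \<in> J" by simp
    then show ?thesis using ideal.one_imp_carrier[OF J(1)] by simp
  qed simp
qed (rule assms(2))

lemma ideal_subring_pow_cong: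
  assumes "subring U R" "ideal Q (sub_ring R U)" "a \<in> U" "b \<in> U" "a \<ominus> b \<in> Q"
  shows "a [^] (n::nat) \<ominus> b [^] n \<in> Q"
proof (induct n)
  case 0
  then show ?case using ideal_subringD(2)[OF assms(1,2)] by (simp add: r_neg minus_eq)
next
  case (Suc n)
  have c: "a \<in> carrier R" "b \<in> carrier R" using assms by blast+
  have "a [^] Suc n \<ominus> b [^] Suc n = a \<otimes> (a [^] n \<ominus> b [^] n) \<oplus> b [^] n \<otimes> (a \<ominus> b)"
  proof -
    have "a [^] n \<in> carrier R" "b [^] n \<in> carrier R" using c by auto
    then show ?thesis using c unfolding nat_pow_Suc by algebra
  qed
  then show ?case
    using Suc assms ideal_subringD(3,4)[OF assms(1,2)] subring_pow_closed[OF assms(1,4)] by simp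
qed

text \<open>Krull's separation argument by Zorn's lemma. It serves three choices of
  \<open>W\<close>: a set \<open>B - P\<close> for lying over, where the maximality clause is needed
  too; \<open>{\<one>}\<close>, to put a proper ideal into a prime; and the powers of an element,
  for the radical as an intersection of primes.\<close>

lemma ex_primeideal_disjoint:
  assumes I: "ideal I R" and W: "W \<subseteq> carrier R" "\<one> \<in> W"
      "\<And>v w. \<lbrakk>v \<in> W; w \<in> W\<rbrakk> \<Longrightarrow> v \<otimes> w \<in> W"
    and disj: "I \<inter> W = {}"
  obtains Q where "primeideal Q R" "I \<subseteq> Q" "Q \<inter> W = {}"
    "\<And>J. \<lbrakk>ideal J R; Q \<subset> J\<rbrakk> \<Longrightarrow> J \<inter> W \<noteq> {}"
proof -
  define F where "F = {J. ideal J R \<and> I \<subseteq> J \<and> J \<inter> W = {}}"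
  have "\<exists>Q\<in>F. \<forall>Y\<in>F. Q \<subseteq> Y \<longrightarrow> Y = Q"
  proof (rule subset_Zorn_nonempty)
    show "F \<noteq> {}" using I disj unfolding F_def by blast
    fix C assume C: "C \<noteq> {}" "subset.chain F C"
    then have "subset.chain {I. ideal I R} C"
      unfolding subset_chain_def F_def by blast
    from chain_Union_is_ideal[OF this] have "ideal (\<Union>C) R" using C(1) by simp
    moreover have "I \<subseteq> \<Union>C" "\<Union>C \<inter> W = {}"
      using C unfolding subset_chain_def F_def by blast+
    ultimately show "\<Union>C \<in> F" unfolding F_def by blast
  qed
  then obtain Q where QF: "Q \<in> F" and Qmax: "\<forall>Y\<in>F. Q \<subseteq> Y \<longrightarrow> Y = Q" ..
  from QF have Q: "ideal Q R" "I \<subseteq> Q" "Q \<inter> W = {}" unfolding F_def by auto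
  have max: "J = Q" if "ideal J R" "I \<subseteq> J" "J \<inter> W = {}" "Q \<subseteq> J" for J
    using Qmax that unfolding F_def by auto
  interpret Q: ideal Q R by (rule Q)
  \<comment> \<open>\<open>Q\<close> together with \<open>a\<close> generates a strictly larger
    ideal above \<open>I\<close>, which by maximality cannot stay disjoint from
    \<open>W\<close>.\<close>
  have meets: "\<exists>q\<in>Q. \<exists>r\<in>carrier R. q \<oplus> r \<otimes> a \<in> W" if a: "a \<in> carrier R" "a \<notin> Q" for a
  proof -
    let ?J = "Q <+>\<^bsub>R\<^esub> PIdl a"
    have J: "ideal ?J R" using add_ideals[OF Q(1) cgenideal_ideal[OF a(1)]] .
    have "q = q \<oplus> \<zero>" "\<zero> \<in> PIdl a" if "q \<in> Q" for q
      using that Q.Icarr additive_subgroup.zero_closed[OF ideal.axioms(1)[OF cgenideal_ideal[OF a(1)]]]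
      by simp_all
    then have "Q \<subseteq> ?J" unfolding set_add_def' by blast
    moreover have "a = \<zero> \<oplus> a" using a(1) by simp
    then have "a \<in> ?J"
      using Q.zero_closed cgenideal_self[OF a(1)] unfolding set_add_def' by blast
    ultimately have "?J \<inter> W \<noteq> {}" using max[OF J] Q(2) a(2) by blast
    then show ?thesis unfolding set_add_def' cgenideal_def by blast
  qed
  have "primeideal Q R"
  proof (rule primeidealI[OF Q(1) is_cring])
    show "carrier R \<noteq> Q" using W(1,2) Q(3) by blast
    fix a b assume ab: "a \<in> carrier R" "b \<in> carrier R" "a \<otimes> b \<in> Q"
    show "a \<in> Q \<or> b \<in> Q"
    proof (rule ccontr)
      assume "\<not> (a \<in> Q \<or> b \<in> Q)"
      then obtain p r q s where pr: "p \<in> Q" "r \<in> carrier R" "p \<oplus> r \<otimes> a \<in> W"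
        and qs: "q \<in> Q" "s \<in> carrier R" "q \<oplus> s \<otimes> b \<in> W"
        using meets ab by metis
      have pc: "p \<in> carrier R" "q \<in> carrier R" using pr qs Q.Icarr by auto
      have "(p \<oplus> r \<otimes> a) \<otimes> (q \<oplus> s \<otimes> b) =
          p \<otimes> (q \<oplus> s \<otimes> b) \<oplus> ((r \<otimes> a) \<otimes> q \<oplus> (r \<otimes> s) \<otimes> (a \<otimes> b))"
        using pr(2) qs(2) ab(1,2) pc by algebra
      also have "\<dots> \<in> Q"
        using pr qs ab pc by (intro Q.a_closed Q.I_r_closed[of p] Q.I_l_closed[of q] Q.I_l_closed[of "a \<otimes> b"]) auto
      finally show False using W(3)[OF pr(3) qs(3)] Q(3) by blast
    qed
  qed
  moreover have "J \<inter> W \<noteq> {}" if "ideal J R" "Q \<subset> J" for J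
    using max[OF that(1)] that(2) Q(2) by blast
  ultimately show thesis using that Q by blast
qed

end

subsection \<open>Integral extensions and lying over\<close>

context cring
begin

text \<open>Polynomials are lists with the leading coefficient first. A monic one is
  \<open>\<one> # cs\<close>, so \<open>length cs\<close> is its degree and \<open>cs\<close> holds
  the lower coefficients, possibly starting with zeros.\<close>

lemma integral_extensionE:
  assumes "integral_extension R T U" "x \<in> U" "x \<in> carrier R"
  obtains cs where "set cs \<subseteq> T" "x [^] length cs \<oplus> eval cs x = \<zero>"
proof -
  obtain p where p: "p \<in> carrier (univ_poly R T)" "p \<noteq> []" "lead_coeff p = \<one>" "eval p x = \<zero>"
    using assms(1,2) unfolding integral_extension_def by blast
  then obtain cs where cs: "p = \<one> # cs" by (cases p) auto
  then have "set cs \<subseteq> T"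
    using p(1) unfolding univ_poly_carrier[symmetric] polynomial_def by auto
  moreover have "x [^] length cs \<oplus> eval cs x = \<zero>"
    using p(4) cs assms(3) by simp
  ultimately show thesis by (rule that)
qed

lemma integral_extension_mono:
  assumes "integral_extension R T U" "T \<subseteq> T'" "U' \<subseteq> U"
  shows "integral_extension R T' U'"
proof -
  have "carrier (univ_poly R T) \<subseteq> carrier (univ_poly R T')"
    using subset_trans[OF _ assms(2)] by (auto simp: univ_poly_def polynomial_def)
  then show ?thesis using assms unfolding integral_extension_def by blast
qed

lemma eval_subring_closed:
  assumes "subring U R" "set cs \<subseteq> U" "x \<in> U"
  shows "eval cs x \<in> U"
  using assms(2)
  by (induct cs) (auto simp: subringE[OF assms(1)] subring_pow_closed[OF assms(1,3)])

text \<open>\<open>Q\<close> is maximal among the ideals of \<open>U\<close> that miss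
  \<open>B - P\<close>, which gives \<open>Q \<inter> B \<subseteq> P\<close> at once. If some
  \<open>p\<close> in \<open>P\<close> were outside \<open>Q\<close>, then \<open>Q + p U\<close>
  would meet \<open>B - P\<close> in an \<open>s\<close> congruent to \<open>p x\<close> modulo
  \<open>Q\<close>, and an integral equation of \<open>x\<close> would force a power of
  \<open>s\<close> into \<open>P\<close>.\<close>

theorem lying_over:
  assumes B: "subring B R" and U: "subring U R" and BU: "B \<subseteq> U"
    and int: "integral_extension R B U" and P: "primeideal P (sub_ring R B)"
  obtains Q where "primeideal Q (sub_ring R U)" "Q \<inter> B = P"
proof -
  interpret U: cring "sub_ring R U" using U by (rule subring_is_cring)
  note PD = primeideal_subringD[OF B P]
  note PI = ideal_subringD[OF B PD(1)]
  note BE = subringE[OF B]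
  note UE = subringE[OF U]
  obtain Q where Q: "primeideal Q (sub_ring R U)" "Q \<inter> (B - P) = {}"
    and max: "\<And>J. \<lbrakk>ideal J (sub_ring R U); Q \<subset> J\<rbrakk> \<Longrightarrow> J \<inter> (B - P) \<noteq> {}"
  proof (rule U.ex_primeideal_disjoint[of "{\<zero>}" "B - P"])
    show "ideal {\<zero>} (sub_ring R U)" using U.zeroideal by simp
    show "B - P \<subseteq> carrier (sub_ring R U)" using BU by auto
    show "\<one>\<^bsub>sub_ring R U\<^esub> \<in> B - P" using PD(2) BE(3) by simp
    show "v \<otimes>\<^bsub>sub_ring R U\<^esub> w \<in> B - P" if "v \<in> B - P" "w \<in> B - P" for v w
      using that PD(3) BE(6) by auto
    show "{\<zero>} \<inter> (B - P) = {}" using PI(2) by blast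
  qed blast
  note QD = primeideal_subringD[OF U Q(1)]
  note QI = ideal_subringD[OF U QD(1)]
  have QP: "Q \<inter> B \<subseteq> P" using Q(2) by blast
  have "p \<in> Q" if p: "p \<in> P" for p
  proof (rule ccontr)
    assume pQ: "p \<notin> Q"
    have pB: "p \<in> B" and pU: "p \<in> U" and pc: "p \<in> carrier R"
      using p PI(1) BU UE(1) by blast+
    define J where "J = {q \<oplus> p \<otimes> x | q x. q \<in> Q \<and> x \<in> U}"
    have "ideal J (sub_ring R U)"
      unfolding ideal_subring_iff[OF U]
    proof (intro conjI ballI)
      show "J \<subseteq> U" unfolding J_def using QI(1) UE(6)[OF pU] UE(7) by auto
      have "\<zero> = \<zero> \<oplus> p \<otimes> \<zero>" using pc by simp
      then show "\<zero> \<in> J" unfolding J_def using QI(2) UE(2) by blast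
    next
      fix a b assume "a \<in> J" "b \<in> J"
      then obtain q x r y where *: "a = q \<oplus> p \<otimes> x" "b = r \<oplus> p \<otimes> y"
        "q \<in> Q" "r \<in> Q" "x \<in> U" "y \<in> U" unfolding J_def by blast
      then have c: "q \<in> carrier R" "r \<in> carrier R" "x \<in> carrier R" "y \<in> carrier R"
        using QI(1) UE(1) by blast+
      have "a \<oplus> b = (q \<oplus> r) \<oplus> p \<otimes> (x \<oplus> y)" unfolding * using c pc by algebra
      then show "a \<oplus> b \<in> J" unfolding J_def using * QI(3) UE(7) by blast
    next
      fix u a assume "u \<in> U" "a \<in> J"
      then obtain q x where *: "a = q \<oplus> p \<otimes> x" "q \<in> Q" "x \<in> U" "u \<in> U" unfolding J_def by blast
      then have c: "q \<in> carrier R" "u \<in> carrier R" "x \<in> carrier R"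
        using QI(1) UE(1) by blast+
      have "u \<otimes> a = u \<otimes> q \<oplus> p \<otimes> (u \<otimes> x)" unfolding * using c pc by algebra
      then show "u \<otimes> a \<in> J" unfolding J_def using * QI(4) UE(6) by blast
    qed
    moreover have "q \<in> J" if "q \<in> Q" for q
    proof -
      have "q = q \<oplus> p \<otimes> \<zero>" using that QI(1) UE(1) pc by auto
      then show ?thesis unfolding J_def using that UE(2) by blast
    qed
    moreover have "p \<in> J"
    proof -
      have "p = \<zero> \<oplus> p \<otimes> \<one>" using pc by simp
      then show ?thesis unfolding J_def using QI(2) UE(3) by blast
    qed
    ultimately have "J \<inter> (B - P) \<noteq> {}" using max pQ by blast
    then obtain s q x where s: "s \<in> B" "s \<notin> P" "s = q \<oplus> p \<otimes> x" "q \<in> Q" "x \<in> U"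
      unfolding J_def by blast
    have c: "s \<in> carrier R" "q \<in> carrier R" "x \<in> carrier R"
      using s QI(1) UE(1) BE(1) by blast+
    have "p \<otimes> x \<ominus> s = \<ominus> q" using c pc unfolding s(3) by algebra
    then have cong: "p \<otimes> x \<ominus> s \<in> Q" using QI(6) s(4) by simp
    have pow: "(p \<otimes> x) [^] n \<ominus> s [^] n \<in> Q" for n :: nat
      using ideal_subring_pow_cong[OF U QD(1) UE(6)[OF pU s(5)] subsetD[OF BU s(1)] cong] .
    \<comment> \<open>multiplying an equation of degree \<open>n\<close> for \<open>x\<close> by \<open>p\<^sup>n\<close> gives one for \<open>p x\<close>, whose lower
      coefficients are multiples of \<open>p\<close>\<close>
    have lower: "\<exists>c\<in>P. p [^] length cs \<otimes> eval cs x \<ominus> c \<in> Q" if "set cs \<subseteq> B" for cs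
      using that
    proof (induct cs)
      case Nil
      show ?case using PI(2) QI(2) by (intro bexI[of _ \<zero>]) (simp_all add: a_minus_def)
    next
      case (Cons d cs)
      then obtain c' where c': "c' \<in> P" "p [^] length cs \<otimes> eval cs x \<ominus> c' \<in> Q" by auto
      define n where "n = length cs"
      have d: "d \<in> B" "d \<in> U" "d \<in> carrier R" using Cons.prems BU UE(1) by auto
      have e: "eval cs x \<in> U" using Cons.prems BU s(5) eval_subring_closed[OF U] by auto
      have cc: "eval cs x \<in> carrier R" "c' \<in> carrier R" "p [^] n \<in> carrier R" "x [^] n \<in> carrier R"
        "s [^] n \<in> carrier R"
        using e c' UE(1) PI(1) BE(1) c pc by auto
      have px: "(p \<otimes> x) [^] n = p [^] n \<otimes> x [^] n" using c pc nat_pow_distrib by blast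
      have "p [^] Suc n \<otimes> eval (d # cs) x \<ominus> (p \<otimes> (d \<otimes> s [^] n) \<oplus> p \<otimes> c')
          = p \<otimes> d \<otimes> ((p \<otimes> x) [^] n \<ominus> s [^] n) \<oplus> p \<otimes> (p [^] n \<otimes> eval cs x \<ominus> c')"
        unfolding px nat_pow_Suc eval.simps list.sel n_def[symmetric] length_Cons diff_Suc_1
        using cc pc d(3) by algebra
      also have "\<dots> \<in> Q"
        using pow[of n] c'(2) QI pU d UE(6) unfolding n_def by simp
      finally have "p [^] length (d # cs) \<otimes> eval (d # cs) x \<ominus> (p \<otimes> (d \<otimes> s [^] n) \<oplus> p \<otimes> c') \<in> Q"
        by (simp add: n_def)
      moreover have "p \<otimes> (d \<otimes> s [^] n) \<oplus> p \<otimes> c' \<in> P"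
        using p c'(1) PI pB d(1) BE(6) subring_pow_closed[OF B s(1)] by simp
      ultimately show ?case by blast
    qed
    obtain cs where cs: "set cs \<subseteq> B" "x [^] length cs \<oplus> eval cs x = \<zero>"
      using integral_extensionE[OF int s(5) c(3)] .
    define n where "n = length cs"
    obtain c' where c': "c' \<in> P" "p [^] n \<otimes> eval cs x \<ominus> c' \<in> Q"
      using lower[OF cs(1)] unfolding n_def by blast
    have e: "eval cs x \<in> U" using cs BU s(5) eval_subring_closed[OF U] by auto
    have cc: "eval cs x \<in> carrier R" "c' \<in> carrier R" "p [^] n \<in> carrier R" "x [^] n \<in> carrier R"
        "s [^] n \<in> carrier R"
      using e c' UE(1) PI(1) BE(1) c pc by auto
    have px: "(p \<otimes> x) [^] n = p [^] n \<otimes> x [^] n" using c pc nat_pow_distrib by blast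
    \<comment> \<open>The monic equation times \<open>p [^] n\<close> vanishes, and modulo
      \<open>Q\<close> its two parts are \<open>s [^] n\<close> and \<open>c'\<close>. Their sum
      thus lies in \<open>Q \<inter> B\<close>, hence in \<open>P\<close>, and so does
      \<open>s [^] n\<close>.\<close>
    have "s [^] n \<oplus> c' = p [^] n \<otimes> (x [^] n \<oplus> eval cs x)
        \<ominus> (((p \<otimes> x) [^] n \<ominus> s [^] n) \<oplus> (p [^] n \<otimes> eval cs x \<ominus> c'))"
      unfolding px using cc by algebra
    also have "\<dots> = \<zero> \<ominus> (((p \<otimes> x) [^] n \<ominus> s [^] n) \<oplus> (p [^] n \<otimes> eval cs x \<ominus> c'))"
      using cs(2) cc unfolding n_def by simp
    also have "\<dots> \<in> Q" using QI pow[of n] c'(2) by simp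
    finally have "s [^] n \<oplus> c' \<in> P"
      using QP c'(1) PI(1) BE(7)[OF subring_pow_closed[OF B s(1), of n], of c'] by blast
    then have "(s [^] n \<oplus> c') \<ominus> c' \<in> P" using c'(1) PI(7) by blast
    moreover have "(s [^] n \<oplus> c') \<ominus> c' = s [^] n" using cc by algebra
    ultimately show False using PD(4)[OF s(1)] s(2) by metis
  qed
  then have "Q \<inter> B = P" using QP PI(1) by blast
  then show thesis using that Q(1) by blast
qed

text \<open>Two primes of \<open>U\<close> with the same trace on \<open>T\<close> lift to
  \<open>V\<close> by lying over. The lifts agree on \<open>R'\<close>, so they coincide, and so do
  their traces on \<open>U\<close>.\<close>

lemma i_extension_subextension:
  assumes R: "subring R' R" "subring U R" "subring T R" "subring V R"
    and incl: "R' \<subseteq> T" "T \<subseteq> U" "U \<subseteq> V"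
    and int: "integral_extension R R' V" and i: "i_extension R R' V"
  shows "i_extension R T U"
  unfolding i_extension_def
proof (rule inj_onI)
  fix P Q assume PQ: "P \<in> Spec (sub_ring R U)" "Q \<in> Spec (sub_ring R U)" "P \<inter> T = Q \<inter> T"
  have int': "integral_extension R U V"
    using integral_extension_mono[OF int] incl by blast
  obtain P' where P': "primeideal P' (sub_ring R V)" "P' \<inter> U = P"
    using PQ(1) lying_over[OF R(2,4) incl(3) int'] unfolding Spec_def by blast
  obtain Q' where Q': "primeideal Q' (sub_ring R V)" "Q' \<inter> U = Q"
    using PQ(2) lying_over[OF R(2,4) incl(3) int'] unfolding Spec_def by blast
  have "P' \<inter> R' = Q' \<inter> R'" using P'(2) Q'(2) PQ(3) incl by blast
  then have "P' = Q'"
    using i P'(1) Q'(1) unfolding i_extension_def Spec_def inj_on_def by blast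
  then show "P = Q" using P' Q' by simp
qed

end

subsection \<open>Finite and minimal extensions\<close>

context cring
begin

section \<open>Submodules of the ambient ring over a subring, and spans\<close>

definition is_submodule :: "'a set \<Rightarrow> 'a set \<Rightarrow> bool" where
  "is_submodule T N \<longleftrightarrow> N \<subseteq> carrier R \<and> \<zero> \<in> N \<and> (\<forall>x\<in>N. \<forall>y\<in>N. x \<oplus> y \<in> N) \<and>
     (\<forall>t\<in>T. \<forall>x\<in>N. t \<otimes> x \<in> N)"

lemma is_submoduleD:
  assumes "subring T R" "is_submodule T N"
  shows "N \<subseteq> carrier R" "\<zero> \<in> N" "\<And>x y. \<lbrakk>x \<in> N; y \<in> N\<rbrakk> \<Longrightarrow> x \<oplus> y \<in> N"
    "\<And>t x. \<lbrakk>t \<in> T; x \<in> N\<rbrakk> \<Longrightarrow> t \<otimes> x \<in> N" "\<And>x y. \<lbrakk>x \<in> N; y \<in> N\<rbrakk> \<Longrightarrow> x \<ominus> y \<in> N"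
proof -
  note N = assms(2)[unfolded is_submodule_def]
  show "N \<subseteq> carrier R" "\<zero> \<in> N" "\<And>x y. \<lbrakk>x \<in> N; y \<in> N\<rbrakk> \<Longrightarrow> x \<oplus> y \<in> N"
    "\<And>t x. \<lbrakk>t \<in> T; x \<in> N\<rbrakk> \<Longrightarrow> t \<otimes> x \<in> N"
    using N by auto
  show "x \<ominus> y \<in> N" if "x \<in> N" "y \<in> N" for x y
  proof -
    have "x \<in> carrier R" "y \<in> carrier R" using that N by auto
    then have "x \<ominus> y = x \<oplus> (\<ominus> \<one>) \<otimes> y" by algebra
    then show ?thesis using that N subringE(3,5)[OF assms(1)] by simp
  qed
qed

lemma subring_is_submodule: "\<lbrakk>subring T R; subring U R; T \<subseteq> U\<rbrakk> \<Longrightarrow> is_submodule T U"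
  unfolding is_submodule_def using subringE[of U R] by auto

text \<open>Together with \<open>Span_least\<close> this extends a property \<open>k x\<close> in
  \<open>N\<close> from a list of generators to their span.\<close>

lemma is_submodule_vimage:
  assumes "subring T R" "is_submodule T N" "k \<in> carrier R"
  shows "is_submodule T {x \<in> carrier R. k \<otimes> x \<in> N}"
proof -
  note ND = is_submoduleD[OF assms(1,2)]
  have "k \<otimes> (r \<otimes> x) \<in> N" if "r \<in> T" "x \<in> carrier R" "k \<otimes> x \<in> N" for r x
  proof -
    have "r \<in> carrier R" using that(1) assms(1) by blast
    then have "k \<otimes> (r \<otimes> x) = r \<otimes> (k \<otimes> x)" using that(2) assms(3) by (simp add: m_lcomm)
    then show ?thesis using ND(4) that(1,3) by simp
  qed
  then show ?thesis
    using ND assms(3) subringE(1)[OF assms(1)] unfolding is_submodule_def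
    by (auto simp: r_distr subset_iff)
qed

declare Span.simps [simp del]

lemma mem_Span_Cons:
  "x \<in> Span T (u # us) \<longleftrightarrow> (\<exists>t\<in>T. \<exists>e\<in>Span T us. x = t \<otimes> u \<oplus> e)"
  unfolding Span.simps by (auto simp: line_extension_def set_add_def' r_coset_def)

lemma Span_least:
  assumes "is_submodule T N" "set us \<subseteq> N"
  shows "Span T us \<subseteq> N"
  using assms(2)
proof (induct us)
  case Nil
  then show ?case using assms(1) unfolding is_submodule_def by (simp add: Span.simps)
next
  case (Cons u us)
  then show ?case using assms(1) unfolding is_submodule_def mem_Span_Cons subset_iff by auto
qed

lemma Span_is_submodule:
  assumes "subring T R" "set us \<subseteq> carrier R"
  shows "is_submodule T (Span T us)"
  using assms(2)
proof (induct us)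
  case Nil
  then show ?case using subringE(1)[OF assms(1)] unfolding is_submodule_def by (auto simp: Span.simps)
next
  case (Cons u us)
  note TE = subringE[OF assms(1)]
  have S: "is_submodule T (Span T us)" using Cons by simp
  note SD = is_submoduleD[OF assms(1) S]
  have u: "u \<in> carrier R" using Cons.prems by simp
  show ?case
    unfolding is_submodule_def
  proof (intro conjI ballI)
    show "Span T (u # us) \<subseteq> carrier R"
      using SD(1) TE(1) u unfolding mem_Span_Cons subset_iff by auto
    have "\<zero> = \<zero> \<otimes> u \<oplus> \<zero>" using u by simp
    then show "\<zero> \<in> Span T (u # us)" using SD(2) TE(2) unfolding mem_Span_Cons by blast
  next
    fix x y assume "x \<in> Span T (u # us)" "y \<in> Span T (u # us)"
    then obtain a d b e where *: "a \<in> T" "b \<in> T" "d \<in> Span T us" "e \<in> Span T us"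
      "x = a \<otimes> u \<oplus> d" "y = b \<otimes> u \<oplus> e"
      unfolding mem_Span_Cons by blast
    then have "a \<in> carrier R" "b \<in> carrier R" "d \<in> carrier R" "e \<in> carrier R"
      using TE(1) SD(1) by blast+
    then have "x \<oplus> y = (a \<oplus> b) \<otimes> u \<oplus> (d \<oplus> e)" unfolding * using u by algebra
    then show "x \<oplus> y \<in> Span T (u # us)"
      unfolding mem_Span_Cons using TE(7)[OF *(1,2)] SD(3)[OF *(3,4)] by blast
  next
    fix t x assume t: "t \<in> T" and "x \<in> Span T (u # us)"
    then obtain a d where *: "a \<in> T" "d \<in> Span T us" "x = a \<otimes> u \<oplus> d"
      unfolding mem_Span_Cons by blast
    then have "a \<in> carrier R" "t \<in> carrier R" "d \<in> carrier R"
      using TE(1) SD(1) t by blast+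
    then have "t \<otimes> x = (t \<otimes> a) \<otimes> u \<oplus> t \<otimes> d" unfolding * using u by algebra
    then show "t \<otimes> x \<in> Span T (u # us)"
      unfolding mem_Span_Cons using TE(6)[OF t *(1)] SD(4)[OF t *(2)] by blast
  qed
qed

lemma Span_Cons_superset:
  assumes "subring T R" "set (u # us) \<subseteq> carrier R"
  shows "u \<in> Span T (u # us)" "Span T us \<subseteq> Span T (u # us)"
proof -
  have u: "u \<in> carrier R" and us: "set us \<subseteq> carrier R" using assms(2) by auto
  note SD = is_submoduleD[OF assms(1) Span_is_submodule[OF assms(1) us]]
  have "u = \<one> \<otimes> u \<oplus> \<zero>" using u by simp
  then show "u \<in> Span T (u # us)"
    unfolding mem_Span_Cons using SD(2) subringE(3)[OF assms(1)] by blast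
  show "Span T us \<subseteq> Span T (u # us)"
  proof
    fix x assume "x \<in> Span T us"
    then have "x = \<zero> \<otimes> u \<oplus> x" "x \<in> Span T us" using u SD(1) by auto
    then show "x \<in> Span T (u # us)"
      unfolding mem_Span_Cons using subringE(2)[OF assms(1)] by blast
  qed
qed

lemma set_subset_Span:
  assumes "subring T R" "set us \<subseteq> carrier R"
  shows "set us \<subseteq> Span T us"
  using assms(2)
proof (induct us)
  case (Cons u us)
  then have "set us \<subseteq> Span T us" by simp
  then show ?case
    using Span_Cons_superset[OF assms(1) Cons.prems] by (metis insert_subset list.simps(15) subset_trans)
qed simp

text \<open>The span is \<open>T[u]\<close>. The list of powers runs to the degree inclusive, one
  more than a basis argument asks for, so that it contains \<open>\<one>\<close> even when the
  degree is zero. Closure under products follows from closure under multiplication by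
  \<open>u\<close>, checked on generators.\<close>

lemma Span_powers_subring:
  assumes T: "subring T R" and u: "u \<in> carrier R" and cs: "set cs \<subseteq> T"
    "u [^] length cs \<oplus> eval cs u = \<zero>"
  defines "us \<equiv> map (\<lambda>i. u [^] i) [0..<Suc (length cs)]"
  shows "subring (Span T us) R" "T \<subseteq> Span T us" "u \<in> Span T us"
proof -
  define L where "L = Span T us"
  define n where "n = length cs"
  note TE = subringE[OF T]
  have usc: "set us \<subseteq> carrier R" unfolding us_def using u by auto
  have sub: "is_submodule T L" unfolding L_def using T usc by (rule Span_is_submodule)
  note LD = is_submoduleD[OF T sub]
  have pow: "u [^] i \<in> L" if "i \<le> n" for i
  proof -
    have "i \<in> set [0..<Suc (length cs)]" using that n_def by auto
    then have "u [^] i \<in> set us" unfolding us_def set_map by (rule imageI)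
    then show ?thesis using set_subset_Span[OF T usc] unfolding L_def by blast
  qed
  have ev: "eval ds u \<in> L" if "set ds \<subseteq> T" "length ds \<le> Suc n" for ds
    using that
  proof (induct ds)
    case Nil then show ?case using LD(2) by simp
  next
    case (Cons d ds)
    then show ?case using LD(3,4) pow by auto
  qed
  have "u \<otimes> x \<in> L" if "x \<in> L" for x
  proof -
    note N = is_submodule_vimage[OF T sub u]
    have "set us \<subseteq> {x \<in> carrier R. u \<otimes> x \<in> L}"
    proof
      fix x assume "x \<in> set us"
      then obtain i where "i \<in> set [0..<Suc n]" "x = u [^] i"
        unfolding us_def n_def set_map by blast
      then have i: "i \<le> n" "x = u [^] i" by auto
      have e: "u \<otimes> x = u [^] Suc i" unfolding i(2) using u by (simp add: m_comm)
      have "u [^] Suc i \<in> L"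
      proof (cases "i = n")
        case False
        then show ?thesis using i(1) pow[of "Suc i"] by simp
      next
        case True
        have csc: "set cs \<subseteq> carrier R" using cs(1) TE(1) by blast
        have ec: "eval cs u \<in> carrier R" using eval_in_carrier[OF csc u] .
        have "u [^] Suc n = (u [^] n \<oplus> eval cs u) \<otimes> u \<ominus> eval cs u \<otimes> u"
        proof -
          have "u [^] n \<in> carrier R" using u by simp
          then show ?thesis using u ec unfolding nat_pow_Suc by algebra
        qed
        also have "\<dots> = \<zero> \<ominus> eval cs u \<otimes> u" using cs(2) u unfolding n_def by simp
        \<comment> \<open>Appending a zero constant coefficient multiplies a polynomial by its
          variable. The new list has length \<open>Suc n\<close>, the largest that \<open>ev\<close>
          covers.\<close>
        also have "eval cs u \<otimes> u = eval (cs @ [\<zero>]) u"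
          using eval_append_aux[OF csc _ u, of \<zero>] ec u by simp
        finally have "u [^] Suc n = \<zero> \<ominus> eval (cs @ [\<zero>]) u" .
        moreover have "eval (cs @ [\<zero>]) u \<in> L"
          by (rule ev) (use cs(1) TE(2) n_def in auto)
        ultimately show ?thesis using LD(2,5) True by simp
      qed
      then show "x \<in> {x \<in> carrier R. u \<otimes> x \<in> L}" using e i(2) u by simp
    qed
    from Span_least[OF N this] show ?thesis using that unfolding L_def by blast
  qed
  note uL = this
  have powL: "u [^] (i::nat) \<otimes> x \<in> L" if "x \<in> L" for i x
  proof (induct i)
    case 0 then show ?case using that LD(1) by auto
  next
    case (Suc i)
    have "x \<in> carrier R" using that LD(1) by blast
    then have "u [^] Suc i \<otimes> x = u \<otimes> (u [^] i \<otimes> x)" using u by (simp add: m_ac)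
    then show ?case using uL[OF Suc] by simp
  qed
  have mult: "x \<otimes> y \<in> L" if "x \<in> L" "y \<in> L" for x y
  proof -
    have y: "y \<in> carrier R" using that LD(1) by blast
    note N = is_submodule_vimage[OF T sub y]
    have "set us \<subseteq> {x \<in> carrier R. y \<otimes> x \<in> L}"
      unfolding us_def using powL[OF that(2)] u y by (auto simp: m_comm)
    from Span_least[OF N this] have "x \<in> carrier R" "y \<otimes> x \<in> L"
      using that(1) unfolding L_def by blast+
    then show ?thesis using y by (simp add: m_comm)
  qed
  have one: "\<one> \<in> L" using pow[of 0] by simp
  show "subring (Span T us) R"
    unfolding L_def[symmetric]
  proof (rule subringI)
    fix h assume "h \<in> L"
    then have "\<zero> \<ominus> h \<in> L" "h \<in> carrier R" using LD(1,2,5) by auto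
    then show "\<ominus> h \<in> L" by (simp add: a_minus_def)
  qed (use LD(1,3) one mult in auto)
  show "T \<subseteq> Span T us"
  proof
    fix t assume t: "t \<in> T"
    then have "t \<otimes> \<one> \<in> L" using LD(4) one by blast
    then show "t \<in> Span T us" using t TE(1) unfolding L_def by auto
  qed
  show "u \<in> Span T us" using uL[OF one] u unfolding L_def by simp
qed

section \<open>Minimal integral extensions: finiteness and maximality of the conductor\<close>

lemma minimal_extensionD:
  assumes "minimal_extension R T U"
  shows "T \<subseteq> U" "T \<noteq> U" "subring T R" "subring U R"
    "\<And>B. \<lbrakk>subring B R; T \<subseteq> B; B \<subseteq> U\<rbrakk> \<Longrightarrow> B = T \<or> B = U"
  using assms unfolding minimal_extension_def intermediate_rings_def by blast+

text \<open>By minimality any \<open>u\<close> of \<open>U\<close> outside \<open>T\<close>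
  generates \<open>U\<close> over \<open>T\<close>, and integrality of \<open>u\<close> makes
  finitely many powers span \<open>T[u]\<close>.\<close>

lemma minimal_integral_finite_extension:
  assumes "minimal_extension R T U" "integral_extension R T U"
  shows "finite_extension R T U"
proof -
  note D = minimal_extensionD[OF assms(1)]
  obtain u where u: "u \<in> U" "u \<notin> T" using D(1,2) by blast
  then have uc: "u \<in> carrier R" using D(4) by blast
  obtain cs where cs: "set cs \<subseteq> T" "u [^] length cs \<oplus> eval cs u = \<zero>"
    using integral_extensionE[OF assms(2) u(1) uc] .
  define us where "us = map (\<lambda>i. u [^] i) [0..<Suc (length cs)]"
  note L = Span_powers_subring[OF D(3) uc cs, folded us_def]
  have "set us \<subseteq> U" unfolding us_def using subring_pow_closed[OF D(4) u(1)] by auto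
  moreover from this have "Span T us \<subseteq> U"
    by (rule Span_least[OF subring_is_submodule[OF D(3,4,1)]])
  then have "Span T us = U" using D(5)[OF L(1,2)] L(3) u(2) by blast
  ultimately show ?thesis unfolding finite_extension_def by blast
qed

text \<open>Nakayama's lemma relative to a submodule \<open>N\<close>, by eliminating one generator
  at a time instead of taking a determinant. The multiplier keeps the form \<open>1 - t s\<close>
  because its use is to invert \<open>t\<close> modulo a conductor.\<close>

lemma nakayama_Span:
  assumes T: "subring T R" and N: "is_submodule T N" and t: "t \<in> T" and "set us \<subseteq> carrier R"
    and "\<And>u. u \<in> set us \<Longrightarrow> \<exists>w\<in>Span T us. u \<ominus> t \<otimes> w \<in> N"
  shows "\<exists>s\<in>T. \<forall>u\<in>set us. (\<one> \<ominus> t \<otimes> s) \<otimes> u \<in> N"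
  using assms(4,5)
proof (induct us)
  case Nil
  then show ?case using subringE(2)[OF T] by auto
next
  case (Cons v us)
  note TE = subringE[OF T]
  note ND = is_submoduleD[OF T N]
  have v: "v \<in> carrier R" and us: "set us \<subseteq> carrier R" using Cons.prems(1) by auto
  note SD = is_submoduleD[OF T Span_is_submodule[OF T us]]
  have tc: "t \<in> carrier R" using t TE(1) by blast
  obtain a e where a: "a \<in> T" "e \<in> Span T us" and vN: "v \<ominus> t \<otimes> (a \<otimes> v \<oplus> e) \<in> N"
    using Cons.prems(2)[of v] unfolding mem_Span_Cons Bex_def by auto
  have ac: "a \<in> carrier R" "e \<in> carrier R" using a TE(1) SD(1) by auto
  have "\<exists>w\<in>Span T us. u \<ominus> t \<otimes> w \<in> N" if u: "u \<in> set us" for u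
  proof -
    obtain b f where b: "b \<in> T" "f \<in> Span T us" and uN: "u \<ominus> t \<otimes> (b \<otimes> v \<oplus> f) \<in> N"
      using Cons.prems(2)[of u] u unfolding mem_Span_Cons Bex_def by auto
    have c: "b \<in> carrier R" "f \<in> carrier R" "u \<in> carrier R" using b u us TE(1) SD(1) by auto
    have k: "\<one> \<ominus> t \<otimes> a \<in> T" using T TE(3) TE(6)[OF t a(1)] by (rule subring_minus_closed)
    \<comment> \<open>The relation for \<open>v\<close> reads \<open>(1 - t a) v = t e\<close>
      modulo \<open>N\<close>. Multiplying the relation for \<open>u\<close> by
      \<open>1 - t a\<close> and substituting removes \<open>v\<close>; \<open>w\<close> collects
      the coefficient of \<open>t\<close> that remains.\<close>
    define w where "w = a \<otimes> u \<oplus> ((\<one> \<ominus> t \<otimes> a) \<otimes> f \<oplus> (t \<otimes> b) \<otimes> e)"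
    have "u \<in> Span T us" using u set_subset_Span[OF T us] by blast
    then have w: "w \<in> Span T us"
      unfolding w_def using a b k SD(3,4) TE(6)[OF t b(1)] by simp
    have "u \<ominus> t \<otimes> w = (\<one> \<ominus> t \<otimes> a) \<otimes> (u \<ominus> t \<otimes> (b \<otimes> v \<oplus> f))
        \<oplus> (t \<otimes> b) \<otimes> (v \<ominus> t \<otimes> (a \<otimes> v \<oplus> e))"
      unfolding w_def using c v ac tc by algebra
    also have "\<dots> \<in> N" using ND(3,4) k uN vN TE(6)[OF t b(1)] by simp
    finally show ?thesis using w by blast
  qed
  with Cons.hyps[OF us] obtain s where s: "s \<in> T" "\<forall>u\<in>set us. (\<one> \<ominus> t \<otimes> s) \<otimes> u \<in> N"
    by blast
  have sc: "s \<in> carrier R" using s TE(1) by blast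
  have ks: "\<one> \<ominus> t \<otimes> s \<in> T" using T TE(3) TE(6)[OF t s(1)] by (rule subring_minus_closed)
  have ka: "\<one> \<ominus> t \<otimes> a \<in> T" using T TE(3) TE(6)[OF t a(1)] by (rule subring_minus_closed)
  have kc: "\<one> \<ominus> t \<otimes> s \<in> carrier R" using ks TE(1) by blast
  from Span_least[OF is_submodule_vimage[OF T N kc], of us] have eN: "(\<one> \<ominus> t \<otimes> s) \<otimes> e \<in> N"
    using s(2) us a(2) by blast
  \<comment> \<open>Determined by \<open>(1 - t s)(1 - t a) = 1 - t s'\<close>: the first factor
    comes from the induction, the second from the elimination of \<open>v\<close>.\<close>
  define s' where "s' = s \<oplus> a \<ominus> t \<otimes> (s \<otimes> a)"
  have s'T: "s' \<in> T"
    unfolding s'_def using T TE(7)[OF s(1) a(1)] TE(6)[OF t TE(6)[OF s(1) a(1)]]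
    by (rule subring_minus_closed)
  have "(\<one> \<ominus> t \<otimes> s') \<otimes> v = (\<one> \<ominus> t \<otimes> s) \<otimes> (v \<ominus> t \<otimes> (a \<otimes> v \<oplus> e)) \<oplus> t \<otimes> ((\<one> \<ominus> t \<otimes> s) \<otimes> e)"
    unfolding s'_def using v ac tc sc by algebra
  also have "\<dots> \<in> N" using ND(3,4) ks vN eN t by simp
  finally have "(\<one> \<ominus> t \<otimes> s') \<otimes> v \<in> N" .
  moreover have "(\<one> \<ominus> t \<otimes> s') \<otimes> u \<in> N" if u: "u \<in> set us" for u
  proof -
    have "u \<in> carrier R" using u us by blast
    then have "(\<one> \<ominus> t \<otimes> s') \<otimes> u = (\<one> \<ominus> t \<otimes> a) \<otimes> ((\<one> \<ominus> t \<otimes> s) \<otimes> u)"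
      unfolding s'_def using ac tc sc by algebra
    then show ?thesis using ND(4)[OF ka] s(2) u by simp
  qed
  ultimately show ?case using s'T by auto
qed

lemma subring_add_ideal:
  assumes "subring T R" "subring U R" "T \<subseteq> U" "ideal J (sub_ring R U)"
  shows "subring (T <+>\<^bsub>R\<^esub> J) R" "T \<subseteq> T <+>\<^bsub>R\<^esub> J" "J \<subseteq> T <+>\<^bsub>R\<^esub> J" "T <+>\<^bsub>R\<^esub> J \<subseteq> U"
proof -
  note TE = subringE[OF assms(1)]
  note UE = subringE[OF assms(2)]
  note JD = ideal_subringD[OF assms(2,4)]
  have mem: "x \<in> T <+>\<^bsub>R\<^esub> J \<longleftrightarrow> (\<exists>t\<in>T. \<exists>j\<in>J. x = t \<oplus> j)" for x
    unfolding set_add_def' by blast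
  have Jc: "J \<subseteq> carrier R" using JD(1) UE(1) by blast
  show sub: "T <+>\<^bsub>R\<^esub> J \<subseteq> U" using assms(3) JD(1) UE(7) unfolding mem subset_iff by auto
  show "T \<subseteq> T <+>\<^bsub>R\<^esub> J"
  proof
    fix t assume "t \<in> T"
    moreover from this have "t = t \<oplus> \<zero>" using TE(1) by auto
    ultimately show "t \<in> T <+>\<^bsub>R\<^esub> J" unfolding mem using JD(2) by blast
  qed
  then have one: "\<one> \<in> T <+>\<^bsub>R\<^esub> J" using TE(3) by blast
  show "J \<subseteq> T <+>\<^bsub>R\<^esub> J"
  proof
    fix j assume "j \<in> J"
    moreover from this have "j = \<zero> \<oplus> j" using Jc by auto
    ultimately show "j \<in> T <+>\<^bsub>R\<^esub> J" unfolding mem using TE(2) by blast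
  qed
  show "subring (T <+>\<^bsub>R\<^esub> J) R"
  proof (rule subringI)
    show "T <+>\<^bsub>R\<^esub> J \<subseteq> carrier R" using sub UE(1) by blast
    show "\<one> \<in> T <+>\<^bsub>R\<^esub> J" by (rule one)
  next
    fix h assume "h \<in> T <+>\<^bsub>R\<^esub> J"
    then obtain t j where *: "t \<in> T" "j \<in> J" "h = t \<oplus> j" unfolding mem by blast
    then have "t \<in> carrier R" "j \<in> carrier R" using TE(1) Jc by blast+
    then have "\<ominus> h = \<ominus> t \<oplus> \<ominus> j" unfolding * by algebra
    then show "\<ominus> h \<in> T <+>\<^bsub>R\<^esub> J" unfolding mem using TE(5)[OF *(1)] JD(6)[OF *(2)] by blast
  next
    fix h h' assume "h \<in> T <+>\<^bsub>R\<^esub> J" "h' \<in> T <+>\<^bsub>R\<^esub> J"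
    then obtain t j t' j' where *: "t \<in> T" "j \<in> J" "h = t \<oplus> j" "t' \<in> T" "j' \<in> J" "h' = t' \<oplus> j'"
      unfolding mem by blast
    then have c: "t \<in> carrier R" "j \<in> carrier R" "t' \<in> carrier R" "j' \<in> carrier R"
      using TE(1) Jc by blast+
    have "h \<oplus> h' = (t \<oplus> t') \<oplus> (j \<oplus> j')" unfolding * using c by algebra
    then show "h \<oplus> h' \<in> T <+>\<^bsub>R\<^esub> J"
      unfolding mem using TE(7)[OF *(1,4)] JD(3)[OF *(2,5)] by blast
    have "h \<otimes> h' = t \<otimes> t' \<oplus> (t \<otimes> j' \<oplus> (t' \<otimes> j \<oplus> j \<otimes> j'))" unfolding * using c by algebra
    moreover have "t \<otimes> j' \<oplus> (t' \<otimes> j \<oplus> j \<otimes> j') \<in> J" using JD * assms(3) by (simp add: subset_iff)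
    ultimately show "h \<otimes> h' \<in> T <+>\<^bsub>R\<^esub> J"
      unfolding mem using TE(6)[OF *(1,4)] by blast
  qed
qed

lemma conductor_ideal:
  assumes "subring T R" "subring U R" "T \<subseteq> U"
  shows "conductor R T U \<subseteq> T" "ideal (conductor R T U) (sub_ring R U)"
    "ideal (conductor R T U) (sub_ring R T)"
proof -
  note TE = subringE[OF assms(1)]
  note UE = subringE[OF assms(2)]
  show CT: "conductor R T U \<subseteq> T"
  proof
    fix x assume x: "x \<in> conductor R T U"
    then have "x \<otimes> \<one> \<in> T" "x \<in> carrier R" using UE(1,3) unfolding conductor_def by auto
    then show "x \<in> T" by simp
  qed
  have "x \<oplus> y \<in> conductor R T U" if "x \<in> conductor R T U" "y \<in> conductor R T U" for x y
    unfolding conductor_def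
  proof (intro CollectI conjI ballI)
    show "x \<oplus> y \<in> U" using that UE(7) unfolding conductor_def by blast
    fix u assume u: "u \<in> U"
    have "x \<in> carrier R" "y \<in> carrier R" "u \<in> carrier R"
      using that u UE(1) unfolding conductor_def by auto
    then show "(x \<oplus> y) \<otimes> u \<in> T" using that u TE(7) unfolding conductor_def by (simp add: l_distr)
  qed
  moreover have m: "u \<otimes> x \<in> conductor R T U" if "x \<in> conductor R T U" "u \<in> U" for x u
    unfolding conductor_def
  proof (intro CollectI conjI ballI)
    show "u \<otimes> x \<in> U" using that UE(6) unfolding conductor_def by blast
    fix v assume v: "v \<in> U"
    have "x \<in> carrier R" "v \<in> carrier R" "u \<in> carrier R"
      using that v UE(1) unfolding conductor_def by auto
    then have "u \<otimes> x \<otimes> v = x \<otimes> (u \<otimes> v)" by algebra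
    then show "u \<otimes> x \<otimes> v \<in> T" using that UE(6)[OF that(2) v] unfolding conductor_def by simp
  qed
  moreover have "\<zero> \<in> conductor R T U"
    using UE(1,2) TE(2) unfolding conductor_def by (auto simp: subset_iff)
  ultimately show "ideal (conductor R T U) (sub_ring R U)" "ideal (conductor R T U) (sub_ring R T)"
    unfolding ideal_subring_iff[OF assms(2)] ideal_subring_iff[OF assms(1)]
    using CT assms(3) by auto
qed

text \<open>For \<open>t\<close> outside the conductor, \<open>t U\<close> is not contained in
  \<open>T\<close>, so the ring \<open>T + t U\<close> must be all of \<open>U\<close> by
  minimality. As \<open>U\<close> is a finite \<open>T\<close>-module, Nakayama's lemma relative to
  \<open>T\<close> gives \<open>1 - t s\<close> with \<open>(1 - t s) U \<subseteq> T\<close>, which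
  is membership in the conductor.\<close>

lemma minimal_integral_conductor:
  assumes min: "minimal_extension R T U" and int: "integral_extension R T U"
  shows "\<one> \<notin> conductor R T U"
    and "\<And>t. \<lbrakk>t \<in> T; t \<notin> conductor R T U\<rbrakk> \<Longrightarrow> \<exists>s\<in>T. \<one> \<ominus> t \<otimes> s \<in> conductor R T U"
proof -
  note D = minimal_extensionD[OF min]
  note TE = subringE[OF D(3)]
  note UE = subringE[OF D(4)]
  note C = conductor_ideal[OF D(3,4,1)]
  show "\<one> \<notin> conductor R T U"
  proof
    assume one: "\<one> \<in> conductor R T U"
    have "u \<in> T" if "u \<in> U" for u
    proof -
      have "\<one> \<otimes> u \<in> T" using one that unfolding conductor_def by blast
      then show ?thesis using that UE(1) by auto
    qed
    then show False using D(1,2) by blast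
  qed
  fix t assume t: "t \<in> T" "t \<notin> conductor R T U"
  have tU: "t \<in> U" and tc: "t \<in> carrier R" using t D(1) TE(1) by blast+
  interpret U: cring "sub_ring R U" using D(4) by (rule subring_is_cring)
  define J where "J = {x \<otimes> t | x. x \<in> U}"
  have J: "ideal J (sub_ring R U)"
    using U.cgenideal_ideal[of t] tU unfolding cgenideal_def J_def by simp
  note TJ = subring_add_ideal[OF D(3,4,1) J]
  have "\<not> J \<subseteq> T"
  proof
    assume JT: "J \<subseteq> T"
    have "t \<otimes> u \<in> T" if u: "u \<in> U" for u
    proof -
      have "t \<otimes> u = u \<otimes> t" using u UE(1) tc by (auto intro: m_comm)
      then show ?thesis using JT u unfolding J_def by blast
    qed
    then show False using t tU unfolding conductor_def by blast
  qed
  then have TJU: "T <+>\<^bsub>R\<^esub> J = U" using D(5)[OF TJ(1,2,4)] TJ(3) by blast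
  obtain us where us: "set us \<subseteq> U" "Span T us = U"
    using minimal_integral_finite_extension[OF min int] unfolding finite_extension_def by blast
  have usc: "set us \<subseteq> carrier R" using us UE(1) by blast
  have TT: "is_submodule T T" using subring_is_submodule[OF D(3,3)] by simp
  have "\<exists>w\<in>Span T us. u \<ominus> t \<otimes> w \<in> T" if "u \<in> set us" for u
  proof -
    have "u \<in> T <+>\<^bsub>R\<^esub> J" using that us TJU by blast
    then obtain a x where ax: "a \<in> T" "x \<in> U" "u = a \<oplus> x \<otimes> t"
      unfolding set_add_def' J_def by blast
    then have "a \<in> carrier R" "x \<in> carrier R" using TE(1) UE(1) by blast+
    then have "u \<ominus> t \<otimes> x = a" unfolding ax using tc by algebra
    then show ?thesis using ax us(2) by metis
  qed
  from nakayama_Span[OF D(3) TT t(1) usc this] obtain s where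
    s: "s \<in> T" "\<forall>u\<in>set us. (\<one> \<ominus> t \<otimes> s) \<otimes> u \<in> T" by blast
  define k where "k = \<one> \<ominus> t \<otimes> s"
  have kT: "k \<in> T" unfolding k_def using D(3) TE(3) TE(6)[OF t(1) s(1)] by (rule subring_minus_closed)
  then have kc: "k \<in> carrier R" using TE(1) by blast
  from Span_least[OF is_submodule_vimage[OF D(3) TT kc], of us] have "\<forall>u\<in>U. k \<otimes> u \<in> T"
    using s(2) usc us(2) unfolding k_def by blast
  then have "k \<in> conductor R T U" using kT D(1) unfolding conductor_def by blast
  then show "\<exists>s\<in>T. \<one> \<ominus> t \<otimes> s \<in> conductor R T U" using s(1) unfolding k_def by blast
qed

end

subsection \<open>The finite chain condition\<close>

lemma FCP_ex_maximal:
  assumes "FCP A T U" "F \<subseteq> intermediate_rings A T U" "F \<noteq> {}"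
  obtains B where "B \<in> F" "\<And>C. \<lbrakk>C \<in> F; B \<subseteq> C\<rbrakk> \<Longrightarrow> C = B"
proof -
  have "\<exists>B\<in>F. \<forall>C\<in>F. B \<subseteq> C \<longrightarrow> C = B"
  proof (rule subset_Zorn_nonempty[OF assms(3)])
    fix C assume C: "C \<noteq> {}" "subset.chain F C"
    then have "subset.chain (intermediate_rings A T U) C"
      using assms(2) unfolding subset_chain_def by blast
    then have "finite C" using assms(1) unfolding FCP_def by blast
    then show "\<Union>C \<in> F" using C Union_in_chain[of C F] unfolding subset_chain_def by blast
  qed
  then show thesis using that by metis
qed

text \<open>A maximal chain in \<open>F\<close> is finite, hence contains its own intersection. Any
  member of \<open>F\<close> below that intersection could be added to the chain and so belongs to
  it already.\<close>

lemma FCP_ex_minimal: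
  assumes "FCP A T U" "F \<subseteq> intermediate_rings A T U" "F \<noteq> {}"
  obtains B where "B \<in> F" "\<And>C. \<lbrakk>C \<in> F; C \<subseteq> B\<rbrakk> \<Longrightarrow> C = B"
proof -
  obtain K where K: "subset.maxchain F K" using subset.Hausdorff by blast
  then have ch: "subset.chain F K" by (rule subset.maxchain_imp_chain)
  then have "subset.chain (intermediate_rings A T U) K"
    using assms(2) unfolding subset_chain_def by blast
  then have "finite K" using assms(1) unfolding FCP_def by blast
  moreover have "K \<noteq> {}"
  proof
    assume "K = {}"
    moreover obtain B where "B \<in> F" using assms(3) by blast
    then have "subset.chain F {B}" unfolding subset_chain_def by blast
    ultimately show False using K unfolding subset.maxchain_def by blast
  qed
  ultimately have IK: "\<Inter>K \<in> K" using ch Inter_in_chain by blast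
  have "C = \<Inter>K" if "C \<in> F" "C \<subseteq> \<Inter>K" for C
  proof -
    have "subset.chain F (insert C K)"
      using ch that unfolding subset_chain_def by blast
    then have "C \<in> K" using K unfolding subset.maxchain_def by blast
    then show ?thesis using that by blast
  qed
  moreover have "\<Inter>K \<in> F" using IK ch unfolding subset_chain_def by blast
  ultimately show thesis using that by blast
qed

context cring
begin

text \<open>The last assumption on \<open>M\<close> says that coefficients from \<open>T\<close> are
  zero or invertible modulo \<open>M\<close>. The lowest invertible coefficient of an integral
  equation of \<open>x\<close> can be normalized to 1, and the power of \<open>x\<close> below it
  factors out.\<close>

lemma ex_power_multiple_mem_ideal:
  assumes T: "subring T R" and U: "subring U R" and TU: "T \<subseteq> U"
    and int: "integral_extension R T U" and J: "ideal J (sub_ring R U)" and M: "M \<subseteq> J" "\<one> \<notin> M"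
      "\<And>t. \<lbrakk>t \<in> T; t \<notin> M\<rbrakk> \<Longrightarrow> \<exists>s\<in>T. \<one> \<ominus> t \<otimes> s \<in> M"
    and x: "x \<in> U"
  obtains n :: nat and y where "y \<in> U" "x [^] n \<otimes> (\<one> \<ominus> y \<otimes> x) \<in> J"
proof -
  note TE = subringE[OF T]
  note UE = subringE[OF U]
  note JD = ideal_subringD[OF U J]
  have xc: "x \<in> carrier R" using x UE(1) by blast
  have aux: "\<exists>n. \<exists>y\<in>U. x [^] (n::nat) \<otimes> (\<one> \<ominus> y \<otimes> x) \<in> J"
    if "set cs \<subseteq> T" "\<not> set cs \<subseteq> M" "x [^] (a::nat) \<otimes> eval cs x \<in> J" for cs a
    using that
  \<comment> \<open>The last list entry is the constant coefficient. If it is in \<open>M\<close>,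
    it contributes an element of \<open>J\<close> and is dropped, turning one factor
    \<open>x\<close> of the remaining sum into a larger exponent \<open>a\<close>.\<close>
  proof (induct cs arbitrary: a rule: rev_induct)
    case Nil
    then show ?case by simp
  next
    case (snoc c ds)
    have cT: "c \<in> T" and dT: "set ds \<subseteq> T" using snoc.prems(1) by auto
    have cc: "c \<in> carrier R" using cT TE(1) by blast
    have eU: "eval ds x \<in> U" using dT TU x by (intro eval_subring_closed[OF U]) auto
    then have ec: "eval ds x \<in> carrier R" using UE(1) by blast
    have pU: "x [^] a \<in> U" using subring_pow_closed[OF U x] .
    then have pc: "x [^] a \<in> carrier R" using UE(1) by blast
    have ev: "eval (ds @ [c]) x = eval ds x \<otimes> x \<oplus> c"
      using dT cT TE(1) xc by (intro eval_append_aux) auto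
    have inJ: "x [^] a \<otimes> (eval ds x \<otimes> x \<oplus> c) \<in> J" using snoc.prems(3) unfolding ev .
    show ?case
    proof (cases "c \<in> M")
      case True
      have "x [^] Suc a \<otimes> eval ds x = x [^] a \<otimes> (eval ds x \<otimes> x \<oplus> c) \<ominus> x [^] a \<otimes> c"
        unfolding nat_pow_Suc using pc xc ec cc by algebra
      also have "\<dots> \<in> J" using inJ JD(4)[OF pU, of c] True M(1) JD(7) by blast
      finally have "x [^] Suc a \<otimes> eval ds x \<in> J" .
      moreover have "\<not> set ds \<subseteq> M" using snoc.prems(2) True by simp
      ultimately show ?thesis using snoc.hyps dT by blast
    next
      case False
      then obtain s where s: "s \<in> T" "\<one> \<ominus> c \<otimes> s \<in> M" using M(3) cT by blast
      have sU: "s \<in> U" and sc: "s \<in> carrier R" using s TU TE(1) by blast+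
      \<comment> \<open>Since \<open>s\<close> inverts \<open>c\<close> modulo \<open>M\<close>,
        multiplying \<open>eval ds x \<otimes> x \<oplus> c\<close> by \<open>s\<close> gives
        \<open>1 - y x\<close> up to a multiple of \<open>1 - c s\<close>.\<close>
      define y where "y = \<ominus> (s \<otimes> eval ds x)"
      have yU: "y \<in> U" unfolding y_def using UE(5,6) sU eU by simp
      have "x [^] a \<otimes> (\<one> \<ominus> y \<otimes> x) = s \<otimes> (x [^] a \<otimes> (eval ds x \<otimes> x \<oplus> c)) \<oplus> x [^] a \<otimes> (\<one> \<ominus> c \<otimes> s)"
        unfolding y_def using pc xc ec cc sc by algebra
      also have "\<dots> \<in> J" using JD(3) JD(4)[OF sU inJ] JD(4)[OF pU, of "\<one> \<ominus> c \<otimes> s"] s(2) M(1) by blast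
      finally show ?thesis using yU by blast
    qed
  qed
  obtain cs where cs: "set cs \<subseteq> T" "x [^] length cs \<oplus> eval cs x = \<zero>"
    using integral_extensionE[OF int x xc] .
  \<comment> \<open>The leading coefficient \<open>\<one>\<close> is outside \<open>M\<close>, so
    the induction is sure to meet an invertible coefficient.\<close>
  have "eval (\<one> # cs) x = \<zero>" using cs(2) xc by simp
  then have "x [^] (0::nat) \<otimes> eval (\<one> # cs) x \<in> J" using JD(2) by simp
  moreover have "set (\<one> # cs) \<subseteq> T" "\<not> set (\<one> # cs) \<subseteq> M" using cs(1) TE(3) M(2) by auto
  ultimately show thesis using aux that by blast
qed

text \<open>FCP supplies a maximal counterexample \<open>B\<close> and a ring \<open>C\<close>
  minimal above it. The claim holds for \<open>C\<close>, and the conductor of the minimal step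
  \<open>B \<subset> C\<close> allows the coefficient argument over \<open>B\<close>; multiplying
  the two resulting elements settles \<open>B\<close>.\<close>

lemma FCP_ex_power_multiple_mem_conductor:
  assumes T: "subring T R" and V: "subring V R" and TV: "T \<subseteq> V"
    and int: "integral_extension R T V" and fcp: "FCP R T V" and x: "x \<in> V"
  shows "\<exists>n. \<exists>y\<in>V. x [^] (n::nat) \<otimes> (\<one> \<ominus> y \<otimes> x) \<in> conductor R T V"
proof (rule ccontr)
  note VE = subringE[OF V]
  have xc: "x \<in> carrier R" using x VE(1) by blast
  let ?P = "\<lambda>B. \<exists>n. \<exists>y\<in>V. x [^] (n::nat) \<otimes> (\<one> \<ominus> y \<otimes> x) \<in> conductor R B V"
  assume "\<not> ?P T"
  then have "{B \<in> intermediate_rings R T V. \<not> ?P B} \<noteq> {}"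
    using T TV unfolding intermediate_rings_def by blast
  then obtain B where B0: "B \<in> {B \<in> intermediate_rings R T V. \<not> ?P B}"
    and Bmax: "\<And>C. \<lbrakk>C \<in> {B \<in> intermediate_rings R T V. \<not> ?P B}; B \<subseteq> C\<rbrakk> \<Longrightarrow> C = B"
    using FCP_ex_maximal[OF fcp, of "{B \<in> intermediate_rings R T V. \<not> ?P B}"] by blast
  have B: "subring B R" "T \<subseteq> B" "B \<subseteq> V" and nP: "\<not> ?P B"
    using B0 unfolding intermediate_rings_def by auto
  \<comment> \<open>The top ring is no counterexample, since the conductor of \<open>V\<close> in
    itself is \<open>V\<close>; hence there is room above \<open>B\<close>.\<close>
  have "x [^] (0::nat) \<otimes> (\<one> \<ominus> \<zero> \<otimes> x) \<in> conductor R V V"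
    using xc VE(1,3,6) unfolding conductor_def by (simp add: a_minus_def)
  then have "?P V" using VE(2) by blast
  then have "B \<noteq> V" using nP by blast
  then have "V \<in> {C \<in> intermediate_rings R T V. B \<subset> C}"
    using V TV B(3) unfolding intermediate_rings_def by blast
  then obtain C where C0: "C \<in> {C \<in> intermediate_rings R T V. B \<subset> C}"
    and Cmin: "\<And>D. \<lbrakk>D \<in> {C \<in> intermediate_rings R T V. B \<subset> C}; D \<subseteq> C\<rbrakk> \<Longrightarrow> D = C"
    using FCP_ex_minimal[OF fcp, of "{C \<in> intermediate_rings R T V. B \<subset> C}"] by blast
  have C: "subring C R" "T \<subseteq> C" "C \<subseteq> V" "B \<subset> C"
    using C0 unfolding intermediate_rings_def by auto
  have min: "minimal_extension R B C"
  proof -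
    have "D = B \<or> D = C" if "D \<in> intermediate_rings R B C" for D
    proof -
      have D: "subring D R" "B \<subseteq> D" "D \<subseteq> C" using that unfolding intermediate_rings_def by auto
      then have "D \<in> {C \<in> intermediate_rings R T V. B \<subset> C}" if "D \<noteq> B"
        using that B(2) C(3) unfolding intermediate_rings_def by blast
      then show ?thesis using Cmin[of D] D(3) by blast
    qed
    moreover have "B \<in> intermediate_rings R B C" "C \<in> intermediate_rings R B C"
      using B C unfolding intermediate_rings_def by auto
    ultimately show ?thesis unfolding minimal_extension_def using C(4) by blast
  qed
  have intBC: "integral_extension R B C" and intBV: "integral_extension R B V"
    using integral_extension_mono[OF int] B C by auto
  note M = minimal_integral_conductor[OF min intBC]
  have BC: "B \<subseteq> C" using C(4) by blast
  note ID = conductor_ideal[OF C(1) V C(3)]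
  note IV = ideal_subringD[OF V ID(2)]
  have "?P C" using Bmax[of C] C C0 by blast
  then obtain m z where mz: "z \<in> V" "x [^] (m::nat) \<otimes> (\<one> \<ominus> z \<otimes> x) \<in> conductor R C V" by blast
  \<comment> \<open>An ideal of \<open>V\<close>, because the conductor of
    \<open>C \<subseteq> V\<close> is one. It contains the conductor of
    \<open>B \<subset> C\<close>, as the former lies in \<open>C\<close>. Elements of
    \<open>J\<close> multiply that of \<open>C \<subseteq> V\<close> into the conductor of
    \<open>B \<subseteq> V\<close>.\<close>
  define J where "J = {w \<in> V. \<forall>v\<in>conductor R C V. w \<otimes> v \<in> B}"
  have J: "ideal J (sub_ring R V)"
    unfolding ideal_subring_iff[OF V]
  proof (intro conjI ballI)
    show "J \<subseteq> V" unfolding J_def by blast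
    show "\<zero> \<in> J" unfolding J_def using VE(1,2) subringE(2)[OF B(1)] IV(1) by (auto simp: subset_iff)
  next
    fix a b assume ab: "a \<in> J" "b \<in> J"
    show "a \<oplus> b \<in> J"
      unfolding J_def
    proof (intro CollectI conjI ballI)
      show "a \<oplus> b \<in> V" using ab VE(7) unfolding J_def by blast
      fix v assume v: "v \<in> conductor R C V"
      have "a \<in> carrier R" "b \<in> carrier R" "v \<in> carrier R"
        using ab v VE(1) IV(1) unfolding J_def by blast+
      then show "(a \<oplus> b) \<otimes> v \<in> B" using ab v subringE(7)[OF B(1)] unfolding J_def by (simp add: l_distr)
    qed
  next
    fix u a assume u: "u \<in> V" and a: "a \<in> J"
    show "u \<otimes> a \<in> J"
      unfolding J_def
    proof (intro CollectI conjI ballI)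
      show "u \<otimes> a \<in> V" using u a VE(6) unfolding J_def by blast
      fix v assume v: "v \<in> conductor R C V"
      have "a \<in> carrier R" "u \<in> carrier R" "v \<in> carrier R"
        using a u v VE(1) IV(1) unfolding J_def by blast+
      then have "u \<otimes> a \<otimes> v = a \<otimes> (u \<otimes> v)" by algebra
      then show "u \<otimes> a \<otimes> v \<in> B" using a IV(4)[OF u v] unfolding J_def by simp
    qed
  qed
  have MJ: "conductor R B C \<subseteq> J"
    using C(3) ID(1) unfolding J_def conductor_def[of R B C] by blast
  obtain n y where ny: "y \<in> V" "x [^] (n::nat) \<otimes> (\<one> \<ominus> y \<otimes> x) \<in> J"
    using ex_power_multiple_mem_ideal[OF B(1) V B(3) intBV J MJ M x] .
  let ?w = "x [^] n \<otimes> (\<one> \<ominus> y \<otimes> x)"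
  let ?v = "x [^] m \<otimes> (\<one> \<ominus> z \<otimes> x)"
  have wV: "?w \<in> V" and vV: "?v \<in> V" using ny mz IV(1) unfolding J_def by blast+
  have "?w \<otimes> ?v \<in> conductor R B V"
    unfolding conductor_def
  proof (intro CollectI conjI ballI)
    show "?w \<otimes> ?v \<in> V" using VE(6)[OF wV vV] .
    fix u assume u: "u \<in> V"
    have "?w \<in> carrier R" "?v \<in> carrier R" "u \<in> carrier R" using wV vV u VE(1) by blast+
    then have "?w \<otimes> ?v \<otimes> u = ?w \<otimes> (?v \<otimes> u)" by (rule m_assoc)
    also have "\<dots> \<in> B" using ny(2) IV(5)[OF u mz(2)] unfolding J_def by blast
    finally show "?w \<otimes> ?v \<otimes> u \<in> B" .
  qed
  \<comment> \<open>The shape of the claim survives multiplication: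
    \<open>(1 - y x)(1 - z x) = 1 - (y + z - y z x) x\<close>.\<close>
  moreover have "?w \<otimes> ?v = x [^] (n + m) \<otimes> (\<one> \<ominus> (y \<oplus> z \<ominus> y \<otimes> z \<otimes> x) \<otimes> x)"
  proof -
    have "y \<in> carrier R" "z \<in> carrier R" "x [^] n \<in> carrier R" "x [^] m \<in> carrier R"
      using ny mz VE(1) xc by auto
    then show ?thesis using xc unfolding nat_pow_mult[OF xc, symmetric] by algebra
  qed
  moreover have "y \<oplus> z \<ominus> y \<otimes> z \<otimes> x \<in> V"
    using ny(1) mz(1) x VE(6,7) subring_minus_closed[OF V] by simp
  ultimately show False using nP by metis
qed

text \<open>Let \<open>x\<close> be in \<open>Q1\<close> but not in \<open>Q2\<close>. The conductor
  element \<open>z\<close> lies in \<open>Q1 \<inter> T\<close>, hence in \<open>Q2\<close>, which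
  makes \<open>y x\<close> congruent to 1 modulo \<open>Q2\<close>. So \<open>e\<close> is in
  \<open>Q1\<close> and not in \<open>Q2\<close>, although u-closedness puts it into
  \<open>T\<close>, where the two primes agree.\<close>

theorem u_closed_imp_i_extension:
  assumes T: "subring T R" and V: "subring V R" and TV: "T \<subseteq> V"
    and int: "integral_extension R T V" and fcp: "FCP R T V" and u: "u_closed R T V"
  shows "i_extension R T V"
proof -
  note VE = subringE[OF V]
  note CI = conductor_ideal[OF T V TV]
  note C = ideal_subringD[OF V CI(2)]
  have main: "Q1 \<subseteq> Q2"
    if Q: "primeideal Q1 (sub_ring R V)" "primeideal Q2 (sub_ring R V)" "Q1 \<inter> T = Q2 \<inter> T" for Q1 Q2
  proof (rule ccontr)
    note Q1D = primeideal_subringD[OF V Q(1)]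
    note Q1I = ideal_subringD[OF V Q1D(1)]
    note Q2D = primeideal_subringD[OF V Q(2)]
    note Q2I = ideal_subringD[OF V Q2D(1)]
    assume "\<not> Q1 \<subseteq> Q2"
    then obtain x where x: "x \<in> Q1" "x \<notin> Q2" by blast
    then have xV: "x \<in> V" and xc: "x \<in> carrier R" using Q1I(1) VE(1) by blast+
    obtain m y where my: "y \<in> V" "x [^] (m::nat) \<otimes> (\<one> \<ominus> y \<otimes> x) \<in> conductor R T V"
      using FCP_ex_power_multiple_mem_conductor[OF T V TV int fcp xV] by blast
    have yc: "y \<in> carrier R" using my VE(1) by blast
    \<comment> \<open>The exponent must be positive, also when \<open>m = 0\<close>: only then do
      \<open>x [^] n\<close>, \<open>z\<close> and \<open>e\<close> lie in
      \<open>Q1\<close>.\<close>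
    define n where "n = Suc m"
    define z where "z = x [^] n \<otimes> (\<one> \<ominus> y \<otimes> x)"
    have p: "x [^] n \<in> V" "y [^] n \<in> V" using subring_pow_closed[OF V] xV my by blast+
    have pc: "x [^] n \<in> carrier R" "y [^] n \<in> carrier R" "x [^] m \<in> carrier R" using xc yc by auto
    have "z = x \<otimes> (x [^] m \<otimes> (\<one> \<ominus> y \<otimes> x))"
      unfolding z_def n_def nat_pow_Suc using xc yc pc(3) by algebra
    then have z: "z \<in> conductor R T V" using C(4)[OF xV my(2)] by simp
    then have zV: "z \<in> V" using C(1) by blast
    have xnQ1: "x [^] n \<in> Q1"
      unfolding n_def nat_pow_Suc using Q1I(4) x(1) subring_pow_closed[OF V xV] by blast
    have rest: "\<one> \<ominus> y \<otimes> x \<in> V"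
      using subring_minus_closed[OF V VE(3)] VE(6)[OF my(1) xV] by blast
    have "z \<in> Q1" unfolding z_def using Q1I(5)[OF rest xnQ1] .
    then have "z \<in> Q2" using z CI(1) Q(3) by blast
    then have oneyx: "\<one> \<ominus> y \<otimes> x \<in> Q2"
      unfolding z_def using Q2D(3)[OF p(1) rest] Q2D(4)[OF xV] x(2) by blast
    define e where "e = y [^] n \<otimes> x [^] n"
    have eV: "e \<in> V" unfolding e_def using VE(6) p by blast
    have ec: "e \<in> carrier R" using eV VE(1) by blast
    \<comment> \<open>\<open>e\<close> is idempotent modulo the ideal generated by \<open>z\<close>, since \<open>1 - y x\<close> divides \<open>1 - (y x)\<^sup>n\<close>\<close>
    have div: "\<exists>k\<in>V. \<one> \<ominus> (y \<otimes> x) [^] (i::nat) = (\<one> \<ominus> y \<otimes> x) \<otimes> k" for i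
    proof (induct i)
      case 0
      have "\<one> \<ominus> \<one> = (\<one> \<ominus> y \<otimes> x) \<otimes> \<zero>" using xc yc by algebra
      then show ?case using VE(2) by auto
    next
      case (Suc i)
      then obtain k where k: "k \<in> V" "\<one> \<ominus> (y \<otimes> x) [^] i = (\<one> \<ominus> y \<otimes> x) \<otimes> k" by blast
      have kc: "k \<in> carrier R" "(y \<otimes> x) [^] i \<in> carrier R" using k(1) VE(1) xc yc by auto
      have "\<one> \<ominus> (y \<otimes> x) [^] Suc i = (\<one> \<ominus> (y \<otimes> x) [^] i) \<otimes> (y \<otimes> x) \<oplus> (\<one> \<ominus> y \<otimes> x)"
        unfolding nat_pow_Suc using kc(2) xc yc by algebra
      also have "\<dots> = (\<one> \<ominus> y \<otimes> x) \<otimes> (k \<otimes> (y \<otimes> x) \<oplus> \<one>)"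
        unfolding k(2) using kc(1) xc yc by algebra
      finally show ?case using VE(7)[OF VE(6)[OF k(1) VE(6)[OF my(1) xV]] VE(3)] by blast
    qed
    obtain k where k: "k \<in> V" "\<one> \<ominus> (y \<otimes> x) [^] n = (\<one> \<ominus> y \<otimes> x) \<otimes> k" using div by blast
    have kc: "k \<in> carrier R" using k VE(1) by blast
    have "(y \<otimes> x) [^] n = e" unfolding e_def using nat_pow_distrib[OF yc xc] .
    then have k': "\<one> \<ominus> e = (\<one> \<ominus> y \<otimes> x) \<otimes> k" using k(2) by simp
    have e2: "e [^] (2::nat) = e \<otimes> e" using ec by (simp add: numeral_2_eq_2)
    have e3: "e [^] (3::nat) = e \<otimes> e \<otimes> e" using ec by (simp add: numeral_3_eq_3)
    have "e [^] (2::nat) \<ominus> e = \<ominus> (e \<otimes> (\<one> \<ominus> e))" unfolding e2 using ec by algebra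
    also have "\<dots> = \<ominus> (y [^] n \<otimes> k) \<otimes> z"
      unfolding k' unfolding e_def z_def using pc xc yc kc by algebra
    finally have A: "e [^] (2::nat) \<ominus> e = \<ominus> (y [^] n \<otimes> k) \<otimes> z" .
    have A': "e [^] (2::nat) \<ominus> e \<in> conductor R T V"
      unfolding A using C(4)[OF VE(5)[OF VE(6)[OF p(2) k(1)]] z] .
    have "e [^] (3::nat) \<ominus> e [^] (2::nat) = e \<otimes> (e [^] (2::nat) \<ominus> e)"
      unfolding e2 e3 using ec by algebra
    then have "e [^] (3::nat) \<ominus> e [^] (2::nat) \<in> conductor R T V"
      using C(4)[OF eV A'] by simp
    then have "e \<in> T" using u A' CI(1) eV unfolding u_closed_def by blast
    moreover have "e \<in> Q1" unfolding e_def using Q1I(4)[OF p(2) xnQ1] .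
    ultimately have "e \<in> Q2" using Q(3) by blast
    \<comment> \<open>\<open>Q2\<close> is prime and misses \<open>x\<close>, so it contains the
      other factor \<open>y\<close>; with \<open>1 - y x\<close> it then contains 1.\<close>
    then have "y \<in> Q2" unfolding e_def
      using Q2D(3)[OF p(2,1)] Q2D(4)[OF xV] Q2D(4)[OF my(1)] x(2) by blast
    then have "(\<one> \<ominus> y \<otimes> x) \<oplus> y \<otimes> x \<in> Q2" using Q2I(3)[OF oneyx] Q2I(5)[OF xV] by blast
    moreover have "(\<one> \<ominus> y \<otimes> x) \<oplus> y \<otimes> x = \<one>" using xc yc by algebra
    ultimately show False using Q2D(2) by simp
  qed
  show ?thesis
    unfolding i_extension_def
  proof (rule inj_onI)
    fix P Q assume PQ: "P \<in> Spec (sub_ring R V)" "Q \<in> Spec (sub_ring R V)" "P \<inter> T = Q \<inter> T"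
    then show "P = Q" using main[of P Q] main[of Q P] unfolding Spec_def by blast
  qed
qed

end

subsection \<open>Anodal elements\<close>

context cring
begin

text \<open>A monic quadratic equation makes \<open>T + T b\<close> closed under products, so it is
  \<open>T[b]\<close>. The uses are \<open>q = \<one>\<close> for a bad element and
  \<open>q = \<zero>\<close> for the generator of a ramified extension.\<close>

lemma subring_adjoin_quadratic:
  assumes T: "subring T R" and b: "b \<in> carrier R" and pq: "p \<in> T" "q \<in> T" "b \<otimes> b = p \<oplus> q \<otimes> b"
  defines "B \<equiv> {x \<oplus> y \<otimes> b | x y. x \<in> T \<and> y \<in> T}"
  shows "subring B R" "T \<subseteq> B" "b \<in> B"
    "\<And>V. \<lbrakk>subring V R; T \<subseteq> V; b \<in> V\<rbrakk> \<Longrightarrow> B \<subseteq> V"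
proof -
  note TE = subringE[OF T]
  have pqc: "p \<in> carrier R" "q \<in> carrier R" using pq TE(1) by auto
  show TB: "T \<subseteq> B"
  proof
    fix x assume x: "x \<in> T"
    then have "x = x \<oplus> \<zero> \<otimes> b" using TE(1) b by auto
    then show "x \<in> B" unfolding B_def using x TE(2) by blast
  qed
  have "b = \<zero> \<oplus> \<one> \<otimes> b" using b by simp
  then show "b \<in> B" unfolding B_def using TE(2,3) by blast
  show "B \<subseteq> V" if "subring V R" "T \<subseteq> V" "b \<in> V" for V
    using subringE(6,7)[OF that(1)] that(2,3) unfolding B_def by (auto simp: subset_iff)
  show "subring B R"
  proof (rule subringI)
    show "B \<subseteq> carrier R" unfolding B_def using TE(1) b by (auto simp: subset_iff)
    show "\<one> \<in> B" using TE(3) TB by blast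
  next
    fix h assume "h \<in> B"
    then obtain x y where *: "x \<in> T" "y \<in> T" "h = x \<oplus> y \<otimes> b" unfolding B_def by blast
    then have "x \<in> carrier R" "y \<in> carrier R" using TE(1) by blast+
    then have "\<ominus> h = (\<ominus> x) \<oplus> (\<ominus> y) \<otimes> b" unfolding * using b by algebra
    then show "\<ominus> h \<in> B" unfolding B_def using TE(5)[OF *(1)] TE(5)[OF *(2)] by blast
  next
    fix h h' assume "h \<in> B" "h' \<in> B"
    then obtain x y x' y' where *: "x \<in> T" "y \<in> T" "h = x \<oplus> y \<otimes> b"
      "x' \<in> T" "y' \<in> T" "h' = x' \<oplus> y' \<otimes> b" unfolding B_def by blast
    then have c: "x \<in> carrier R" "y \<in> carrier R" "x' \<in> carrier R" "y' \<in> carrier R"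
      using TE(1) by blast+
    have "h \<oplus> h' = (x \<oplus> x') \<oplus> (y \<oplus> y') \<otimes> b" unfolding * using b c by algebra
    then show "h \<oplus> h' \<in> B" unfolding B_def using TE(7)[OF *(1,4)] TE(7)[OF *(2,5)] by blast
    have "h \<otimes> h' = x \<otimes> x' \<oplus> (x \<otimes> y' \<oplus> x' \<otimes> y) \<otimes> b \<oplus> y \<otimes> y' \<otimes> (b \<otimes> b)"
      unfolding * using b c by algebra
    also have "\<dots> = (x \<otimes> x' \<oplus> y \<otimes> y' \<otimes> p) \<oplus> (x \<otimes> y' \<oplus> x' \<otimes> y \<oplus> y \<otimes> y' \<otimes> q) \<otimes> b"
      unfolding pq(3) using b c pqc by algebra
    finally have "h \<otimes> h' = (x \<otimes> x' \<oplus> y \<otimes> y' \<otimes> p) \<oplus> (x \<otimes> y' \<oplus> x' \<otimes> y \<oplus> y \<otimes> y' \<otimes> q) \<otimes> b" .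
    moreover have "x \<otimes> x' \<oplus> y \<otimes> y' \<otimes> p \<in> T" "x \<otimes> y' \<oplus> x' \<otimes> y \<oplus> y \<otimes> y' \<otimes> q \<in> T"
      using * pq(1,2) by (simp_all add: TE(6,7))
    ultimately show "h \<otimes> h' \<in> B" unfolding B_def by blast
  qed
qed

text \<open>\<open>Q\<close> is the kernel of the homomorphism \<open>T[b] \<rightarrow> T/M\<close>
  that sends \<open>b\<close> to \<open>e\<close>; it respects \<open>b b = c + b\<close> because
  \<open>c\<close> is in \<open>M\<close> and \<open>e\<close> is idempotent. The assumption on
  \<open>r\<close> makes it well defined: two representations \<open>x + y b\<close> and
  \<open>x' + y' b\<close> of one element yield such an \<open>r = y - y'\<close>. Taking
  \<open>e\<close> as 0 and as 1 gives two primes over \<open>M\<close>, told apart by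
  \<open>b\<close>.\<close>

lemma primeideal_adjoin_anodal:
  assumes T: "subring T R" and b: "b \<in> carrier R" and c: "c \<in> T" "b \<otimes> b = c \<oplus> b"
    and M: "primeideal M (sub_ring R T)" "c \<in> M"
      "\<And>r. \<lbrakk>r \<in> T; r \<otimes> b \<in> T\<rbrakk> \<Longrightarrow> r \<in> M \<and> r \<otimes> b \<in> M"
    and e: "e \<in> T" "e \<otimes> e = e"
  defines "B \<equiv> {x \<oplus> y \<otimes> b | x y. x \<in> T \<and> y \<in> T}"
  defines "Q \<equiv> {x \<oplus> y \<otimes> b | x y. x \<in> T \<and> y \<in> T \<and> x \<oplus> e \<otimes> y \<in> M}"
  shows "primeideal Q (sub_ring R B)" "Q \<inter> T = M" "b \<in> Q \<longleftrightarrow> e \<in> M"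
proof -
  note TE = subringE[OF T]
  note MD = primeideal_subringD[OF T M(1)]
  note MI = ideal_subringD[OF T MD(1)]
  have cc: "c \<in> carrier R" and ec: "e \<in> carrier R" using c e TE(1) by auto
  have "b \<otimes> b = c \<oplus> \<one> \<otimes> b" using c(2) b by simp
  note B = subring_adjoin_quadratic[OF T b c(1) TE(3) this, folded B_def]
  have mem: "x \<oplus> y \<otimes> b \<in> Q \<longleftrightarrow> x \<oplus> e \<otimes> y \<in> M" if xy: "x \<in> T" "y \<in> T" for x y
  proof
    assume "x \<oplus> y \<otimes> b \<in> Q"
    then obtain x' y' where *: "x \<oplus> y \<otimes> b = x' \<oplus> y' \<otimes> b" "x' \<in> T" "y' \<in> T" "x' \<oplus> e \<otimes> y' \<in> M"
      unfolding Q_def by blast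
    have cs: "x \<in> carrier R" "y \<in> carrier R" "x' \<in> carrier R" "y' \<in> carrier R"
      using xy * TE(1) by blast+
    have yT: "y \<ominus> y' \<in> T" using subring_minus_closed[OF T] xy * by blast
    have "(y \<ominus> y') \<otimes> b = (x \<oplus> y \<otimes> b) \<ominus> x \<ominus> y' \<otimes> b" using cs b by algebra
    also have "\<dots> = x' \<ominus> x" unfolding *(1) using cs b by algebra
    finally have yb: "(y \<ominus> y') \<otimes> b = x' \<ominus> x" .
    then have "y \<ominus> y' \<in> M" "x' \<ominus> x \<in> M"
      using M(3)[OF yT] subring_minus_closed[OF T *(2) xy(1)] by simp_all
    then have "(x' \<oplus> e \<otimes> y') \<ominus> (x' \<ominus> x) \<oplus> e \<otimes> (y \<ominus> y') \<in> M"
      using *(4) MI(3,7) MI(4)[OF e(1)] by blast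
    moreover have "(x' \<oplus> e \<otimes> y') \<ominus> (x' \<ominus> x) \<oplus> e \<otimes> (y \<ominus> y') = x \<oplus> e \<otimes> y"
      using cs ec by algebra
    ultimately show "x \<oplus> e \<otimes> y \<in> M" by simp
  next
    assume "x \<oplus> e \<otimes> y \<in> M"
    then show "x \<oplus> y \<otimes> b \<in> Q" unfolding Q_def using xy by blast
  qed
  have memT: "x \<in> Q \<longleftrightarrow> x \<in> M" if x: "x \<in> T" for x
  proof -
    have xc: "x \<in> carrier R" using x TE(1) by blast
    have "x \<oplus> \<zero> \<otimes> b = x" "x \<oplus> e \<otimes> \<zero> = x" using xc b ec by auto
    then show ?thesis using mem[OF x TE(2)] by simp
  qed
  show "Q \<inter> T = M" using memT MI(1) by blast
  have "\<zero> \<oplus> \<one> \<otimes> b = b" "\<zero> \<oplus> e \<otimes> \<one> = e" using b ec by auto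
  then show "b \<in> Q \<longleftrightarrow> e \<in> M" using mem[OF TE(2,3)] by simp
  \<comment> \<open>Evaluation at \<open>e\<close> is multiplicative only modulo \<open>M\<close>:
    the error is \<open>y y' c\<close>.\<close>
  have prod: "x \<otimes> x' \<oplus> y \<otimes> y' \<otimes> c \<in> T" "x \<otimes> y' \<oplus> x' \<otimes> y \<oplus> y \<otimes> y' \<in> T"
    "(x \<oplus> y \<otimes> b) \<otimes> (x' \<oplus> y' \<otimes> b) = (x \<otimes> x' \<oplus> y \<otimes> y' \<otimes> c) \<oplus> (x \<otimes> y' \<oplus> x' \<otimes> y \<oplus> y \<otimes> y') \<otimes> b"
    "(x \<otimes> x' \<oplus> y \<otimes> y' \<otimes> c) \<oplus> e \<otimes> (x \<otimes> y' \<oplus> x' \<otimes> y \<oplus> y \<otimes> y')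
      = (x \<oplus> e \<otimes> y) \<otimes> (x' \<oplus> e \<otimes> y') \<oplus> y \<otimes> y' \<otimes> c"
    if xy: "x \<in> T" "y \<in> T" "x' \<in> T" "y' \<in> T" for x y x' y'
  proof -
    have cs: "x \<in> carrier R" "y \<in> carrier R" "x' \<in> carrier R" "y' \<in> carrier R"
      using xy TE(1) by blast+
    show "x \<otimes> x' \<oplus> y \<otimes> y' \<otimes> c \<in> T" "x \<otimes> y' \<oplus> x' \<otimes> y \<oplus> y \<otimes> y' \<in> T"
      using xy c(1) by (simp_all add: TE(6,7))
    have "(x \<oplus> y \<otimes> b) \<otimes> (x' \<oplus> y' \<otimes> b)
        = x \<otimes> x' \<oplus> (x \<otimes> y' \<oplus> x' \<otimes> y) \<otimes> b \<oplus> y \<otimes> y' \<otimes> (b \<otimes> b)"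
      using b cs by algebra
    also have "\<dots> = (x \<otimes> x' \<oplus> y \<otimes> y' \<otimes> c) \<oplus> (x \<otimes> y' \<oplus> x' \<otimes> y \<oplus> y \<otimes> y') \<otimes> b"
      unfolding c(2) using b cs cc by algebra
    finally show "(x \<oplus> y \<otimes> b) \<otimes> (x' \<oplus> y' \<otimes> b)
        = (x \<otimes> x' \<oplus> y \<otimes> y' \<otimes> c) \<oplus> (x \<otimes> y' \<oplus> x' \<otimes> y \<oplus> y \<otimes> y') \<otimes> b" .
    have "(x \<oplus> e \<otimes> y) \<otimes> (x' \<oplus> e \<otimes> y') \<oplus> y \<otimes> y' \<otimes> c
        = x \<otimes> x' \<oplus> e \<otimes> (x \<otimes> y' \<oplus> x' \<otimes> y) \<oplus> (e \<otimes> e) \<otimes> (y \<otimes> y') \<oplus> y \<otimes> y' \<otimes> c"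
      using cs ec cc by algebra
    also have "\<dots> = (x \<otimes> x' \<oplus> y \<otimes> y' \<otimes> c) \<oplus> e \<otimes> (x \<otimes> y' \<oplus> x' \<otimes> y \<oplus> y \<otimes> y')"
      unfolding e(2) using cs ec cc by algebra
    finally show "(x \<otimes> x' \<oplus> y \<otimes> y' \<otimes> c) \<oplus> e \<otimes> (x \<otimes> y' \<oplus> x' \<otimes> y \<oplus> y \<otimes> y')
      = (x \<oplus> e \<otimes> y) \<otimes> (x' \<oplus> e \<otimes> y') \<oplus> y \<otimes> y' \<otimes> c" by (rule sym)
  qed
  have prodQ: "(x \<oplus> y \<otimes> b) \<otimes> (x' \<oplus> y' \<otimes> b) \<in> Q \<longleftrightarrow> (x \<oplus> e \<otimes> y) \<otimes> (x' \<oplus> e \<otimes> y') \<in> M"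
    if xy: "x \<in> T" "y \<in> T" "x' \<in> T" "y' \<in> T" for x y x' y'
  proof -
    let ?m = "(x \<oplus> e \<otimes> y) \<otimes> (x' \<oplus> e \<otimes> y')"
    have mT: "?m \<in> T" using xy e(1) by (simp add: TE(6,7))
    have yy: "y \<otimes> y' \<otimes> c \<in> M" using MI(4)[OF TE(6)[OF xy(2,4)] M(2)] .
    have cs: "?m \<in> carrier R" "y \<otimes> y' \<otimes> c \<in> carrier R" using mT yy MI(1) TE(1) by blast+
    have "?m \<oplus> y \<otimes> y' \<otimes> c \<in> M \<longleftrightarrow> ?m \<in> M"
    proof
      assume "?m \<oplus> y \<otimes> y' \<otimes> c \<in> M"
      then have "(?m \<oplus> y \<otimes> y' \<otimes> c) \<ominus> y \<otimes> y' \<otimes> c \<in> M" using yy by (rule MI(7))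
      moreover have "(m \<oplus> d) \<ominus> d = m" if "m \<in> carrier R" "d \<in> carrier R" for m d
        using that by algebra
      ultimately show "?m \<in> M" using cs by metis
    qed (use yy MI(3) in blast)
    then show ?thesis
      unfolding prod(3)[OF xy] mem[OF prod(1,2)[OF xy]] prod(4)[OF xy] .
  qed
  show "primeideal Q (sub_ring R B)"
    unfolding primeideal_subring_iff[OF B(1)] ideal_subring_iff[OF B(1)]
  proof (intro conjI ballI impI)
    show "Q \<subseteq> B" unfolding Q_def B_def by blast
    show "\<zero> \<in> Q" using memT TE(2) MI(2) by blast
    show "\<one> \<notin> Q" using memT TE(3) MD(2) by blast
  next
    fix h h' assume "h \<in> Q" "h' \<in> Q"
    then obtain x y x' y' where *: "x \<in> T" "y \<in> T" "h = x \<oplus> y \<otimes> b" "x \<oplus> e \<otimes> y \<in> M"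
      "x' \<in> T" "y' \<in> T" "h' = x' \<oplus> y' \<otimes> b" "x' \<oplus> e \<otimes> y' \<in> M" unfolding Q_def by blast
    have cs: "x \<in> carrier R" "y \<in> carrier R" "x' \<in> carrier R" "y' \<in> carrier R"
      using * TE(1) by blast+
    have "h \<oplus> h' = (x \<oplus> x') \<oplus> (y \<oplus> y') \<otimes> b" unfolding * using b cs by algebra
    moreover have "(x \<oplus> x') \<oplus> e \<otimes> (y \<oplus> y') = (x \<oplus> e \<otimes> y) \<oplus> (x' \<oplus> e \<otimes> y')" using ec cs by algebra
    ultimately show "h \<oplus> h' \<in> Q"
      using mem[OF TE(7)[OF *(1,5)] TE(7)[OF *(2,6)]] MI(3)[OF *(4,8)] by simp
  next
    fix h h' assume "h \<in> B" "h' \<in> Q"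
    then obtain x y x' y' where *: "x \<in> T" "y \<in> T" "h = x \<oplus> y \<otimes> b"
      "x' \<in> T" "y' \<in> T" "h' = x' \<oplus> y' \<otimes> b" "x' \<oplus> e \<otimes> y' \<in> M" unfolding Q_def B_def by blast
    have "(x \<oplus> e \<otimes> y) \<otimes> (x' \<oplus> e \<otimes> y') \<in> M"
      using MI(4)[OF _ *(7)] TE(7)[OF *(1) TE(6)[OF e(1) *(2)]] by blast
    then show "h \<otimes> h' \<in> Q" unfolding *(3,6) using prodQ[OF *(1,2,4,5)] by blast
  next
    fix h h' assume "h \<in> B" "h' \<in> B" and hQ: "h \<otimes> h' \<in> Q"
    then obtain x y x' y' where *: "x \<in> T" "y \<in> T" "h = x \<oplus> y \<otimes> b"
      "x' \<in> T" "y' \<in> T" "h' = x' \<oplus> y' \<otimes> b" unfolding B_def by blast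
    have "(x \<oplus> e \<otimes> y) \<otimes> (x' \<oplus> e \<otimes> y') \<in> M"
      using hQ unfolding *(3,6) using prodQ[OF *(1,2,4,5)] by blast
    then have "x \<oplus> e \<otimes> y \<in> M \<or> x' \<oplus> e \<otimes> y' \<in> M"
      using MD(3)[OF TE(7)[OF *(1) TE(6)[OF e(1) *(2)]] TE(7)[OF *(4) TE(6)[OF e(1) *(5)]]] by blast
    then show "h \<in> Q \<or> h' \<in> Q" unfolding *(3,6) mem[OF *(1,2)] mem[OF *(4,5)] .
  qed
qed

text \<open>With \<open>c = b^2 - b\<close> the two conditions of u-closedness become
  \<open>c\<close> in \<open>T\<close> and \<open>c b\<close> in \<open>T\<close>, since
  \<open>c b = b^3 - b^2\<close>.\<close>

lemma anodal_element:
  assumes T: "subring T R" and b: "b \<in> carrier R"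
    and b2: "b [^] (2::nat) \<ominus> b \<in> T" and b3: "b [^] (3::nat) \<ominus> b [^] (2::nat) \<in> T"
  obtains c where "c \<in> T" "b \<otimes> b = c \<oplus> b" "c \<otimes> b \<in> T"
proof
  have e2: "b [^] (2::nat) = b \<otimes> b" using b by (simp add: numeral_2_eq_2)
  have e3: "b [^] (3::nat) = b \<otimes> b \<otimes> b" using b by (simp add: numeral_3_eq_3)
  show "b [^] (2::nat) \<ominus> b \<in> T" by (rule b2)
  show "b \<otimes> b = (b [^] (2::nat) \<ominus> b) \<oplus> b" unfolding e2 using b by algebra
  have "(b [^] (2::nat) \<ominus> b) \<otimes> b = b [^] (3::nat) \<ominus> b [^] (2::nat)"
    unfolding e2 e3 using b by algebra
  then show "(b [^] (2::nat) \<ominus> b) \<otimes> b \<in> T" using b3 by simp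
qed

theorem i_extension_imp_u_closed:
  assumes T: "subring T R" and V: "subring V R" and TV: "T \<subseteq> V"
    and int: "integral_extension R T V" and i: "i_extension R T V"
  shows "u_closed R T V"
  unfolding u_closed_def
proof (intro ballI impI)
  note TE = subringE[OF T]
  interpret T: cring "sub_ring R T" using T by (rule subring_is_cring)
  fix b assume bV: "b \<in> V" and b23: "b [^] (2::nat) \<ominus> b \<in> T" "b [^] (3::nat) \<ominus> b [^] (2::nat) \<in> T"
  have b: "b \<in> carrier R" using bV V by blast
  obtain c where c: "c \<in> T" "b \<otimes> b = c \<oplus> b" "c \<otimes> b \<in> T" using anodal_element[OF T b b23] .
  have cc: "c \<in> carrier R" using c TE(1) by blast
  show "b \<in> T"
  proof (rule ccontr)
    assume nb: "b \<notin> T"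
    \<comment> \<open>The conductor of \<open>T\<close> in \<open>T[b]\<close>, proper because
      \<open>b\<close> is outside \<open>T\<close>. It is also an ideal of \<open>T[b]\<close>: from
      \<open>r b b = r c + r b\<close> below, \<open>r b\<close> is again in
      \<open>I\<close>.\<close>
    define I where "I = {r \<in> T. r \<otimes> b \<in> T}"
    have I: "ideal I (sub_ring R T)"
      unfolding ideal_subring_iff[OF T]
    proof (intro conjI ballI)
      show "I \<subseteq> T" unfolding I_def by blast
      show "\<zero> \<in> I" unfolding I_def using b TE(2) by simp
    next
      fix r s assume "r \<in> I" "s \<in> I"
      moreover from this have "r \<in> carrier R" "s \<in> carrier R" using TE(1) unfolding I_def by auto
      ultimately show "r \<oplus> s \<in> I" unfolding I_def using TE(7) b by (simp add: l_distr)
    next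
      fix t r assume "t \<in> T" "r \<in> I"
      moreover from this have "t \<in> carrier R" "r \<in> carrier R" using TE(1) unfolding I_def by auto
      ultimately show "t \<otimes> r \<in> I" unfolding I_def using TE(6) b by (simp add: m_assoc)
    qed
    have I1: "I \<inter> {\<one>} = {}" unfolding I_def using nb b by simp
    obtain M where M: "primeideal M (sub_ring R T)" "I \<subseteq> M"
    proof (rule T.ex_primeideal_disjoint[of I "{\<one>}"])
      show "ideal I (sub_ring R T)" by (rule I)
    qed (use TE(1,3) I1 in auto)
    note MD = primeideal_subringD[OF T M(1)]
    have IM: "r \<in> M \<and> r \<otimes> b \<in> M" if r: "r \<in> T" "r \<otimes> b \<in> T" for r
    proof -
      have rc: "r \<in> carrier R" using r TE(1) by blast
      have "r \<otimes> b \<otimes> b = r \<otimes> (b \<otimes> b)" using rc b by algebra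
      also have "\<dots> = r \<otimes> c \<oplus> r \<otimes> b" unfolding c(2) using rc cc b by algebra
      finally have "r \<otimes> b \<otimes> b \<in> T" using TE(7)[OF TE(6)[OF r(1) c(1)] r(2)] by simp
      then show ?thesis using r M(2) unfolding I_def by blast
    qed
    have cM: "c \<in> M" using IM[OF c(1,3)] by blast
    define B where "B = {x \<oplus> y \<otimes> b | x y. x \<in> T \<and> y \<in> T}"
    have "b \<otimes> b = c \<oplus> \<one> \<otimes> b" using c(2) b by simp
    note B = subring_adjoin_quadratic[OF T b c(1) TE(3) this, folded B_def]
    \<comment> \<open>Injectivity descends from \<open>V\<close> to \<open>T[b]\<close>, where the
      two primes over \<open>M\<close> are explicit.\<close>
    have iB: "i_extension R T B"
      using i_extension_subextension[OF T B(1) T V subset_refl B(2) B(4)[OF V TV bV] int i] .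
    note Q = primeideal_adjoin_anodal[OF T b c(1,2) M(1) cM IM, folded B_def]
    define Q0 where "Q0 = {x \<oplus> y \<otimes> b | x y. x \<in> T \<and> y \<in> T \<and> x \<oplus> \<zero> \<otimes> y \<in> M}"
    define Q1 where "Q1 = {x \<oplus> y \<otimes> b | x y. x \<in> T \<and> y \<in> T \<and> x \<oplus> \<one> \<otimes> y \<in> M}"
    have Q0: "primeideal Q0 (sub_ring R B)" "Q0 \<inter> T = M" "b \<in> Q0"
      unfolding Q0_def using Q[of \<zero>] TE(2) ideal_subringD(2)[OF T MD(1)] by simp_all
    have Q1: "primeideal Q1 (sub_ring R B)" "Q1 \<inter> T = M" "b \<notin> Q1"
      unfolding Q1_def using Q[of \<one>] TE(3) MD(2) by simp_all
    have "Q0 = Q1"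
      using iB Q0(1,2) Q1(1,2) unfolding i_extension_def Spec_def inj_on_def by blast
    then show False using Q0(3) Q1(3) by blast
  qed
qed

end

subsection \<open>Residue fields\<close>

context domain
begin

lemma fraction_class_eq_iff:
  assumes "a \<in> carrier R" "s \<in> carrier R - {\<zero>}" "b \<in> carrier R" "t \<in> carrier R - {\<zero>}"
  shows "fraction_class R a s = fraction_class R b t \<longleftrightarrow> a \<otimes> t = b \<otimes> s"
proof
  assume "fraction_class R a s = fraction_class R b t"
  moreover have "(b, t) \<in> fraction_class R b t"
    using assms(3,4) unfolding fraction_class_def by simp
  ultimately show "a \<otimes> t = b \<otimes> s" unfolding fraction_class_def by auto
next
  have sub: "fraction_class R a s \<subseteq> fraction_class R b t"
    if "a \<in> carrier R" "s \<in> carrier R - {\<zero>}" "b \<in> carrier R" "t \<in> carrier R - {\<zero>}"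
      "a \<otimes> t = b \<otimes> s" for a s b t
  proof
    fix p assume "p \<in> fraction_class R a s"
    then obtain d u where du: "p = (d, u)" "d \<in> carrier R" "u \<in> carrier R" "u \<noteq> \<zero>" "a \<otimes> u = d \<otimes> s"
      unfolding fraction_class_def by blast
    have "s \<otimes> (b \<otimes> u) = (b \<otimes> s) \<otimes> u" using that(1-4) du(2-4) by (simp add: m_ac)
    also have "\<dots> = (a \<otimes> u) \<otimes> t" unfolding that(5)[symmetric] using that(1-4) du(2-4) by (simp add: m_ac)
    also have "\<dots> = s \<otimes> (d \<otimes> t)" unfolding du(5) using that(1-4) du(2-4) by (simp add: m_ac)
    finally have "b \<otimes> u = d \<otimes> t" using that(1-4) du(2-4) m_lcancel[of s] by simp
    then show "p \<in> fraction_class R b t" using du unfolding fraction_class_def by simp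
  qed
  assume "a \<otimes> t = b \<otimes> s"
  then show "fraction_class R a s = fraction_class R b t" using sub assms by (metis subset_antisym)
qed

text \<open>Operations on fractions are defined as unions over all representatives. Independence of
  the representative turns such a union into a union of equal sets.\<close>

lemma fraction_class_UN:
  assumes "a \<in> carrier R" "s \<in> carrier R - {\<zero>}"
    and "\<And>b t. \<lbrakk>b \<in> carrier R; t \<in> carrier R - {\<zero>}; a \<otimes> t = b \<otimes> s\<rbrakk> \<Longrightarrow> F b t = F a s"
  shows "(\<Union>(b, t)\<in>fraction_class R a s. F b t) = F a s"
proof -
  have "(a, s) \<in> fraction_class R a s" using assms(1,2) unfolding fraction_class_def by simp
  moreover have "F b t = F a s" if "(b, t) \<in> fraction_class R a s" for b t
    using that assms(3)[of b t] unfolding fraction_class_def by blast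
  then have "(\<Union>(b, t)\<in>fraction_class R a s. F b t) = (\<Union>p\<in>fraction_class R a s. F a s)"
    by (intro SUP_cong refl) auto
  ultimately show ?thesis by force
qed

lemma fraction_field_mult:
  assumes "a \<in> carrier R" "s \<in> carrier R - {\<zero>}" "b \<in> carrier R" "t \<in> carrier R - {\<zero>}"
  shows "fraction_class R a s \<otimes>\<^bsub>fraction_field R\<^esub> fraction_class R b t
    = fraction_class R (a \<otimes> b) (s \<otimes> t)"
proof -
  have "(\<Union>(b', t')\<in>fraction_class R b t. fraction_class R (a' \<otimes> b') (s' \<otimes> t'))
      = fraction_class R (a' \<otimes> b) (s' \<otimes> t)"
    if "a' \<in> carrier R" "s' \<in> carrier R - {\<zero>}" for a' s'
  proof (rule fraction_class_UN[OF assms(3,4)])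
    fix b' t' assume *: "b' \<in> carrier R" "t' \<in> carrier R - {\<zero>}" "b \<otimes> t' = b' \<otimes> t"
    have "a' \<otimes> b' \<otimes> (s' \<otimes> t) = (a' \<otimes> s') \<otimes> (b' \<otimes> t)" using *(1,2) that assms by (simp add: m_ac)
    also have "\<dots> = a' \<otimes> b \<otimes> (s' \<otimes> t')" unfolding *(3)[symmetric] using *(1,2) that assms by (simp add: m_ac)
    finally show "fraction_class R (a' \<otimes> b') (s' \<otimes> t') = fraction_class R (a' \<otimes> b) (s' \<otimes> t)"
      using * that assms by (subst fraction_class_eq_iff) (auto simp: integral_iff)
  qed
  then have "fraction_class R a s \<otimes>\<^bsub>fraction_field R\<^esub> fraction_class R b t
      = (\<Union>(a', s')\<in>fraction_class R a s. fraction_class R (a' \<otimes> b) (s' \<otimes> t))"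
    unfolding fraction_field_def
    by (simp, intro SUP_cong refl) (auto simp: fraction_class_def[of R a s])
  also have "\<dots> = fraction_class R (a \<otimes> b) (s \<otimes> t)"
  proof (rule fraction_class_UN[OF assms(1,2)])
    fix a' s' assume *: "a' \<in> carrier R" "s' \<in> carrier R - {\<zero>}" "a \<otimes> s' = a' \<otimes> s"
    have "a' \<otimes> b \<otimes> (s \<otimes> t) = (b \<otimes> t) \<otimes> (a' \<otimes> s)" using *(1,2) assms by (simp add: m_ac)
    also have "\<dots> = a \<otimes> b \<otimes> (s' \<otimes> t)" unfolding *(3)[symmetric] using *(1,2) assms by (simp add: m_ac)
    finally show "fraction_class R (a' \<otimes> b) (s' \<otimes> t) = fraction_class R (a \<otimes> b) (s \<otimes> t)"
      using * assms by (subst fraction_class_eq_iff) (auto simp: integral_iff)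
  qed
  finally show ?thesis .
qed

lemma fraction_field_add:
  assumes "a \<in> carrier R" "s \<in> carrier R - {\<zero>}" "b \<in> carrier R" "t \<in> carrier R - {\<zero>}"
  shows "fraction_class R a s \<oplus>\<^bsub>fraction_field R\<^esub> fraction_class R b t
    = fraction_class R (a \<otimes> t \<oplus> b \<otimes> s) (s \<otimes> t)"
proof -
  have "(\<Union>(b', t')\<in>fraction_class R b t. fraction_class R (a' \<otimes> t' \<oplus> b' \<otimes> s') (s' \<otimes> t'))
      = fraction_class R (a' \<otimes> t \<oplus> b \<otimes> s') (s' \<otimes> t)"
    if "a' \<in> carrier R" "s' \<in> carrier R - {\<zero>}" for a' s'
  proof (rule fraction_class_UN[OF assms(3,4)])
    fix b' t' assume *: "b' \<in> carrier R" "t' \<in> carrier R - {\<zero>}" "b \<otimes> t' = b' \<otimes> t"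
    have c: "b' \<in> carrier R" "t' \<in> carrier R" "a' \<in> carrier R" "s' \<in> carrier R" "b \<in> carrier R" "t \<in> carrier R"
      using * that assms by auto
    have "(a' \<otimes> t' \<oplus> b' \<otimes> s') \<otimes> (s' \<otimes> t) = a' \<otimes> t' \<otimes> s' \<otimes> t \<oplus> s' \<otimes> s' \<otimes> (b' \<otimes> t)"
      using c by algebra
    also have "\<dots> = (a' \<otimes> t \<oplus> b \<otimes> s') \<otimes> (s' \<otimes> t')" unfolding *(3)[symmetric] using c by algebra
    finally show "fraction_class R (a' \<otimes> t' \<oplus> b' \<otimes> s') (s' \<otimes> t')
        = fraction_class R (a' \<otimes> t \<oplus> b \<otimes> s') (s' \<otimes> t)"
      using * that assms by (subst fraction_class_eq_iff) (auto simp: integral_iff)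
  qed
  then have "fraction_class R a s \<oplus>\<^bsub>fraction_field R\<^esub> fraction_class R b t
      = (\<Union>(a', s')\<in>fraction_class R a s. fraction_class R (a' \<otimes> t \<oplus> b \<otimes> s') (s' \<otimes> t))"
    unfolding fraction_field_def
    by (simp, intro SUP_cong refl) (auto simp: fraction_class_def[of R a s])
  also have "\<dots> = fraction_class R (a \<otimes> t \<oplus> b \<otimes> s) (s \<otimes> t)"
  proof (rule fraction_class_UN[OF assms(1,2)])
    fix a' s' assume *: "a' \<in> carrier R" "s' \<in> carrier R - {\<zero>}" "a \<otimes> s' = a' \<otimes> s"
    have c: "a \<in> carrier R" "s \<in> carrier R" "a' \<in> carrier R" "s' \<in> carrier R" "b \<in> carrier R" "t \<in> carrier R"
      using * assms by auto
    have "(a' \<otimes> t \<oplus> b \<otimes> s') \<otimes> (s \<otimes> t) = t \<otimes> t \<otimes> (a' \<otimes> s) \<oplus> b \<otimes> s' \<otimes> s \<otimes> t" using c by algebra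
    also have "\<dots> = (a \<otimes> t \<oplus> b \<otimes> s) \<otimes> (s' \<otimes> t)" unfolding *(3)[symmetric] using c by algebra
    finally show "fraction_class R (a' \<otimes> t \<oplus> b \<otimes> s') (s' \<otimes> t)
        = fraction_class R (a \<otimes> t \<oplus> b \<otimes> s) (s \<otimes> t)"
      using * assms by (subst fraction_class_eq_iff) (auto simp: integral_iff)
  qed
  finally show ?thesis .
qed

end

text \<open>The induced map is always an injective homomorphism, so only surjectivity is at stake.
  It is enough to reach the elements of \<open>E\<close>: if \<open>e = h a / h s\<close> and
  \<open>f = h b / h t\<close> with \<open>f\<close> nonzero, then \<open>e / f\<close> is the image
  of \<open>a t / (s b)\<close>.\<close>

theorem fraction_map_iso_iff:
  fixes D :: "('a, 'b) ring_scheme" (structure) and E :: "('c, 'd) ring_scheme"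
  assumes D: "domain D" and E: "domain E" and h: "h \<in> ring_hom D E" and inj: "inj_on h (carrier D)"
  shows "fraction_map E h \<in> ring_iso (fraction_field D) (fraction_field E) \<longleftrightarrow>
    (\<forall>e\<in>carrier E. \<exists>a\<in>carrier D. \<exists>s\<in>carrier D - {\<zero>}. h s \<otimes>\<^bsub>E\<^esub> e = h a)"
proof -
  interpret D: domain D by (rule D)
  interpret E: domain E by (rule E)
  interpret h: ring_hom_ring D E h
    using h by (simp add: ring_hom_ring_def ring_hom_ring_axioms_def D.ring_axioms E.ring_axioms)
  have h0: "h s \<in> carrier E - {\<zero>\<^bsub>E\<^esub>}" if "s \<in> carrier D - {\<zero>}" for s
  proof -
    have "h s \<noteq> h \<zero>" using that inj D.zero_closed unfolding inj_on_def by blast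
    then show ?thesis using that by simp
  qed
  have carD: "carrier (fraction_field D) = {fraction_class D a s | a s. a \<in> carrier D \<and> s \<in> carrier D - {\<zero>}}"
    and carE: "carrier (fraction_field E) = {fraction_class E a s | a s. a \<in> carrier E \<and> s \<in> carrier E - {\<zero>\<^bsub>E\<^esub>}}"
    unfolding fraction_field_def by simp_all
  have map: "fraction_map E h (fraction_class D a s) = fraction_class E (h a) (h s)"
    if as: "a \<in> carrier D" "s \<in> carrier D - {\<zero>}" for a s
    unfolding fraction_map_def
  proof (rule D.fraction_class_UN[OF as])
    fix b t assume *: "b \<in> carrier D" "t \<in> carrier D - {\<zero>}" "a \<otimes> t = b \<otimes> s"
    have "h b \<otimes>\<^bsub>E\<^esub> h s = h a \<otimes>\<^bsub>E\<^esub> h t" using * as h.hom_mult by (metis DiffD1)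
    then show "fraction_class E (h b) (h t) = fraction_class E (h a) (h s)"
      using E.fraction_class_eq_iff[OF _ h0[OF *(2)] _ h0[OF as(2)]] * as by simp
  qed
  have nz: "s \<otimes> t \<in> carrier D - {\<zero>}" if "s \<in> carrier D - {\<zero>}" "t \<in> carrier D - {\<zero>}" for s t
    using that by (auto simp: D.integral_iff)
  have hom: "fraction_map E h \<in> ring_hom (fraction_field D) (fraction_field E)"
  proof (rule ring_hom_memI)
    fix x assume "x \<in> carrier (fraction_field D)"
    then obtain a s where as: "a \<in> carrier D" "s \<in> carrier D - {\<zero>}" "x = fraction_class D a s"
      unfolding carD by blast
    then show "fraction_map E h x \<in> carrier (fraction_field E)"
      unfolding carE using map[OF as(1,2)] h0[OF as(2)] h.hom_closed by blast
  next
    fix x y assume "x \<in> carrier (fraction_field D)" "y \<in> carrier (fraction_field D)"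
    then obtain a s b t where as: "a \<in> carrier D" "s \<in> carrier D - {\<zero>}" "x = fraction_class D a s"
      and bt: "b \<in> carrier D" "t \<in> carrier D - {\<zero>}" "y = fraction_class D b t"
      unfolding carD by blast
    have c: "s \<in> carrier D" "t \<in> carrier D" using as bt by auto
    show "fraction_map E h (x \<otimes>\<^bsub>fraction_field D\<^esub> y)
        = fraction_map E h x \<otimes>\<^bsub>fraction_field E\<^esub> fraction_map E h y"
      unfolding as(3) bt(3) D.fraction_field_mult[OF as(1,2) bt(1,2)] map[OF as(1,2)] map[OF bt(1,2)]
      using E.fraction_field_mult[OF _ h0[OF as(2)] _ h0[OF bt(2)]] map[OF _ nz[OF as(2) bt(2)]]
        as(1) bt(1) c by simp
    show "fraction_map E h (x \<oplus>\<^bsub>fraction_field D\<^esub> y)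
        = fraction_map E h x \<oplus>\<^bsub>fraction_field E\<^esub> fraction_map E h y"
      unfolding as(3) bt(3) D.fraction_field_add[OF as(1,2) bt(1,2)] map[OF as(1,2)] map[OF bt(1,2)]
      using E.fraction_field_add[OF _ h0[OF as(2)] _ h0[OF bt(2)]] map[OF _ nz[OF as(2) bt(2)]]
        as(1) bt(1) c by simp
  next
    show "fraction_map E h \<one>\<^bsub>fraction_field D\<^esub> = \<one>\<^bsub>fraction_field E\<^esub>"
      using map[of \<one> \<one>] unfolding fraction_field_def by simp
  qed
  have inj': "inj_on (fraction_map E h) (carrier (fraction_field D))"
  proof (rule inj_onI)
    fix x y assume "x \<in> carrier (fraction_field D)" "y \<in> carrier (fraction_field D)"
      and eq: "fraction_map E h x = fraction_map E h y"
    then obtain a s b t where as: "a \<in> carrier D" "s \<in> carrier D - {\<zero>}" "x = fraction_class D a s"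
      and bt: "b \<in> carrier D" "t \<in> carrier D - {\<zero>}" "y = fraction_class D b t"
      unfolding carD by blast
    have c: "s \<in> carrier D" "t \<in> carrier D" using as bt by auto
    have "h a \<otimes>\<^bsub>E\<^esub> h t = h b \<otimes>\<^bsub>E\<^esub> h s"
      using eq E.fraction_class_eq_iff[OF _ h0[OF as(2)] _ h0[OF bt(2)]] as(1) bt(1)
      unfolding as(3) bt(3) map[OF as(1,2)] map[OF bt(1,2)] by simp
    then have "h (a \<otimes> t) = h (b \<otimes> s)" using as(1) bt(1) c by simp
    then have "a \<otimes> t = b \<otimes> s" using inj as(1) bt(1) c unfolding inj_on_def by simp
    then show "x = y"
      unfolding as(3) bt(3) using D.fraction_class_eq_iff[OF as(1,2) bt(1,2)] by simp
  qed
  have "fraction_map E h \<in> ring_iso (fraction_field D) (fraction_field E) \<longleftrightarrow>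
      carrier (fraction_field E) \<subseteq> fraction_map E h ` carrier (fraction_field D)"
    using hom inj' ring_hom_closed[OF hom] unfolding ring_iso_def bij_betw_def by blast
  also have "\<dots> \<longleftrightarrow> (\<forall>e\<in>carrier E. \<exists>a\<in>carrier D. \<exists>s\<in>carrier D - {\<zero>}. h s \<otimes>\<^bsub>E\<^esub> e = h a)"
  proof (intro iffI ballI)
    fix e assume sub: "carrier (fraction_field E) \<subseteq> fraction_map E h ` carrier (fraction_field D)"
      and e: "e \<in> carrier E"
    have one: "\<one>\<^bsub>E\<^esub> \<in> carrier E - {\<zero>\<^bsub>E\<^esub>}" by simp
    have "fraction_class E e \<one>\<^bsub>E\<^esub> \<in> carrier (fraction_field E)" unfolding carE using e one by blast
    then obtain a s where as: "a \<in> carrier D" "s \<in> carrier D - {\<zero>}"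
      "fraction_class E e \<one>\<^bsub>E\<^esub> = fraction_map E h (fraction_class D a s)"
      using sub unfolding carD by blast
    have "e \<otimes>\<^bsub>E\<^esub> h s = h a \<otimes>\<^bsub>E\<^esub> \<one>\<^bsub>E\<^esub>"
      using as(3) E.fraction_class_eq_iff[OF e one _ h0[OF as(2)]] as(1)
      unfolding map[OF as(1,2)] by simp
    then have "h s \<otimes>\<^bsub>E\<^esub> e = h a" using as(1,2) e E.m_comm by simp
    then show "\<exists>a\<in>carrier D. \<exists>s\<in>carrier D - {\<zero>}. h s \<otimes>\<^bsub>E\<^esub> e = h a" using as by blast
  next
    assume R: "\<forall>e\<in>carrier E. \<exists>a\<in>carrier D. \<exists>s\<in>carrier D - {\<zero>}. h s \<otimes>\<^bsub>E\<^esub> e = h a"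
    show "carrier (fraction_field E) \<subseteq> fraction_map E h ` carrier (fraction_field D)"
    proof
      fix x assume "x \<in> carrier (fraction_field E)"
      then obtain e f where ef: "e \<in> carrier E" "f \<in> carrier E - {\<zero>\<^bsub>E\<^esub>}" "x = fraction_class E e f"
        unfolding carE by blast
      obtain a s where as: "a \<in> carrier D" "s \<in> carrier D - {\<zero>}" "h s \<otimes>\<^bsub>E\<^esub> e = h a"
        using R ef(1) by blast
      obtain b t where bt: "b \<in> carrier D" "t \<in> carrier D - {\<zero>}" "h t \<otimes>\<^bsub>E\<^esub> f = h b"
        using R ef(2) by blast
      have "b \<noteq> \<zero>"
      proof
        assume "b = \<zero>"
        then have "h t \<otimes>\<^bsub>E\<^esub> f = \<zero>\<^bsub>E\<^esub>" using bt(3) by simp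
        then show False using h0[OF bt(2)] ef(2) by (auto simp: E.integral_iff)
      qed
      then have b0: "b \<in> carrier D - {\<zero>}" using bt(1) by simp
      have c: "s \<in> carrier D" "t \<in> carrier D" "f \<in> carrier E" using as bt ef by auto
      have "h (a \<otimes> t) \<otimes>\<^bsub>E\<^esub> f = h a \<otimes>\<^bsub>E\<^esub> (h t \<otimes>\<^bsub>E\<^esub> f)" using as(1) c by (simp add: E.m_assoc)
      also have "\<dots> = (h s \<otimes>\<^bsub>E\<^esub> e) \<otimes>\<^bsub>E\<^esub> h b" unfolding as(3) bt(3) ..
      also have "\<dots> = e \<otimes>\<^bsub>E\<^esub> h (s \<otimes> b)" using ef(1) c bt(1) by (simp add: E.m_ac)
      finally have "x = fraction_class E (h (a \<otimes> t)) (h (s \<otimes> b))"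
        unfolding ef(3) using E.fraction_class_eq_iff[OF ef(1,2) _ h0[OF nz[OF as(2) b0]]] as(1) c by simp
      also have "\<dots> = fraction_map E h (fraction_class D (a \<otimes> t) (s \<otimes> b))"
        using map[OF _ nz[OF as(2) b0]] as(1) c by simp
      finally show "x \<in> fraction_map E h ` carrier (fraction_field D)"
        unfolding carD using nz[OF as(2) b0] D.m_closed[OF as(1) c(2)] by blast
    qed
  qed
  finally show ?thesis .
qed

context cring
begin

section \<open>Quotients of subrings and the canonical maps between them\<close>

lemma a_r_coset_subring: "a_r_coset (sub_ring R U) Q u = Q +> u"
  unfolding a_r_coset_def r_coset_def by simp

lemma subring_Quot_carrier:
  "carrier (sub_ring R U Quot Q) = (\<lambda>u. Q +> u) ` U"
  unfolding FactRing_def A_RCOSETS_def' a_r_coset_subring by auto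

lemma subring_Quot_coset_eq_iff:
  assumes "subring U R" "ideal Q (sub_ring R U)" "u \<in> U" "v \<in> U"
  shows "Q +> u = Q +> v \<longleftrightarrow> u \<ominus> v \<in> Q"
proof -
  interpret U: cring "sub_ring R U" using assms(1) by (rule subring_is_cring)
  have "u \<ominus>\<^bsub>sub_ring R U\<^esub> v = u \<ominus> v"
    using subring_a_inv[OF assms(1,4)] by (simp add: a_minus_def)
  then show ?thesis
    using U.quotient_eq_iff_same_a_r_cos[OF assms(2), of u v] assms(3,4)
    by (simp add: a_r_coset_subring)
qed

lemma subring_Quot_zero: "\<zero>\<^bsub>sub_ring R U Quot Q\<^esub> = Q"
  unfolding FactRing_def by simp

lemma subring_Quot_coset_eq_zero_iff:
  assumes "subring U R" "ideal Q (sub_ring R U)" "u \<in> U"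
  shows "Q +> u = Q \<longleftrightarrow> u \<in> Q"
proof -
  have c: "Q \<subseteq> carrier R" "u \<in> carrier R"
    using ideal_subringD(1)[OF assms(1,2)] subringE(1)[OF assms(1)] assms(3) by blast+
  have "Q +> \<zero> = Q" using c(1) unfolding a_r_coset_def r_coset_def by (auto simp: subset_iff)
  moreover have "u \<ominus> \<zero> = u" using c(2) by algebra
  ultimately show ?thesis
    using subring_Quot_coset_eq_iff[OF assms subringE(2)[OF assms(1)]] by simp
qed

lemma subring_Quot_ops:
  assumes "subring U R" "ideal Q (sub_ring R U)" "u \<in> U" "v \<in> U"
  shows "(Q +> u) \<otimes>\<^bsub>sub_ring R U Quot Q\<^esub> (Q +> v) = Q +> (u \<otimes> v)"
    "(Q +> u) \<oplus>\<^bsub>sub_ring R U Quot Q\<^esub> (Q +> v) = Q +> (u \<oplus> v)"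
    "\<one>\<^bsub>sub_ring R U Quot Q\<^esub> = Q +> \<one>"
proof -
  have h: "(\<lambda>u. Q +> u) \<in> ring_hom (sub_ring R U) (sub_ring R U Quot Q)"
    using ideal.rcos_ring_hom[OF assms(2)] unfolding a_r_coset_subring .
  show "(Q +> u) \<otimes>\<^bsub>sub_ring R U Quot Q\<^esub> (Q +> v) = Q +> (u \<otimes> v)"
    using ring_hom_mult[OF h, of u v] assms by simp
  show "(Q +> u) \<oplus>\<^bsub>sub_ring R U Quot Q\<^esub> (Q +> v) = Q +> (u \<oplus> v)"
    using ring_hom_add[OF h, of u v] assms by simp
  show "\<one>\<^bsub>sub_ring R U Quot Q\<^esub> = Q +> \<one>"
    using ring_hom_one[OF h] by simp
qed

lemma quot_map_coset:
  assumes T: "subring T R" and U: "subring U R" and TU: "T \<subseteq> U" and Q: "ideal Q (sub_ring R U)"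
    and P: "ideal P (sub_ring R T)" "P \<subseteq> Q" and t: "t \<in> T"
  shows "quot_map R Q (P +> t) = Q +> t"
proof -
  note QI = ideal_subringD[OF U Q]
  have c: "Q \<subseteq> carrier R" "t \<in> carrier R"
    using QI(1) subringE(1)[OF U] t TU by blast+
  have "q \<oplus> (p \<oplus> t) \<in> Q +> t" if "q \<in> Q" "p \<in> P" for q p
  proof -
    have "q \<oplus> (p \<oplus> t) = (q \<oplus> p) \<oplus> t" using that c P(2) by (auto simp: a_assoc subset_iff)
    moreover have "q \<oplus> p \<in> Q" using that P(2) QI(3) by blast
    ultimately show ?thesis unfolding a_r_coset_def r_coset_def by auto
  qed
  moreover have "q \<oplus> t \<in> Q <+>\<^bsub>R\<^esub> (P +> t)" if "q \<in> Q" for q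
  proof -
    have "q \<oplus> t = q \<oplus> (\<zero> \<oplus> t)" using c by simp
    moreover have "\<zero> \<oplus> t \<in> P +> t"
      using ideal_subringD(2)[OF T P(1)] unfolding a_r_coset_def r_coset_def by auto
    ultimately show ?thesis using that unfolding set_add_def' by blast
  qed
  ultimately show ?thesis
    unfolding quot_map_def set_add_def' a_r_coset_def r_coset_def by auto
qed

lemma quot_map_ring_hom:
  assumes T: "subring T R" and U: "subring U R" and TU: "T \<subseteq> U" and Q: "ideal Q (sub_ring R U)"
    and P: "ideal P (sub_ring R T)" "P = Q \<inter> T"
  shows "quot_map R Q \<in> ring_hom (sub_ring R T Quot P) (sub_ring R U Quot Q)"
    and "inj_on (quot_map R Q) (carrier (sub_ring R T Quot P))"
proof -
  have PQ: "P \<subseteq> Q" using P(2) by blast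
  note q = quot_map_coset[OF T U TU Q P(1) PQ]
  note oT = subring_Quot_ops[OF T P(1)]
  note oU = subring_Quot_ops[OF U Q]
  note TE = subringE[OF T]
  show "quot_map R Q \<in> ring_hom (sub_ring R T Quot P) (sub_ring R U Quot Q)"
  proof (rule ring_hom_memI)
    fix x y assume xy: "x \<in> carrier (sub_ring R T Quot P)" "y \<in> carrier (sub_ring R T Quot P)"
    then obtain a b where ab: "a \<in> T" "b \<in> T" "x = P +> a" "y = P +> b"
      unfolding subring_Quot_carrier by blast
    have abU: "a \<in> U" "b \<in> U" using ab TU by auto
    show "quot_map R Q (x \<otimes>\<^bsub>sub_ring R T Quot P\<^esub> y) = quot_map R Q x \<otimes>\<^bsub>sub_ring R U Quot Q\<^esub> quot_map R Q y"
      unfolding ab(3,4) oT(1)[OF ab(1,2)] q[OF ab(1)] q[OF ab(2)] oU(1)[OF abU] q[OF TE(6)[OF ab(1,2)]] ..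
    show "quot_map R Q (x \<oplus>\<^bsub>sub_ring R T Quot P\<^esub> y) = quot_map R Q x \<oplus>\<^bsub>sub_ring R U Quot Q\<^esub> quot_map R Q y"
      unfolding ab(3,4) oT(2)[OF ab(1,2)] q[OF ab(1)] q[OF ab(2)] oU(2)[OF abU] q[OF TE(7)[OF ab(1,2)]] ..
  next
    fix x assume "x \<in> carrier (sub_ring R T Quot P)"
    then show "quot_map R Q x \<in> carrier (sub_ring R U Quot Q)"
      using q TU unfolding subring_Quot_carrier by auto
  next
    show "quot_map R Q \<one>\<^bsub>sub_ring R T Quot P\<^esub> = \<one>\<^bsub>sub_ring R U Quot Q\<^esub>"
      unfolding oT(3)[OF TE(3,3)] oU(3)[OF subringE(3,3)[OF U]] using q[OF TE(3)] .
  qed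
  show "inj_on (quot_map R Q) (carrier (sub_ring R T Quot P))"
  proof (rule inj_onI)
    fix x y assume "x \<in> carrier (sub_ring R T Quot P)" "y \<in> carrier (sub_ring R T Quot P)"
      and eq: "quot_map R Q x = quot_map R Q y"
    then obtain a b where ab: "a \<in> T" "b \<in> T" "x = P +> a" "y = P +> b"
      unfolding subring_Quot_carrier by blast
    have abU: "a \<in> U" "b \<in> U" using ab TU by auto
    have "a \<ominus> b \<in> Q"
      using eq unfolding ab(3,4) q[OF ab(1)] q[OF ab(2)] subring_Quot_coset_eq_iff[OF U Q abU] .
    then have "a \<ominus> b \<in> P" unfolding P(2) using subring_minus_closed[OF T ab(1,2)] by blast
    then show "x = y" unfolding ab(3,4) subring_Quot_coset_eq_iff[OF T P(1) ab(1,2)] .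
  qed
qed

text \<open>A criterion free of fractions and cosets: modulo \<open>Q\<close>, every element of
  \<open>U\<close> is a quotient \<open>t / s\<close> of elements of \<open>T\<close> with
  denominator outside \<open>Q\<close>.\<close>

lemma residue_map_iso_iff:
  assumes T: "subring T R" and U: "subring U R" and TU: "T \<subseteq> U" and Q: "primeideal Q (sub_ring R U)"
  shows "residue_map R U Q \<in> ring_iso (residue_field (sub_ring R T) (Q \<inter> T)) (residue_field (sub_ring R U) Q)
    \<longleftrightarrow> (\<forall>b\<in>U. \<exists>s\<in>T - Q. \<exists>t\<in>T. s \<otimes> b \<ominus> t \<in> Q)"
proof -
  note P = primeideal_inter_subring[OF T U TU Q]
  note QI = primeideal_subringD(1)[OF U Q]
  note PI = primeideal_subringD(1)[OF T P]
  note h = quot_map_ring_hom[OF T U TU QI PI refl]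
  have PQ: "Q \<inter> T \<subseteq> Q" by blast
  note q = quot_map_coset[OF T U TU QI PI PQ]
  have *: "(\<exists>a\<in>carrier (sub_ring R T Quot (Q \<inter> T)).
        \<exists>s\<in>carrier (sub_ring R T Quot (Q \<inter> T)) - {\<zero>\<^bsub>sub_ring R T Quot (Q \<inter> T)\<^esub>}.
          quot_map R Q s \<otimes>\<^bsub>sub_ring R U Quot Q\<^esub> (Q +> b) = quot_map R Q a)
      \<longleftrightarrow> (\<exists>s\<in>T - Q. \<exists>t\<in>T. s \<otimes> b \<ominus> t \<in> Q)" (is "?L \<longleftrightarrow> ?R") if b: "b \<in> U" for b
  proof -
    have prod: "quot_map R Q ((Q \<inter> T) +> s) \<otimes>\<^bsub>sub_ring R U Quot Q\<^esub> (Q +> b) = quot_map R Q ((Q \<inter> T) +> t)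
        \<longleftrightarrow> s \<otimes> b \<ominus> t \<in> Q" if st: "s \<in> T" "t \<in> T" for s t
    proof -
      have stU: "s \<in> U" "t \<in> U" using st TU by auto
      show ?thesis
        unfolding q[OF st(1)] q[OF st(2)] subring_Quot_ops(1)[OF U QI stU(1) b]
        using subring_Quot_coset_eq_iff[OF U QI subringE(6)[OF U stU(1) b] stU(2)] .
    qed
    have car: "carrier (sub_ring R T Quot (Q \<inter> T)) - {\<zero>\<^bsub>sub_ring R T Quot (Q \<inter> T)\<^esub>} = (\<lambda>s. (Q \<inter> T) +> s) ` (T - Q)"
      unfolding subring_Quot_carrier subring_Quot_zero
      using subring_Quot_coset_eq_zero_iff[OF T PI] by auto
    have "?L \<longleftrightarrow> (\<exists>t\<in>T. \<exists>s\<in>T - Q.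
        quot_map R Q ((Q \<inter> T) +> s) \<otimes>\<^bsub>sub_ring R U Quot Q\<^esub> (Q +> b) = quot_map R Q ((Q \<inter> T) +> t))"
      unfolding car unfolding subring_Quot_carrier by simp
    also have "\<dots> \<longleftrightarrow> ?R" using prod by auto
    finally show ?thesis .
  qed
  show ?thesis
    unfolding residue_map_def residue_field_def
      fraction_map_iso_iff[OF primeideal.quotient_is_domain[OF P] primeideal.quotient_is_domain[OF Q] h]
    unfolding subring_Quot_carrier[of U] ball_simps using * by simp
qed

lemma infra_integral_iff:
  assumes "subring T R" "subring U R" "T \<subseteq> U"
  shows "infra_integral R T U \<longleftrightarrow> integral_extension R T U \<and>
    (\<forall>Q. primeideal Q (sub_ring R U) \<longrightarrow> (\<forall>b\<in>U. \<exists>s\<in>T - Q. \<exists>t\<in>T. s \<otimes> b \<ominus> t \<in> Q))"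
  unfolding infra_integral_def Spec_def using residue_map_iso_iff[OF assms] by auto

end

subsection \<open>Seminormalization and t-closure\<close>

context cring
begin

text \<open>The set is the preimage of the image of \<open>T\<close> localized at
  \<open>T - Q\<close> inside the same localization of \<open>G/K\<close>. The ideal
  \<open>K\<close> is kept separate from \<open>Q\<close>: infra-integrality uses
  \<open>K = Q\<close>, injectivity on spectra uses the intersection of two primes.\<close>

lemma subring_fraction_mod_ideal:
  assumes T: "subring T R" and G: "subring G R" and TG: "T \<subseteq> G"
    and Q: "primeideal Q (sub_ring R G)" and K: "ideal K (sub_ring R G)"
  shows "subring {x \<in> G. \<exists>s\<in>T - Q. \<exists>t\<in>T. s \<otimes> x \<ominus> t \<in> K} R" (is "subring ?W R")
proof -
  note TE = subringE[OF T]
  note GE = subringE[OF G]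
  note QD = primeideal_subringD[OF G Q]
  note KI = ideal_subringD[OF G K]
  have QT: "s \<otimes> s' \<in> T - Q" if "s \<in> T - Q" "s' \<in> T - Q" for s s'
    using that TE(6) QD(3)[of s s'] TG by blast
  show ?thesis
  proof (rule subringI)
    show "?W \<subseteq> carrier R" using GE(1) by blast
    have "\<one> \<otimes> \<one> \<ominus> \<one> = \<zero>" by algebra
    then have "\<one> \<otimes> \<one> \<ominus> \<one> \<in> K" using KI(2) by (simp only:)
    then show "\<one> \<in> ?W" using TE(3) GE(3) QD(2) by blast
  next
    fix x assume "x \<in> ?W"
    then obtain s t where st: "x \<in> G" "s \<in> T - Q" "t \<in> T" "s \<otimes> x \<ominus> t \<in> K" by blast
    have "x \<in> carrier R" "s \<in> carrier R" "t \<in> carrier R" using st GE(1) TE(1) by auto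
    then have "s \<otimes> (\<ominus> x) \<ominus> (\<ominus> t) = \<ominus> (s \<otimes> x \<ominus> t)" by algebra
    then have "s \<otimes> (\<ominus> x) \<ominus> (\<ominus> t) \<in> K" using KI(6)[OF st(4)] by simp
    then show "\<ominus> x \<in> ?W" using st(2) GE(5)[OF st(1)] TE(5)[OF st(3)] by blast
  next
    fix x x' assume "x \<in> ?W" "x' \<in> ?W"
    then obtain s t s' t' where st: "x \<in> G" "s \<in> T - Q" "t \<in> T" "s \<otimes> x \<ominus> t \<in> K"
      and st': "x' \<in> G" "s' \<in> T - Q" "t' \<in> T" "s' \<otimes> x' \<ominus> t' \<in> K" by blast
    have c: "x \<in> carrier R" "s \<in> carrier R" "t \<in> carrier R" "x' \<in> carrier R" "s' \<in> carrier R"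
      "t' \<in> carrier R" using st st' GE(1) TE(1) by auto
    have g: "s \<in> G" "s' \<in> G" "t \<in> G" "s \<in> T" "s' \<in> T" using st st' TG by auto
    have "(s \<otimes> s') \<otimes> (x \<otimes> x') \<ominus> t \<otimes> t' = (s' \<otimes> x') \<otimes> (s \<otimes> x \<ominus> t) \<oplus> t \<otimes> (s' \<otimes> x' \<ominus> t')"
      using c by algebra
    also have "\<dots> \<in> K" using KI(3)[OF KI(4)[OF GE(6)[OF g(2) st'(1)] st(4)] KI(4)[OF g(3) st'(4)]] .
    finally show "x \<otimes> x' \<in> ?W"
      using GE(6)[OF st(1) st'(1)] QT[OF st(2) st'(2)] TE(6)[OF st(3) st'(3)] by blast
    have "(s \<otimes> s') \<otimes> (x \<oplus> x') \<ominus> (s' \<otimes> t \<oplus> s \<otimes> t') = s' \<otimes> (s \<otimes> x \<ominus> t) \<oplus> s \<otimes> (s' \<otimes> x' \<ominus> t')"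
      using c by algebra
    also have "\<dots> \<in> K" using KI(3)[OF KI(4)[OF g(2) st(4)] KI(4)[OF g(1) st'(4)]] .
    finally show "x \<oplus> x' \<in> ?W"
      using GE(7)[OF st(1) st'(1)] QT[OF st(2) st'(2)]
        TE(7)[OF TE(6)[OF g(5) st(3)] TE(6)[OF g(4) st'(3)]] by blast
  qed
qed

lemma infra_integral_refl:
  assumes "subring T R" "integral_extension R T V" "T \<subseteq> V"
  shows "infra_integral R T T"
  unfolding infra_integral_iff[OF assms(1,1) subset_refl]
proof (intro conjI allI impI ballI)
  show "integral_extension R T T" using integral_extension_mono[OF assms(2)] assms(3) by blast
  fix Q b assume Q: "primeideal Q (sub_ring R T)" and b: "b \<in> T"
  note QD = primeideal_subringD[OF assms(1) Q]
  have "b \<in> carrier R" using b assms(1) by blast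
  then have "\<one> \<otimes> b \<ominus> b = \<zero>" by algebra
  then have "\<one> \<otimes> b \<ominus> b \<in> Q" using ideal_subringD(2)[OF assms(1) QD(1)] by (simp only:)
  then show "\<exists>s\<in>T - Q. \<exists>t\<in>T. s \<otimes> b \<ominus> t \<in> Q" using b QD(2) subringE(3)[OF assms(1)] by blast
qed

lemma subintegral_refl:
  assumes "subring T R" "integral_extension R T V" "T \<subseteq> V"
  shows "subintegral R T T"
proof -
  have "Q \<inter> T = Q" if "Q \<in> Spec (sub_ring R T)" for Q
    using that primeideal_subringD(1)[OF assms(1)] ideal_subringD(1)[OF assms(1)]
    unfolding Spec_def by blast
  then have "i_extension R T T" unfolding i_extension_def inj_on_def by simp
  then show ?thesis unfolding subintegral_def using infra_integral_refl[OF assms] by blast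
qed

text \<open>Applied to the union of a family of intermediate rings, this is their
  compositum.\<close>

definition subring_closure :: "'a set \<Rightarrow> 'a set" where
  "subring_closure H = \<Inter>{B. subring B R \<and> H \<subseteq> B}"

lemma subring_closure:
  assumes "H \<subseteq> carrier R"
  shows "subring (subring_closure H) R" "H \<subseteq> subring_closure H"
    "\<And>B. \<lbrakk>subring B R; H \<subseteq> B\<rbrakk> \<Longrightarrow> subring_closure H \<subseteq> B"
proof -
  show "subring (subring_closure H) R"
    unfolding subring_closure_def using carrier_is_subring assms by (intro subring_Inter) auto
qed (auto simp: subring_closure_def)

text \<open>For a prime \<open>Q\<close> of the compositum, the elements that are fractions from
  \<open>T\<close> modulo \<open>Q\<close> form a subring containing every member of
  \<open>F\<close>, hence the compositum.\<close>

lemma infra_integral_subring_closure: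
  assumes T: "subring T R" and V: "subring V R" and int: "integral_extension R T V"
    and F: "F \<subseteq> intermediate_rings R T V" "F \<noteq> {}" "\<And>B. B \<in> F \<Longrightarrow> infra_integral R T B"
  shows "subring_closure (\<Union>F) \<in> intermediate_rings R T V" "infra_integral R T (subring_closure (\<Union>F))"
proof -
  define G where "G = subring_closure (\<Union>F)"
  have FB: "subring B R" "T \<subseteq> B" "B \<subseteq> V" if "B \<in> F" for B
    using that F(1) unfolding intermediate_rings_def by auto
  have FV: "\<Union>F \<subseteq> V" using FB(3) by blast
  then have "\<Union>F \<subseteq> carrier R" using subringE(1)[OF V] by blast
  note G = subring_closure[OF this, folded G_def]
  have TG: "T \<subseteq> G" using G(2) F(2) FB(2) by blast
  have GV: "G \<subseteq> V" using G(3)[OF V FV] .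
  show "subring_closure (\<Union>F) \<in> intermediate_rings R T V"
    unfolding G_def[symmetric] intermediate_rings_def using G(1) TG GV by blast
  show "infra_integral R T (subring_closure (\<Union>F))"
    unfolding G_def[symmetric] infra_integral_iff[OF T G(1) TG]
  proof (intro conjI allI impI)
    show "integral_extension R T G" using integral_extension_mono[OF int] GV by blast
    fix Q assume Q: "primeideal Q (sub_ring R G)"
    let ?W = "{x \<in> G. \<exists>s\<in>T - Q. \<exists>t\<in>T. s \<otimes> x \<ominus> t \<in> Q}"
    have "B \<subseteq> ?W" if B: "B \<in> F" for B
    proof
      fix b assume b: "b \<in> B"
      have BG: "B \<subseteq> G" using G(2) B by blast
      have QB: "primeideal (Q \<inter> B) (sub_ring R B)"
        using primeideal_inter_subring[OF FB(1)[OF B] G(1) BG Q] .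
      then obtain s t where "s \<in> T - Q \<inter> B" "t \<in> T" "s \<otimes> b \<ominus> t \<in> Q \<inter> B"
        using F(3)[OF B, unfolded infra_integral_iff[OF T FB(1,2)[OF B]]] b by blast
      then show "b \<in> ?W" using FB(2)[OF B] b BG by blast
    qed
    then have "G \<subseteq> ?W"
      using G(3)[OF subring_fraction_mod_ideal[OF T G(1) TG Q primeideal_subringD(1)[OF G(1) Q]]] by blast
    then show "\<forall>b\<in>G. \<exists>s\<in>T - Q. \<exists>t\<in>T. s \<otimes> b \<ominus> t \<in> Q" by blast
  qed
qed

text \<open>Primes \<open>P\<close> and \<open>Q\<close> with the same trace on \<open>T\<close>
  agree on every member of \<open>F\<close>, so members consist of fractions from \<open>T\<close>
  modulo \<open>P \<inter> Q\<close>, and so does the compositum. If \<open>x\<close> in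
  \<open>P\<close> is \<open>t / s\<close> in this sense, then \<open>t\<close> is in
  \<open>P \<inter> T = Q \<inter> T\<close>, so \<open>s x\<close> and finally \<open>x\<close> are
  in \<open>Q\<close>.\<close>

lemma subintegral_subring_closure:
  assumes T: "subring T R" and V: "subring V R" and int: "integral_extension R T V"
    and F: "F \<subseteq> intermediate_rings R T V" "F \<noteq> {}" "\<And>B. B \<in> F \<Longrightarrow> subintegral R T B"
  shows "subintegral R T (subring_closure (\<Union>F))"
proof -
  define G where "G = subring_closure (\<Union>F)"
  have FB: "subring B R" "T \<subseteq> B" "B \<subseteq> V" if "B \<in> F" for B
    using that F(1) unfolding intermediate_rings_def by auto
  have FV: "\<Union>F \<subseteq> V" using FB(3) by blast
  then have "\<Union>F \<subseteq> carrier R" using subringE(1)[OF V] by blast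
  note G = subring_closure[OF this, folded G_def]
  have TG: "T \<subseteq> G" using G(2) F(2) FB(2) by blast
  have infra: "infra_integral R T B" and i: "i_extension R T B" if "B \<in> F" for B
    using F(3)[OF that] unfolding subintegral_def by auto
  have incl: "P \<subseteq> Q" if P: "primeideal P (sub_ring R G)" and Q: "primeideal Q (sub_ring R G)"
    and PQ: "P \<inter> T = Q \<inter> T" for P Q
  proof
    note PD = primeideal_subringD[OF G(1) P]
    note QD = primeideal_subringD[OF G(1) Q]
    note PI = ideal_subringD[OF G(1) PD(1)]
    note QI = ideal_subringD[OF G(1) QD(1)]
    have K: "ideal (P \<inter> Q) (sub_ring R G)"
      unfolding ideal_subring_iff[OF G(1)] using PI QI by auto
    let ?W = "{x \<in> G. \<exists>s\<in>T - Q. \<exists>t\<in>T. s \<otimes> x \<ominus> t \<in> P \<inter> Q}"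
    have "B \<subseteq> ?W" if B: "B \<in> F" for B
    proof
      fix b assume b: "b \<in> B"
      have BG: "B \<subseteq> G" using G(2) B by blast
      have QB: "primeideal (Q \<inter> B) (sub_ring R B)" "primeideal (P \<inter> B) (sub_ring R B)"
        using primeideal_inter_subring[OF FB(1)[OF B] G(1) BG] P Q by auto
      moreover have "(P \<inter> B) \<inter> T = (Q \<inter> B) \<inter> T" using PQ by blast
      ultimately have PQB: "P \<inter> B = Q \<inter> B"
        using i[OF B] unfolding i_extension_def Spec_def inj_on_def by blast
      obtain s t where "s \<in> T - Q \<inter> B" "t \<in> T" "s \<otimes> b \<ominus> t \<in> Q \<inter> B"
        using infra[OF B, unfolded infra_integral_iff[OF T FB(1,2)[OF B]]] b QB(1) by blast
      then show "b \<in> ?W" using FB(2)[OF B] b BG PQB by blast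
    qed
    then have GW: "G \<subseteq> ?W"
      using G(3)[OF subring_fraction_mod_ideal[OF T G(1) TG Q K]] by blast
    fix x assume x: "x \<in> P"
    then have xG: "x \<in> G" using PI(1) by blast
    then obtain s t where st: "s \<in> T" "s \<notin> Q" "t \<in> T" "s \<otimes> x \<ominus> t \<in> P \<inter> Q" using GW by blast
    have g: "s \<in> G" "t \<in> G" using st TG by auto
    have c: "x \<in> carrier R" "s \<in> carrier R" "t \<in> carrier R" using xG g subringE(1)[OF G(1)] by auto
    have "s \<otimes> x \<ominus> (s \<otimes> x \<ominus> t) \<in> P" using PI(7)[OF PI(4)[OF g(1) x]] st(4) by blast
    moreover have "s \<otimes> x \<ominus> (s \<otimes> x \<ominus> t) = t" using c by algebra
    ultimately have "t \<in> Q" using st(3) PQ by auto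
    then have "(s \<otimes> x \<ominus> t) \<oplus> t \<in> Q" using QI(3) st(4) by blast
    moreover have "(s \<otimes> x \<ominus> t) \<oplus> t = s \<otimes> x" using c by algebra
    ultimately show "x \<in> Q" using QD(3)[OF g(1) xG] st(2) by simp
  qed
  then have "i_extension R T G"
    unfolding i_extension_def Spec_def inj_on_def by blast
  moreover have "infra_integral R T G"
    unfolding G_def using infra_integral_subring_closure(2)[OF T V int F(1,2) infra] .
  ultimately show ?thesis unfolding subintegral_def G_def by blast
qed

text \<open>\<open>GREATEST\<close> is meaningful once a greatest element is exhibited: the
  compositum of all infra-integral subextensions, a family that contains at least
  \<open>T\<close>.\<close>

lemma t_closure_greatest:
  assumes T: "subring T R" and V: "subring V R" and TV: "T \<subseteq> V" and int: "integral_extension R T V"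
  shows "t_closure R T V \<in> intermediate_rings R T V" "infra_integral R T (t_closure R T V)"
    "\<And>B. \<lbrakk>B \<in> intermediate_rings R T V; infra_integral R T B\<rbrakk> \<Longrightarrow> B \<subseteq> t_closure R T V"
proof -
  define F where "F = {B \<in> intermediate_rings R T V. infra_integral R T B}"
  define G where "G = subring_closure (\<Union>F)"
  have F: "F \<subseteq> intermediate_rings R T V" "\<And>B. B \<in> F \<Longrightarrow> infra_integral R T B" unfolding F_def by auto
  have "T \<in> F"
    unfolding F_def intermediate_rings_def using T TV infra_integral_refl[OF T int TV] by blast
  then have "F \<noteq> {}" by blast
  note G = infra_integral_subring_closure[OF T V int F(1) this F(2), folded G_def]
  have "B \<subseteq> G" if "B \<in> F" for B
    using that unfolding G_def subring_closure_def by blast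
  then have le: "B \<subseteq> G" if "B \<in> intermediate_rings R T V" "infra_integral R T B" for B
    using that unfolding F_def by blast
  have "t_closure R T V = G"
    unfolding t_closure_def by (rule Greatest_equality) (use G le in blast)+
  then show "t_closure R T V \<in> intermediate_rings R T V" "infra_integral R T (t_closure R T V)"
    "\<And>B. \<lbrakk>B \<in> intermediate_rings R T V; infra_integral R T B\<rbrakk> \<Longrightarrow> B \<subseteq> t_closure R T V"
    using G le by auto
qed

lemma seminormalization_greatest:
  assumes T: "subring T R" and V: "subring V R" and TV: "T \<subseteq> V" and int: "integral_extension R T V"
  shows "seminormalization R T V \<in> intermediate_rings R T V" "subintegral R T (seminormalization R T V)"
    "\<And>B. \<lbrakk>B \<in> intermediate_rings R T V; subintegral R T B\<rbrakk> \<Longrightarrow> B \<subseteq> seminormalization R T V"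
proof -
  define F where "F = {B \<in> intermediate_rings R T V. subintegral R T B}"
  define G where "G = subring_closure (\<Union>F)"
  have F: "F \<subseteq> intermediate_rings R T V" "\<And>B. B \<in> F \<Longrightarrow> subintegral R T B"
    "\<And>B. B \<in> F \<Longrightarrow> infra_integral R T B" unfolding F_def subintegral_def by auto
  have "T \<in> F"
    unfolding F_def intermediate_rings_def using T TV subintegral_refl[OF T int TV] by blast
  then have ne: "F \<noteq> {}" by blast
  have G: "G \<in> intermediate_rings R T V" "subintegral R T G"
    unfolding G_def using infra_integral_subring_closure(1)[OF T V int F(1) ne F(3)]
      subintegral_subring_closure[OF T V int F(1) ne F(2)] by auto
  have "B \<subseteq> G" if "B \<in> F" for B
    using that unfolding G_def subring_closure_def by blast
  then have le: "B \<subseteq> G" if "B \<in> intermediate_rings R T V" "subintegral R T B" for B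
    using that unfolding F_def by blast
  have "seminormalization R T V = G"
    unfolding seminormalization_def by (rule Greatest_equality) (use G le in blast)+
  then show "seminormalization R T V \<in> intermediate_rings R T V" "subintegral R T (seminormalization R T V)"
    "\<And>B. \<lbrakk>B \<in> intermediate_rings R T V; subintegral R T B\<rbrakk> \<Longrightarrow> B \<subseteq> seminormalization R T V"
    using G le by auto
qed

text \<open>Only \<open>b\<close> needs a fraction at \<open>Q\<close>. If \<open>c\<close> is
  outside \<open>Q\<close>, then \<open>b = (c b) / c\<close> with \<open>c b\<close> in
  \<open>T\<close>. Otherwise \<open>b (b - 1) = c\<close> lies in \<open>Q\<close>, and
  \<open>b\<close> is congruent to 0 or 1.\<close>

lemma infra_integral_adjoin_anodal:
  assumes T: "subring T R" and V: "subring V R" and TV: "T \<subseteq> V" and int: "integral_extension R T V"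
    and b: "b \<in> V" and c: "c \<in> T" "b \<otimes> b = c \<oplus> b" "c \<otimes> b \<in> T"
  defines "B \<equiv> {x \<oplus> y \<otimes> b | x y. x \<in> T \<and> y \<in> T}"
  shows "B \<in> intermediate_rings R T V" "infra_integral R T B"
proof -
  note TE = subringE[OF T]
  have bc: "b \<in> carrier R" using b V by blast
  have cc: "c \<in> carrier R" using c TE(1) by blast
  have "b \<otimes> b = c \<oplus> \<one> \<otimes> b" using c(2) bc by simp
  note B = subring_adjoin_quadratic[OF T bc c(1) TE(3) this, folded B_def]
  have BV: "B \<subseteq> V" using B(4)[OF V TV b] .
  show "B \<in> intermediate_rings R T V" unfolding intermediate_rings_def using B(1,2) BV by blast
  show "infra_integral R T B"
    unfolding infra_integral_iff[OF T B(1,2)]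
  proof (intro conjI allI impI)
    show "integral_extension R T B" using integral_extension_mono[OF int] BV by blast
    fix Q assume Q: "primeideal Q (sub_ring R B)"
    note QD = primeideal_subringD[OF B(1) Q]
    note QI = ideal_subringD[OF B(1) QD(1)]
    let ?W = "{x \<in> B. \<exists>s\<in>T - Q. \<exists>t\<in>T. s \<otimes> x \<ominus> t \<in> Q}"
    have one: "\<one> \<in> T - Q" using TE(3) QD(2) by blast
    have "t \<in> ?W" if t: "t \<in> T" for t
    proof -
      have "t \<in> carrier R" using t TE(1) by blast
      then have "\<one> \<otimes> t \<ominus> t = \<zero>" by algebra
      then have "\<one> \<otimes> t \<ominus> t \<in> Q" using QI(2) by (simp only:)
      then show ?thesis using t one B(2) by blast
    qed
    moreover have "b \<in> ?W"
    proof (cases "c \<in> Q")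
      case False
      have "c \<otimes> b \<ominus> c \<otimes> b = \<zero>" using cc bc by algebra
      then have "c \<otimes> b \<ominus> c \<otimes> b \<in> Q" using QI(2) by (simp only:)
      then show ?thesis using False c B(3) by blast
    next
      case True
      have bm: "\<one> \<otimes> b \<ominus> \<one> \<in> B"
        using subring_minus_closed[OF B(1) B(3) subringE(3)[OF B(1)]] bc by simp
      have "b \<otimes> (\<one> \<otimes> b \<ominus> \<one>) = b \<otimes> b \<ominus> b" using bc by algebra
      also have "\<dots> = c" unfolding c(2) using bc cc by algebra
      finally have "b \<in> Q \<or> \<one> \<otimes> b \<ominus> \<one> \<in> Q" using QD(3)[OF B(3) bm] True by simp
      moreover have "\<one> \<otimes> b \<ominus> \<zero> = b" using bc by algebra
      ultimately have "\<one> \<otimes> b \<ominus> \<zero> \<in> Q \<or> \<one> \<otimes> b \<ominus> \<one> \<in> Q" by (simp only:)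
      then show ?thesis using one B(3) TE(2,3) by blast
    qed
    ultimately have "B \<subseteq> ?W"
      using B(4)[OF subring_fraction_mod_ideal[OF T B(1,2) Q QD(1)]] by blast
    then show "\<forall>b\<in>B. \<exists>s\<in>T - Q. \<exists>t\<in>T. s \<otimes> b \<ominus> t \<in> Q" by blast
  qed
qed

text \<open>Injectivity passes to the t-closure, which thereby is subintegral and lies below the
  seminormalization; the other inclusion holds as subintegral includes infra-integral.\<close>

theorem i_extension_imp_seminormalization_eq_t_closure:
  assumes T: "subring T R" and V: "subring V R" and TV: "T \<subseteq> V" and int: "integral_extension R T V"
    and i: "i_extension R T V"
  shows "seminormalization R T V = t_closure R T V"
proof -
  note t = t_closure_greatest[OF T V TV int]
  note s = seminormalization_greatest[OF T V TV int]
  have tc: "subring (t_closure R T V) R" "T \<subseteq> t_closure R T V" "t_closure R T V \<subseteq> V"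
    using t(1) unfolding intermediate_rings_def by auto
  have "i_extension R T (t_closure R T V)"
    using i_extension_subextension[OF T tc(1) T V subset_refl tc(2,3) int i] .
  then have "subintegral R T (t_closure R T V)" using t(2) unfolding subintegral_def by blast
  then have "t_closure R T V \<subseteq> seminormalization R T V" using s(3) t(1) by blast
  moreover have "seminormalization R T V \<subseteq> t_closure R T V"
    using t(3)[OF s(1)] s(2) unfolding subintegral_def by blast
  ultimately show ?thesis by blast
qed

theorem seminormalization_eq_t_closure_imp_u_closed:
  assumes T: "subring T R" and V: "subring V R" and TV: "T \<subseteq> V" and int: "integral_extension R T V"
    and eq: "seminormalization R T V = t_closure R T V"
  shows "u_closed R T V"
  unfolding u_closed_def
proof (intro ballI impI)
  note t = t_closure_greatest[OF T V TV int]
  note s = seminormalization_greatest[OF T V TV int]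
  have sn: "subring (seminormalization R T V) R" "T \<subseteq> seminormalization R T V"
    "seminormalization R T V \<subseteq> V"
    using s(1) unfolding intermediate_rings_def by auto
  fix b assume b: "b \<in> V" and b23: "b [^] (2::nat) \<ominus> b \<in> T" "b [^] (3::nat) \<ominus> b [^] (2::nat) \<in> T"
  have bc: "b \<in> carrier R" using b V by blast
  obtain c where c: "c \<in> T" "b \<otimes> b = c \<oplus> b" "c \<otimes> b \<in> T" using anodal_element[OF T bc b23] .
  have "b \<otimes> b = c \<oplus> \<one> \<otimes> b" using c(2) bc by simp
  note B = subring_adjoin_quadratic(3)[OF T bc c(1) subringE(3)[OF T] this]
  then have bs: "b \<in> seminormalization R T V"
    unfolding eq using t(3)[OF infra_integral_adjoin_anodal[OF T V TV int b c]] by blast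
  have "integral_extension R T (seminormalization R T V)" "i_extension R T (seminormalization R T V)"
    using s(2) unfolding subintegral_def infra_integral_def by auto
  \<comment> \<open>The seminormalization is an i-extension of \<open>T\<close>, hence u-closed over
    \<open>T\<close>, and it contains \<open>b\<close> because it equals the t-closure.\<close>
  from i_extension_imp_u_closed[OF T sn(1,2) this] show "b \<in> T"
    using bs b23 unfolding u_closed_def by blast
qed

end

subsection \<open>Minimal subextensions\<close>

context cring
begin

lemma quot_map_image:
  assumes "subring T R" "subring U R" "T \<subseteq> U" "ideal M (sub_ring R U)" "ideal M (sub_ring R T)"
  shows "quot_map R M ` carrier (sub_ring R T Quot M) = (\<lambda>t. M +> t) ` T"
  unfolding subring_Quot_carrier image_image
  using quot_map_coset[OF assms subset_refl] by simp

text \<open>The correspondence between subrings of \<open>U/M\<close> and subrings of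
  \<open>U\<close> containing \<open>M\<close>, restricted to those above \<open>T\<close>. It
  applies because \<open>M\<close> is an ideal of \<open>U\<close> inside \<open>T\<close>.\<close>

lemma minimal_extension_Quot_conductor:
  assumes min: "minimal_extension R T U"
  defines "M \<equiv> conductor R T U"
  shows "minimal_extension (sub_ring R U Quot M)
    (quot_map R M ` carrier (sub_ring R T Quot M)) (carrier (sub_ring R U Quot M))"
proof -
  note D = minimal_extensionD[OF min]
  note TE = subringE[OF D(3)]
  note UE = subringE[OF D(4)]
  note M = conductor_ideal[OF D(3,4,1), folded M_def]
  interpret U: cring "sub_ring R U" using D(4) by (rule subring_is_cring)
  interpret E: ring "sub_ring R U Quot M" using ideal.quotient_is_ring[OF M(2)] .
  have h: "ring_hom_ring (sub_ring R U) (sub_ring R U Quot M) (\<lambda>u. M +> u)"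
    using ideal.rcos_ring_hom_ring[OF M(2)] unfolding a_r_coset_subring .
  have "subring T (sub_ring R U)"
    using U.ring_incl_imp_subring[of T] subring_is_ring[OF D(3)] D(1) by simp
  from ring_hom_ring.img_is_subring[OF h this]
  have K: "subring ((\<lambda>t. M +> t) ` T) (sub_ring R U Quot M)" .
  have car: "carrier (sub_ring R U Quot M) = (\<lambda>u. M +> u) ` U" by (rule subring_Quot_carrier)
  note ops = subring_Quot_ops[OF D(4) M(2)]
  \<comment> \<open>An intermediate ring contains \<open>M\<close> and is therefore a union of
    cosets of \<open>M\<close>.\<close>
  have meet: "u \<in> B" if "u \<in> U" "b \<in> B" "M +> u = M +> b" "T \<subseteq> B" "subring B R" "B \<subseteq> U" for u b B
  proof -
    have "u \<ominus> b \<in> M"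
      using that subring_Quot_coset_eq_iff[OF D(4) M(2) that(1), of b] by blast
    then have "(u \<ominus> b) \<oplus> b \<in> B" using that M(1) subringE(7)[OF that(5)] by blast
    moreover have "u \<in> carrier R" "b \<in> carrier R" using that UE(1) by blast+
    then have "(u \<ominus> b) \<oplus> b = u" by algebra
    ultimately show ?thesis by simp
  qed
  have "(\<lambda>t. M +> t) ` T \<noteq> (\<lambda>u. M +> u) ` U"
  proof
    assume eq: "(\<lambda>t. M +> t) ` T = (\<lambda>u. M +> u) ` U"
    have "u \<in> T" if u: "u \<in> U" for u
    proof -
      have "M +> u \<in> (\<lambda>t. M +> t) ` T" unfolding eq using u by blast
      then show ?thesis using meet[OF u _ _ subset_refl D(3) D(1)] by blast
    qed
    then show False using D(1,2) by blast
  qed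
  then have psub: "(\<lambda>t. M +> t) ` T \<subset> (\<lambda>u. M +> u) ` U" using D(1) by blast
  have only: "B' = (\<lambda>t. M +> t) ` T \<or> B' = (\<lambda>u. M +> u) ` U"
    if B': "subring B' (sub_ring R U Quot M)" "(\<lambda>t. M +> t) ` T \<subseteq> B'" "B' \<subseteq> (\<lambda>u. M +> u) ` U" for B'
  proof -
    define B where "B = {u \<in> U. M +> u \<in> B'}"
    have "subring B R"
    proof (rule subringI)
      show "B \<subseteq> carrier R" unfolding B_def using UE(1) by blast
      show "\<one> \<in> B" unfolding B_def using UE(3) TE(3) B'(2) by blast
    next
      fix u v assume uv: "u \<in> B" "v \<in> B"
      then have uvU: "u \<in> U" "v \<in> U" and uvB: "M +> u \<in> B'" "M +> v \<in> B'" unfolding B_def by auto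
      show "u \<otimes> v \<in> B" unfolding B_def
        using UE(6)[OF uvU] subringE(6)[OF B'(1) uvB] unfolding ops(1)[OF uvU] by blast
      show "u \<oplus> v \<in> B" unfolding B_def
        using UE(7)[OF uvU] subringE(7)[OF B'(1) uvB] unfolding ops(2)[OF uvU] by blast
    next
      fix u assume u: "u \<in> B"
      then have uU: "u \<in> U" and uB: "M +> u \<in> B'" unfolding B_def by auto
      have m1: "\<ominus> \<one> \<in> T" "\<ominus> \<one> \<in> U" using TE(3,5) UE(3,5) by auto
      then have "M +> (\<ominus> \<one>) \<in> B'" using B'(2) by blast
      then have "M +> (\<ominus> \<one> \<otimes> u) \<in> B'"
        using subringE(6)[OF B'(1) _ uB] unfolding ops(1)[OF m1(2) uU, symmetric] by blast
      moreover have "u \<in> carrier R" using uU UE(1) by blast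
      then have "\<ominus> \<one> \<otimes> u = \<ominus> u" by algebra
      ultimately show "\<ominus> u \<in> B" unfolding B_def using UE(5)[OF uU] by simp
    qed
    moreover have "T \<subseteq> B" "B \<subseteq> U" unfolding B_def using B'(2) D(1) by auto
    ultimately have "B = T \<or> B = U" using D(5) by blast
    moreover have "B' = (\<lambda>u. M +> u) ` B" unfolding B_def using B'(3) by blast
    ultimately show ?thesis by blast
  qed
  have E: "subring ((\<lambda>u. M +> u) ` U) (sub_ring R U Quot M)"
    using E.carrier_is_subring unfolding car .
  have "intermediate_rings (sub_ring R U Quot M) ((\<lambda>t. M +> t) ` T) ((\<lambda>u. M +> u) ` U)
      = {(\<lambda>t. M +> t) ` T, (\<lambda>u. M +> u) ` U}" (is "?I = {?K, ?E}")
  proof (rule subset_antisym)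
    show "?I \<subseteq> {?K, ?E}"
      unfolding intermediate_rings_def by (rule subsetI, drule CollectD) (use only in simp)
    show "{?K, ?E} \<subseteq> ?I" unfolding intermediate_rings_def using K E psubset_imp_subset[OF psub] by simp
  qed
  then show ?thesis
    unfolding quot_map_image[OF D(3,4,1) M(2,3)] car minimal_extension_def using psub by blast
qed

text \<open>Over the field \<open>T/M\<close>, the ring \<open>U/M\<close> has basis 1 and the class
  of \<open>y\<close>, with square zero. The maximal ideal asked for is
  \<open>M + T y\<close>.\<close>

lemma ramifiedI:
  assumes min: "minimal_extension R T U" and int: "integral_extension R T U"
    and y: "y \<in> U" "y \<notin> conductor R T U" "y \<otimes> y \<in> conductor R T U"
  shows "ramified R T U"
proof -
  define M where "M = conductor R T U"
  note D = minimal_extensionD[OF min]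
  note TE = subringE[OF D(3)]
  note UE = subringE[OF D(4)]
  note M = conductor_ideal[OF D(3,4,1), folded M_def]
  note Mc = minimal_integral_conductor[OF min int, folded M_def]
  note MT = ideal_subringD[OF D(3) M(3)]
  note MU = ideal_subringD[OF D(4) M(2)]
  have yM: "y \<notin> M" "y \<otimes> y \<in> M" using y unfolding M_def by auto
  have yc: "y \<in> carrier R" using y UE(1) by blast
  \<comment> \<open>\<open>T/M\<close> is a field and has no nonzero element of square zero.\<close>
  have yT: "y \<notin> T"
  proof
    assume "y \<in> T"
    then obtain s where s: "s \<in> T" "\<one> \<ominus> y \<otimes> s \<in> M" using Mc(2) yM by blast
    have sc: "s \<in> carrier R" using s TE(1) by blast
    have "y = y \<otimes> (\<one> \<ominus> y \<otimes> s) \<oplus> s \<otimes> (y \<otimes> y)" using yc sc by algebra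
    also have "\<dots> \<in> M" using MT(3) MT(4)[OF \<open>y \<in> T\<close> s(2)] MT(4)[OF s(1) yM(2)] by blast
    finally show False using yM by blast
  qed
  have "y \<otimes> y = y \<otimes> y \<oplus> \<zero> \<otimes> y" using yc by simp
  note B = subring_adjoin_quadratic[OF D(3) yc subsetD[OF M(1) yM(2)] TE(2) this]
  have Ueq: "U = {x \<oplus> t \<otimes> y | x t. x \<in> T \<and> t \<in> T}"
    using D(5)[OF B(1,2) B(4)[OF D(4,1) y(1)]] B(3) yT by blast
  define N where "N = {m \<oplus> t \<otimes> y | m t. m \<in> M \<and> t \<in> T}"
  \<comment> \<open>Independence of 1 and \<open>y\<close> over \<open>T/M\<close>: if
    \<open>(r - t) y\<close> is in \<open>T\<close> with \<open>r - t\<close> invertible modulo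
    \<open>M\<close>, then \<open>y\<close> is in \<open>T\<close>.\<close>
  have mem: "x \<oplus> t \<otimes> y \<in> N \<longleftrightarrow> x \<in> M" if xt: "x \<in> T" "t \<in> T" for x t
  proof
    assume "x \<oplus> t \<otimes> y \<in> N"
    then obtain m r where mr: "m \<in> M" "r \<in> T" "x \<oplus> t \<otimes> y = m \<oplus> r \<otimes> y" unfolding N_def by blast
    have c: "x \<in> carrier R" "t \<in> carrier R" "m \<in> carrier R" "r \<in> carrier R"
      using xt mr M(1) TE(1) by blast+
    have rt: "r \<ominus> t \<in> T" using subring_minus_closed[OF D(3)] mr xt by blast
    have "(r \<ominus> t) \<otimes> y = (m \<oplus> r \<otimes> y) \<ominus> m \<ominus> t \<otimes> y" using c yc by algebra
    also have "\<dots> = x \<ominus> m" unfolding mr(3)[symmetric] using c yc by algebra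
    finally have eq: "(r \<ominus> t) \<otimes> y = x \<ominus> m" .
    have "r \<ominus> t \<in> M"
    proof (rule ccontr)
      assume "r \<ominus> t \<notin> M"
      then obtain s where s: "s \<in> T" "\<one> \<ominus> (r \<ominus> t) \<otimes> s \<in> M" using Mc(2) rt by blast
      have sc: "s \<in> carrier R" using s TE(1) by blast
      have "y = (\<one> \<ominus> (r \<ominus> t) \<otimes> s) \<otimes> y \<oplus> s \<otimes> ((r \<ominus> t) \<otimes> y)" using yc sc c by algebra
      also have "\<dots> = (\<one> \<ominus> (r \<ominus> t) \<otimes> s) \<otimes> y \<oplus> s \<otimes> (x \<ominus> m)" unfolding eq ..
      also have "\<dots> \<in> T"
        using TE(7) subsetD[OF M(1) MU(5)[OF y(1) s(2)]]
          TE(6)[OF s(1) subring_minus_closed[OF D(3) xt(1) subsetD[OF M(1) mr(1)]]] by blast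
      finally show False using yT by blast
    qed
    then have "m \<oplus> (r \<ominus> t) \<otimes> y \<in> M" using MU(3)[OF mr(1)] MU(5)[OF y(1)] by blast
    moreover have "m \<oplus> (r \<ominus> t) \<otimes> y = x" unfolding eq using c by algebra
    ultimately show "x \<in> M" by simp
  qed (use xt N_def in blast)
  have memT: "x \<in> N \<longleftrightarrow> x \<in> M" if x: "x \<in> T" for x
  proof -
    have "x \<oplus> \<zero> \<otimes> y = x" using x TE(1) yc by auto
    then show ?thesis using mem[OF x TE(2)] by simp
  qed
  then have NT: "M = N \<inter> T" using M(1) by blast
  have NI: "ideal N (sub_ring R U)"
    unfolding ideal_subring_iff[OF D(4)]
  proof (intro conjI ballI)
    show "N \<subseteq> U" unfolding N_def Ueq using M(1) by blast
    show "\<zero> \<in> N" using memT[OF TE(2)] MT(2) by blast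
  next
    fix a b assume "a \<in> N" "b \<in> N"
    then obtain m t m' t' where ab: "m \<in> M" "t \<in> T" "a = m \<oplus> t \<otimes> y" "m' \<in> M" "t' \<in> T" "b = m' \<oplus> t' \<otimes> y"
      unfolding N_def by blast
    have c: "m \<in> carrier R" "t \<in> carrier R" "m' \<in> carrier R" "t' \<in> carrier R"
      using ab M(1) TE(1) by blast+
    have "a \<oplus> b = (m \<oplus> m') \<oplus> (t \<oplus> t') \<otimes> y" unfolding ab using c yc by algebra
    then show "a \<oplus> b \<in> N" unfolding N_def using MT(3)[OF ab(1,4)] TE(7)[OF ab(2,5)] by blast
  next
    fix u a assume "u \<in> U" "a \<in> N"
    then obtain x s m t where ua: "x \<in> T" "s \<in> T" "u = x \<oplus> s \<otimes> y" "m \<in> M" "t \<in> T" "a = m \<oplus> t \<otimes> y"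
      unfolding N_def Ueq by blast
    have c: "m \<in> carrier R" "t \<in> carrier R" "x \<in> carrier R" "s \<in> carrier R"
      using ua M(1) TE(1) by blast+
    have "u \<otimes> a = (x \<otimes> m \<oplus> (s \<otimes> t) \<otimes> (y \<otimes> y)) \<oplus> (x \<otimes> t \<oplus> s \<otimes> m) \<otimes> y"
      unfolding ua using c yc by algebra
    moreover have "x \<otimes> m \<oplus> (s \<otimes> t) \<otimes> (y \<otimes> y) \<in> M"
      using MT(3)[OF MT(4)[OF ua(1,4)] MT(4)[OF TE(6)[OF ua(2,5)] yM(2)]] .
    moreover have "x \<otimes> t \<oplus> s \<otimes> m \<in> T"
      using TE(7)[OF TE(6)[OF ua(1,5)] TE(6)[OF ua(2) subsetD[OF M(1) ua(4)]]] .
    ultimately show "u \<otimes> a \<in> N" unfolding N_def by blast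
  qed
  have Nmax: "maximalideal N (sub_ring R U)"
  proof (rule maximalideal_subringI[OF D(4) NI])
    show "\<one> \<notin> N" using memT[OF TE(3)] Mc(1) by blast
    fix u assume u: "u \<in> U" "u \<notin> N"
    then obtain x s where xs: "x \<in> T" "s \<in> T" "u = x \<oplus> s \<otimes> y" unfolding Ueq by blast
    then have "x \<notin> M" using u mem by blast
    then obtain r where r: "r \<in> T" "\<one> \<ominus> x \<otimes> r \<in> M" using Mc(2) xs by blast
    have c: "x \<in> carrier R" "s \<in> carrier R" "r \<in> carrier R" using xs r TE(1) by blast+
    have "\<one> \<ominus> u \<otimes> r = (\<one> \<ominus> x \<otimes> r) \<oplus> (\<ominus> (s \<otimes> r)) \<otimes> y" unfolding xs using c yc by algebra
    then have "\<one> \<ominus> u \<otimes> r \<in> N" unfolding N_def using r(2) TE(5)[OF TE(6)[OF xs(2) r(1)]] by blast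
    then show "\<exists>v\<in>U. \<one> \<ominus> u \<otimes> v \<in> N" using r D(1) by blast
  qed
  have prod: "a \<otimes> b \<in> M" if abN: "a \<in> N" "b \<in> N" for a b
  proof -
    obtain m t m' t' where ab: "m \<in> M" "t \<in> T" "a = m \<oplus> t \<otimes> y" "m' \<in> M" "t' \<in> T" "b = m' \<oplus> t' \<otimes> y"
      using abN unfolding N_def by blast
    have c: "m \<in> carrier R" "t \<in> carrier R" "m' \<in> carrier R" "t' \<in> carrier R"
      using ab M(1) TE(1) by blast+
    have tU: "t \<in> U" "t' \<in> U" using ab D(1) by auto
    have bU: "m' \<oplus> t' \<otimes> y \<in> U"
      using UE(7)[OF subsetD[OF MU(1) ab(4)] UE(6)[OF tU(2) y(1)]] .
    have "a \<otimes> b = (m' \<oplus> t' \<otimes> y) \<otimes> m \<oplus> ((t \<otimes> y) \<otimes> m' \<oplus> (t \<otimes> t') \<otimes> (y \<otimes> y))"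
      unfolding ab using c yc by algebra
    also have "\<dots> \<in> M"
      using MU(3)[OF MU(4)[OF bU ab(1)]
          MU(3)[OF MU(4)[OF UE(6)[OF tU(1) y(1)] ab(4)] MU(4)[OF UE(6)[OF tU] yM(2)]]] .
    finally show ?thesis .
  qed
  have "ideal_prod (sub_ring R U) N N \<subseteq> M"
  proof
    fix z assume "z \<in> ideal_prod (sub_ring R U) N N"
    then show "z \<in> M"
      by (induct rule: ideal_prod.induct) (use prod MU(3) in auto)
  qed
  moreover have "M \<subset> N"
  proof -
    have "y = \<zero> \<oplus> \<one> \<otimes> y" using yc by simp
    then have "y \<in> N" unfolding N_def using MT(2) TE(3) by blast
    then show ?thesis using NT yM by blast
  qed
  moreover have "ring.dimension (sub_ring R U Quot M) 2
      (quot_map R M ` carrier (sub_ring R T Quot M)) (carrier (sub_ring R U Quot M))"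
  proof -
    interpret E: ring "sub_ring R U Quot M" using ideal.quotient_is_ring[OF M(2)] .
    note ops = subring_Quot_ops[OF D(4) M(2)]
    define K where "K = (\<lambda>t. M +> t) ` T"
    have car: "carrier (sub_ring R U Quot M) = (\<lambda>u. M +> u) ` U" by (rule subring_Quot_carrier)
    \<comment> \<open>The dimension is built up one vector at a time: from zero by 1 to
      \<open>K\<close>, then by the class of \<open>y\<close> to \<open>U/M\<close>.\<close>
    have "K = E.line_extension K \<one>\<^bsub>sub_ring R U Quot M\<^esub> {\<zero>\<^bsub>sub_ring R U Quot M\<^esub>}"
    proof -
      have "K \<subseteq> carrier (sub_ring R U Quot M)" unfolding car K_def using D(1) by blast
      then have "k \<otimes>\<^bsub>sub_ring R U Quot M\<^esub> \<one>\<^bsub>sub_ring R U Quot M\<^esub> \<oplus>\<^bsub>sub_ring R U Quot M\<^esub> \<zero>\<^bsub>sub_ring R U Quot M\<^esub> = k"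
        if "k \<in> K" for k using that by auto
      then show ?thesis by (auto simp: E.line_extension_mem_iff)
    qed
    moreover have "\<one>\<^bsub>sub_ring R U Quot M\<^esub> \<notin> {\<zero>\<^bsub>sub_ring R U Quot M\<^esub>}"
      unfolding ops(3)[OF UE(3,3)] subring_Quot_zero
      using subring_Quot_coset_eq_zero_iff[OF D(4) M(2) UE(3)] Mc(1) by blast
    ultimately have K1: "E.dimension 1 K K"
      using E.Suc_dim[OF E.one_closed _ E.zero_dim, of K] by simp
    have yE: "M +> y \<in> carrier (sub_ring R U Quot M)" unfolding car using y(1) by blast
    have yK: "M +> y \<notin> K"
    proof
      assume "M +> y \<in> K"
      then obtain t where t: "t \<in> T" "M +> y = M +> t" unfolding K_def by blast
      have tU: "t \<in> U" and tc: "t \<in> carrier R" using t D(1) TE(1) by blast+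
      have "y \<ominus> t \<in> M" using t(2) subring_Quot_coset_eq_iff[OF D(4) M(2) y(1) tU] by blast
      then have "(y \<ominus> t) \<oplus> t \<in> T" using M(1) TE(7) t(1) by blast
      moreover have "(y \<ominus> t) \<oplus> t = y" using yc tc by algebra
      ultimately show False using yT by simp
    qed
    have "E.line_extension K (M +> y) K = (\<lambda>u. M +> u) ` U"
    proof -
      have eq: "(M +> t) \<otimes>\<^bsub>sub_ring R U Quot M\<^esub> (M +> y) \<oplus>\<^bsub>sub_ring R U Quot M\<^esub> (M +> x) = M +> (x \<oplus> t \<otimes> y)"
        if "t \<in> T" "x \<in> T" for t x
      proof -
        have tx: "t \<in> U" "x \<in> U" and c: "t \<in> carrier R" "x \<in> carrier R"
          using that D(1) TE(1) by blast+
        have "t \<otimes> y \<oplus> x = x \<oplus> t \<otimes> y" using c yc by algebra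
        then show ?thesis
          unfolding ops(1)[OF tx(1) y(1)] ops(2)[OF UE(6)[OF tx(1) y(1)] tx(2)] by simp
      qed
      have "E.line_extension K (M +> y) K = {M +> (x \<oplus> t \<otimes> y) | x t. x \<in> T \<and> t \<in> T}"
        unfolding set_eq_iff E.line_extension_mem_iff K_def using eq by auto
      also have "\<dots> = (\<lambda>u. M +> u) ` U" unfolding Ueq by blast
      finally show ?thesis .
    qed
    then have "E.dimension (Suc 1) K (carrier (sub_ring R U Quot M))"
      using E.Suc_dim[OF yE yK K1] unfolding car by simp
    then show ?thesis
      unfolding quot_map_image[OF D(3,4,1) M(2,3)] K_def[symmetric] by (simp add: numeral_2_eq_2)
  qed
  moreover have "quot_map R N \<in> ring_iso (sub_ring R T Quot M) (sub_ring R U Quot N)"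
  proof -
    note h = quot_map_ring_hom[OF D(3,4,1) NI M(3) NT]
    have MN: "M \<subseteq> N" using NT by blast
    have "carrier (sub_ring R U Quot N) \<subseteq> quot_map R N ` carrier (sub_ring R T Quot M)"
    proof
      fix z assume "z \<in> carrier (sub_ring R U Quot N)"
      then obtain u where u: "u \<in> U" "z = N +> u" unfolding subring_Quot_carrier by blast
      then obtain x s where xs: "x \<in> T" "s \<in> T" "u = x \<oplus> s \<otimes> y" unfolding Ueq by blast
      have c: "x \<in> carrier R" "s \<in> carrier R" using xs TE(1) by blast+
      have "u \<ominus> x = \<zero> \<oplus> s \<otimes> y" unfolding xs using c yc by algebra
      then have "u \<ominus> x \<in> N" unfolding N_def using MT(2) xs(2) by blast
      then have "z = N +> x"
        unfolding u(2) using subring_Quot_coset_eq_iff[OF D(4) NI u(1) subsetD[OF D(1) xs(1)]] by blast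
      also have "\<dots> = quot_map R N (M +> x)"
        using quot_map_coset[OF D(3,4,1) NI M(3) MN xs(1)] by simp
      finally show "z \<in> quot_map R N ` carrier (sub_ring R T Quot M)"
        unfolding subring_Quot_carrier[of T] using xs(1) by blast
    qed
    then show ?thesis
      using h ring_hom_closed[OF h(1)] unfolding ring_iso_def bij_betw_def by blast
  qed
  moreover have "M \<in> Max_Spec (sub_ring R T)"
    unfolding Max_Spec_def using maximalideal_subringI[OF D(3) M(3) Mc] by blast
  ultimately show ?thesis
    unfolding ramified_def Let_def M_def[symmetric]
    using min minimal_integral_finite_extension[OF min int] Nmax unfolding Max_Spec_def by blast
qed

text \<open>Injectivity on spectra excludes the decomposed type, which has two maximal ideals over
  \<open>M\<close>. In the case without square-zero elements it makes \<open>U/M\<close> a domain,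
  and this domain is integral over the field \<open>T/M\<close>.\<close>

theorem minimal_i_extension_ramified_or_inert:
  assumes min: "minimal_extension R T U" and int: "integral_extension R T U"
    and i: "i_extension R T U"
  shows "ramified R T U \<or> inert R T U"
proof (cases "\<exists>y\<in>U. y \<notin> conductor R T U \<and> y \<otimes> y \<in> conductor R T U")
  case True
  then show ?thesis using ramifiedI[OF min int] by blast
next
  case False
  define M where "M = conductor R T U"
  note D = minimal_extensionD[OF min]
  note TE = subringE[OF D(3)]
  note UE = subringE[OF D(4)]
  note M = conductor_ideal[OF D(3,4,1), folded M_def]
  note Mc = minimal_integral_conductor[OF min int, folded M_def]
  note MU = ideal_subringD[OF D(4) M(2)]
  interpret U: cring "sub_ring R U" using D(4) by (rule subring_is_cring)
  have sq: "y \<otimes> y \<notin> M" if "y \<in> U" "y \<notin> M" for y using False that unfolding M_def by blast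
  \<comment> \<open>Absence of square-zero elements gives absence of nilpotents: repeated squaring
    handles exponents \<open>2 ^ k\<close>, and \<open>n\<close> is at most
    \<open>2 ^ n\<close>.\<close>
  have pow: "u [^] (n::nat) \<notin> M" if u: "u \<in> U" "u \<notin> M" for u n
  proof
    assume n: "u [^] n \<in> M"
    have uc: "u \<in> carrier R" using u UE(1) by blast
    have two: "u [^] ((2::nat) ^ k) \<notin> M" for k :: nat
    proof (induct k)
      case 0 then show ?case using u uc by simp
    next
      case (Suc k)
      have "u [^] ((2::nat) ^ Suc k) = u [^] ((2::nat) ^ k) \<otimes> u [^] ((2::nat) ^ k)"
        using nat_pow_mult[OF uc] by (simp add: mult_2)
      then show ?case using sq[OF subring_pow_closed[OF D(4) u(1)] Suc] by simp
    qed
    have "n + (2 ^ n - n) = (2::nat) ^ n" using less_exp[of n] by simp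
    then have "u [^] ((2::nat) ^ n) = u [^] n \<otimes> u [^] (2 ^ n - n)"
      using nat_pow_mult[OF uc, of n "2 ^ n - n"] by simp
    then show False using two[of n] MU(5)[OF subring_pow_closed[OF D(4) u(1)] n] by simp
  qed
  \<comment> \<open>A prime above \<open>M\<close> that avoids all powers of \<open>u\<close>; its
    trace on \<open>T\<close> is a proper ideal above \<open>M\<close>, hence \<open>M\<close> by
    maximality.\<close>
  have ex: "\<exists>Q. primeideal Q (sub_ring R U) \<and> M \<subseteq> Q \<and> u \<notin> Q \<and> Q \<inter> T = M" if u: "u \<in> U" "u \<notin> M" for u
  proof -
    have uc: "u \<in> carrier R" using u UE(1) by blast
    obtain Q where Q: "primeideal Q (sub_ring R U)" "M \<subseteq> Q" "Q \<inter> range (\<lambda>n::nat. u [^] n) = {}"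
    proof (rule U.ex_primeideal_disjoint[of M "range (\<lambda>n::nat. u [^] n)"])
      show "ideal M (sub_ring R U)" by (rule M(2))
      show "range (\<lambda>n::nat. u [^] n) \<subseteq> carrier (sub_ring R U)"
        using subring_pow_closed[OF D(4) u(1)] by auto
      have "\<one> = u [^] (0::nat)" by simp
      then have "\<one> \<in> range (\<lambda>n::nat. u [^] n)" by (rule range_eqI)
      then show "\<one>\<^bsub>sub_ring R U\<^esub> \<in> range (\<lambda>n::nat. u [^] n)" by simp
      show "v \<otimes>\<^bsub>sub_ring R U\<^esub> w \<in> range (\<lambda>n::nat. u [^] n)"
        if "v \<in> range (\<lambda>n::nat. u [^] n)" "w \<in> range (\<lambda>n::nat. u [^] n)" for v w
        using that nat_pow_mult[OF uc] by auto
      show "M \<inter> range (\<lambda>n::nat. u [^] n) = {}" using pow[OF u] by blast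
    qed blast
    note QD = primeideal_subringD[OF D(4) Q(1)]
    note QI = ideal_subringD[OF D(4) QD(1)]
    have "u [^] (1::nat) = u" using uc by simp
    then have "u \<notin> Q" using Q(3) by (metis disjoint_iff rangeI)
    moreover have "t \<in> M" if t: "t \<in> Q" "t \<in> T" for t
    proof (rule ccontr)
      assume "t \<notin> M"
      then obtain s where s: "s \<in> T" "\<one> \<ominus> t \<otimes> s \<in> M" using Mc(2) t by blast
      have c: "t \<in> carrier R" "s \<in> carrier R" using t s TE(1) by blast+
      have "(\<one> \<ominus> t \<otimes> s) \<oplus> t \<otimes> s \<in> Q"
        using QI(3)[OF subsetD[OF Q(2) s(2)] QI(5)[OF subsetD[OF D(1) s(1)] t(1)]] .
      moreover have "(\<one> \<ominus> t \<otimes> s) \<oplus> t \<otimes> s = \<one>" using c by algebra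
      ultimately show False using QD(2) by simp
    qed
    ultimately show ?thesis using Q M(1) by blast
  qed
  \<comment> \<open>One prime over \<open>M\<close>, obtained from \<open>u = \<one>\<close>. By
    injectivity all primes given by \<open>ex\<close> equal this one, so it avoids every element
    outside \<open>M\<close>.\<close>
  obtain Q where Q: "primeideal Q (sub_ring R U)" "M \<subseteq> Q" "Q \<inter> T = M"
    using ex[OF UE(3) Mc(1)] by blast
  have "u \<in> M" if u: "u \<in> Q" for u
  proof (rule ccontr)
    assume "u \<notin> M"
    moreover have "u \<in> U"
      using u ideal_subringD(1)[OF D(4) primeideal_subringD(1)[OF D(4) Q(1)]] by blast
    ultimately obtain P where P: "primeideal P (sub_ring R U)" "u \<notin> P" "P \<inter> T = M"
      using ex by blast
    have "P = Q" using i P Q unfolding i_extension_def Spec_def inj_on_def by blast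
    then show False using P(2) u by blast
  qed
  then have "Q = M" using Q(2) by blast
  then have Mp: "primeideal M (sub_ring R U)" using Q(1) by simp
  note MpD = primeideal_subringD[OF D(4) Mp]
  \<comment> \<open>A domain integral over a field is a field: the prime \<open>M\<close> contains
    \<open>u [^] n (1 - w u)\<close> but no power of \<open>u\<close>, so \<open>w\<close> inverts
    \<open>u\<close> modulo \<open>M\<close>.\<close>
  have "maximalideal M (sub_ring R U)"
  proof (rule maximalideal_subringI[OF D(4) M(2) Mc(1)])
    fix u assume u: "u \<in> U" "u \<notin> M"
    obtain n w where nw: "w \<in> U" "u [^] (n::nat) \<otimes> (\<one> \<ominus> w \<otimes> u) \<in> M"
      using ex_power_multiple_mem_ideal[OF D(3,4,1) int M(2) subset_refl Mc u(1)] .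
    have "\<one> \<ominus> w \<otimes> u \<in> U"
      using subring_minus_closed[OF D(4) UE(3) UE(6)[OF nw(1) u(1)]] .
    then have "\<one> \<ominus> w \<otimes> u \<in> M"
      using MpD(3)[OF subring_pow_closed[OF D(4) u(1)] _ nw(2)] pow[OF u] by blast
    moreover have "w \<in> carrier R" "u \<in> carrier R" using nw u UE(1) by blast+
    then have "w \<otimes> u = u \<otimes> w" by (rule m_comm)
    ultimately show "\<exists>v\<in>U. \<one> \<ominus> u \<otimes> v \<in> M" using nw(1) by auto
  qed
  moreover have "maximalideal M (sub_ring R T)" using maximalideal_subringI[OF D(3) M(3) Mc] .
  ultimately have "inert R T U"
    unfolding inert_def Let_def M_def[symmetric] Max_Spec_def
    using min minimal_integral_finite_extension[OF min int]
      minimal_extension_Quot_conductor[OF min, folded M_def] by blast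
  then show ?thesis ..
qed

end

theorem proposition5p2:
  fixes S :: "('a, 'b) ring_scheme" and R :: "'a set"
  assumes "cring S" and "subring R S" and "R \<subset> carrier S"
    and "integral_extension S R (carrier S)"
    and "FCP S R (carrier S)"
  shows "(u_closed S R (carrier S) \<longleftrightarrow> i_extension S R (carrier S)) \<and>
         (i_extension S R (carrier S) \<longleftrightarrow>
            seminormalization S R (carrier S) = t_closure S R (carrier S)) \<and>
         (u_closed S R (carrier S) \<longrightarrow>
            (\<forall>T\<in>intermediate_rings S R (carrier S). \<forall>U\<in>intermediate_rings S R (carrier S).
               minimal_extension S T U \<longrightarrow> ramified S T U \<or> inert S T U))"
proof -
  interpret S: cring S by (rule assms(1))
  note V = S.carrier_is_subring
  have RV: "R \<subseteq> carrier S" using assms(3) by blast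
  note ext = assms(2) V RV assms(4)
  have u_i: "u_closed S R (carrier S) \<longleftrightarrow> i_extension S R (carrier S)"
    using S.u_closed_imp_i_extension[OF ext assms(5)] S.i_extension_imp_u_closed[OF ext] by blast
  \<comment> \<open>The backward direction goes through u-closedness: (3) => (1) => (2).\<close>
  have i_s: "i_extension S R (carrier S) \<longleftrightarrow>
      seminormalization S R (carrier S) = t_closure S R (carrier S)"
    using S.i_extension_imp_seminormalization_eq_t_closure[OF ext]
      S.seminormalization_eq_t_closure_imp_u_closed[OF ext] u_i by blast
  have "ramified S T U \<or> inert S T U"
    if u: "u_closed S R (carrier S)" and T: "T \<in> intermediate_rings S R (carrier S)"
      and U: "U \<in> intermediate_rings S R (carrier S)" and min: "minimal_extension S T U" for T U
  proof -
    have TU: "subring T S" "R \<subseteq> T" "subring U S" "U \<subseteq> carrier S" "T \<subseteq> U"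
      using T U min unfolding intermediate_rings_def minimal_extension_def by auto
    show ?thesis
      \<comment> \<open>Integrality and injectivity on spectra are inherited by
        \<open>T \<subseteq> U\<close>, the latter by lying over from \<open>U\<close> to
        \<open>S\<close>.\<close>
      using S.minimal_i_extension_ramified_or_inert[OF min
          S.integral_extension_mono[OF assms(4) TU(2,4)]
          S.i_extension_subextension[OF assms(2) TU(3,1) V TU(2,5,4) assms(4) u_i[THEN iffD1, OF u]]] .
  qed
  then show ?thesis using u_i i_s by blast
qed

end
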